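(* Let $\mathscr{V}$ be a topological category over $\mathsf{Set}$, with topological functor $|-| : \mathscr{V} \to \mathsf{Set}$, equipped with a symmetric monoidal structure $(\otimes, I)$ such that $|-|$ is strict symmetric monoidal with respect to the cartesian structure on $\mathsf{Set}$, and let $\mathcal{S}$ be a set. Let $\Sigma$ be a $\mathscr{V}$-enriched $\mathcal{S}$-sorted signature with underlying classical $\mathcal{S}$-sorted signature $|\Sigma|$. Then $U^\Sigma : \Sigma\text{-}\mathsf{Alg} \to \mathscr{V}^{\mathcal{S}}$ has a left adjoint $F^\Sigma : \mathscr{V}^{\mathcal{S}} \to \Sigma\text{-}\mathsf{Alg}$, and the resulting adjunction $F^\Sigma \dashv U^\Sigma$ is a lifting of the adjunction $F^{|\Sigma|} \dashv U^{|\Sigma|} : |\Sigma|\text{-}\mathsf{Alg} \to \mathsf{Set}^{\mathcal{S}}$ (along $|-|^\Sigma$ and $|-|^{\mathcal{S}}$). In particular, $|-|^\Sigma \circ F^\Sigma = F^{|\Sigma|} \circ |-|^{\mathcal{S}}$ strictly. For each object $X$ of $\mathscr{V}^{\mathcal{S}}$, the free $\Sigma$-algebra $F^\Sigma X$ on $X$ is the domain of the initial lift of the $|-|^\Sigma$-structured source $$\left(f^\sharp : F^{|\Sigma|}|X| \to |A|^\Sigma\right)_{(A, f) \in X \downarrow U^\Sigma}.$$ In particular, the carrier object $U^\Sigma F^\Sigma X$ of $\mathscr{V}^{\mathcal{S}}$ is the domain of the initial lift of the $|-|^{\mathcal{S}}$-structured source $$\left(f^\sharp : \mathsf{Term}_{|\Sigma|}(|X|)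 \to |A|^{\mathcal{S}}\right)_{(A, f) \in X \downarrow U^\Sigma}.$$
   Context: Topological categories. A concrete category over a category $\mathscr{X}$ is a category $\mathscr{V}$ with a faithful functor $|-| : \mathscr{V} \to \mathscr{X}$; an $\mathscr{X}$-morphism $f : |V| \to |W|$ is $\mathscr{V}$-admissible if it lifts (uniquely) to a morphism $V \to W$. The fibre $\mathsf{Fib}(X)$ of an object $X$ of $\mathscr{X}$ is the preordered class of objects $V$ with $|V| = X$, where $V \leq V'$ iff $1_X$ is an admissible morphism $V \to V'$; $\mathscr{V}$ is amnestic if all fibres are partially ordered. A (possibly large) source $(f_i : V \to V_i)_{i}$ is initial if for all $W$ and $f : |W| \to |V|$, $f$ is admissible iff all $f_i \circ f$ are. $\mathscr{V}$ (or $|-|$) is topological over $\mathscr{X}$ if it is amnestic and every (possibly large) structured source $(f_i : X \to |V_i|)_i$ has an initial lift: an object $V$ (the domain of the lift) with $|V| = X$, each $f_i$ admissible $V \to V_i$, and $(f_i : V \to V_i)_i$ initial. The category $\mathscr{V}^{\mathcal{S}}$ is topological over $\mathsf{Set}^{\mathcal{S}}$ via $|-|^{\mathcal{S}}$ (often written $|-|$), $|(V_S)_{S}| = (|V_S|)_{S}$. One has $|X \otimes Y| = |X| \times |Y|$, $|X \times Y| = |X| \times |Y|$, and $|I|$ is a singleton. $\mathcal{S}^*$ is the set of finite sequences of elements of $\mathcal{S}$ (sorts). Signatures. A $\mathscr{V}$-enriched $\mathcal{S}$-sorted signature is a set $\Sigma$ of operation symbols, each equipped with a type $((S_1, \ldots,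 S_n), S, P)$: input sorts $(S_1,\ldots,S_n) \in \mathcal{S}^*$, output sort $S \in \mathcal{S}$, parameter object $P \in \mathrm{ob}\,\mathscr{V}$. A $\Sigma$-algebra is an object $A = (A_S)_{S}$ of $\mathscr{V}^{\mathcal{S}}$ with, for each $\sigma \in \Sigma$ of type $((S_1, \ldots, S_n), S, P)$, a $\mathscr{V}$-morphism $\sigma^A : P \otimes (A_{S_1} \times \cdots \times A_{S_n}) \to A_S$. A morphism $f : A \to B$ of $\Sigma$-algebras is a morphism of $\mathscr{V}^{\mathcal{S}}$ with $f_S \circ \sigma^A = \sigma^B \circ (1_P \otimes (f_{S_1} \times \cdots \times f_{S_n}))$ for all $\sigma$. $U^\Sigma : \Sigma\text{-}\mathsf{Alg} \to \mathscr{V}^{\mathcal{S}}$ is the forgetful functor. A classical $\mathcal{S}$-sorted signature is the case $\mathscr{V} = \mathsf{Set}$ (cartesian) with all parameters equal to the one-point set (omitted from notation). Underlying classical signature. $|\Sigma|$ has an operation symbol $\sigma_p$ with input sorts $(S_1,\ldots,S_n)$ and output sort $S$ for each $\sigma \in \Sigma$ of type $((S_1,\ldots,S_n),S,P)$ and each $p \in |P|$. Each $\Sigma$-algebra $A$ has an underlying $|\Sigma|$-algebra $|A| = |A|^\Sigma$ with carrier $(|A_S|)_S$ and $\sigma_p^{|A|} = \sigma^A(p, -)$; this gives a faithful functor $|-|^\Sigma : \Sigma\text{-}\mathsf{Alg} \to |\Sigma|\text{-}\mathsf{Alg}$. Classical free algebras. For an $\mathcal{S}$-sorted set $Y$, $\mathsf{Term}_{|\Sigma|}(Y)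 = (\mathsf{Term}_{|\Sigma|}(Y)_S)_{S}$ is the $\mathcal{S}$-sorted set of ground terms with constants from $Y$: $Y_S \subseteq \mathsf{Term}_{|\Sigma|}(Y)_S$, and for each $\tau \in |\Sigma|$ with input sorts $(S_1, \ldots, S_n)$, output sort $S$, and $t_i \in \mathsf{Term}_{|\Sigma|}(Y)_{S_i}$, one has $\tau(t_1, \ldots, t_n) \in \mathsf{Term}_{|\Sigma|}(Y)_S$. With the evident operations it is the free $|\Sigma|$-algebra $F^{|\Sigma|} Y$, where $F^{|\Sigma|} \dashv U^{|\Sigma|}$, with unit $\eta$ given by the inclusions. $X \downarrow U^\Sigma$ is the class of pairs $(A, f)$ with $A$ a $\Sigma$-algebra and $f : X \to U^\Sigma A$ a morphism of $\mathscr{V}^{\mathcal{S}}$; $f^\sharp : F^{|\Sigma|}|X| \to |A|^\Sigma$ is the unique $|\Sigma|$-algebra morphism corresponding to the $\mathcal{S}$-sorted function $f : |X| \to |A|$ (also regarded as an $\mathcal{S}$-sorted function $\mathsf{Term}_{|\Sigma|}(|X|) \to |A|^{\mathcal{S}}$). Lifting of adjunctions. Given adjunctions $(\eta, \varepsilon) : F \dashv G : \mathscr{A} \to \mathscr{B}$ and $(\eta', \varepsilon') : F' \dashv G' : \mathscr{A}' \to \mathscr{B}'$ and functors $T : \mathscr{A} \to \mathscr{A}'$, $R : \mathscr{B} \to \mathscr{B}'$, the first is a lifting of the second along $T, R$ if $G'T = RG$, $F'R = TF$, $R\eta = \eta' R$ and $T\varepsilon = \varepsilon' T$. *)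

theory Defs
  imports Main "HOL-Library.FuncSet" "HOL-Library.Nat_Bijection"
begin

text \<open>
  The elements of a type of this class play the role of the class of all sets; a (small) set is a
  collection of such elements for which small holds, a class is an arbitrary HOL set.  The axioms
  are closure properties of the sets of ZFC, with tup the formation of finite tuples.
  The power set axiom is not imposed, so that the class also has instances that are available in
  HOL without further axioms.
\<close>

class set_universe =
  fixes small :: "'a set \<Rightarrow> bool"
    and tup :: "'a list \<Rightarrow> 'a"
  assumes inj_tup: "inj tup"
    and small_subset: "small X \<Longrightarrow> Y \<subseteq> X \<Longrightarrow> small Y"
    and small_image: "small X \<Longrightarrow> small (f ` X)"
    and small_UN: "small X \<Longrightarrow> (\<And>x. x \<in> X \<Longrightarrow> small (F x)) \<Longrightarrow> small (\<Union>x\<in>X. F x)"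
    and small_infinite: "\<exists>X. small X \<and> infinite X"

text \<open>This instance only witnesses the consistency of the axioms.\<close>

instantiation nat :: set_universe
begin

definition small_nat :: "nat set \<Rightarrow> bool" where "small_nat X = True"

definition tup_nat :: "nat list \<Rightarrow> nat" where "tup_nat = list_encode"

instance
proof
  show "\<exists>X::nat set. small X \<and> infinite X"
    by (intro exI[of _ UNIV]) (simp add: small_nat_def)
qed (simp_all add: small_nat_def tup_nat_def inj_list_encode)

end

definition untup :: "'u::set_universe \<Rightarrow> 'u list"
  where "untup = inv tup"

definition tprod :: "'u::set_universe set list \<Rightarrow> 'u set"
  where "tprod Xs = tup ` listset Xs"

record ('o, 'm) cat =
  Obj :: "'o set"
  Arr :: "'m set"
  Dom :: "'m \<Rightarrow> 'o"
  Cod :: "'m \<Rightarrow> 'o"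
  Ide :: "'o \<Rightarrow> 'm"
  Cmp :: "'m \<Rightarrow> 'm \<Rightarrow> 'm"

definition hom :: "('o, 'm) cat \<Rightarrow> 'o \<Rightarrow> 'o \<Rightarrow> 'm set"
  where "hom C a b = {f \<in> Arr C. Dom C f = a \<and> Cod C f = b}"

locale category =
  fixes C :: "('o, 'm) cat"
  assumes dom_in: "f \<in> Arr C \<Longrightarrow> Dom C f \<in> Obj C"
    and cod_in: "f \<in> Arr C \<Longrightarrow> Cod C f \<in> Obj C"
    and ide_in: "a \<in> Obj C \<Longrightarrow> Ide C a \<in> hom C a a"
    and cmp_in: "f \<in> hom C a b \<Longrightarrow> g \<in> hom C b c \<Longrightarrow> Cmp C g f \<in> hom C a c"
    and cmp_ide_right: "f \<in> hom C a b \<Longrightarrow> Cmp C f (Ide C a) = f"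
    and cmp_ide_left: "f \<in> hom C a b \<Longrightarrow> Cmp C (Ide C b) f = f"
    and cmp_assoc: "f \<in> hom C a b \<Longrightarrow> g \<in> hom C b c \<Longrightarrow> h \<in> hom C c d \<Longrightarrow>
      Cmp C h (Cmp C g f) = Cmp C (Cmp C h g) f"

definition isos :: "('o, 'm) cat \<Rightarrow> 'o \<Rightarrow> 'o \<Rightarrow> 'm set"
  where "isos C a b = {f \<in> hom C a b. \<exists>g \<in> hom C b a. Cmp C g f = Ide C a \<and> Cmp C f g = Ide C b}"

record ('o, 'm, 'p, 'n) ftor =
  FO :: "'o \<Rightarrow> 'p"
  FA :: "'m \<Rightarrow> 'n"

locale cat_functor = C: category C + D: category D
  for C :: "('o, 'm) cat" and D :: "('p, 'n) cat" +
  fixes F :: "('o, 'm, 'p, 'n) ftor"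
  assumes fo_in: "a \<in> Obj C \<Longrightarrow> FO F a \<in> Obj D"
    and fa_in: "f \<in> hom C a b \<Longrightarrow> FA F f \<in> hom D (FO F a) (FO F b)"
    and fa_ide: "a \<in> Obj C \<Longrightarrow> FA F (Ide C a) = Ide D (FO F a)"
    and fa_cmp: "f \<in> hom C a b \<Longrightarrow> g \<in> hom C b c \<Longrightarrow> FA F (Cmp C g f) = Cmp D (FA F g) (FA F f)"

definition id_ftor :: "('o, 'm, 'o, 'm) ftor"
  where "id_ftor = \<lparr>FO = \<lambda>a. a, FA = \<lambda>f. f\<rparr>"

definition comp_ftor :: "('p, 'n, 'q, 'k) ftor \<Rightarrow> ('o, 'm, 'p, 'n) ftor \<Rightarrow> ('o, 'm, 'q, 'k) ftor"
  where "comp_ftor G F = \<lparr>FO = \<lambda>a. FO G (FO F a), FA = \<lambda>f. FA G (FA F f)\<rparr>"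

definition ftor_eq :: "('o, 'm) cat \<Rightarrow> ('o, 'm, 'p, 'n) ftor \<Rightarrow> ('o, 'm, 'p, 'n) ftor \<Rightarrow> bool"
  where "ftor_eq C F G \<longleftrightarrow>
    (\<forall>a \<in> Obj C. FO F a = FO G a) \<and> (\<forall>f \<in> Arr C. FA F f = FA G f)"

locale natural_transformation = F: cat_functor C D F + G: cat_functor C D G
  for C :: "('o, 'm) cat" and D :: "('p, 'n) cat"
    and F :: "('o, 'm, 'p, 'n) ftor" and G :: "('o, 'm, 'p, 'n) ftor" +
  fixes t :: "'o \<Rightarrow> 'n"
  assumes component_in: "a \<in> Obj C \<Longrightarrow> t a \<in> hom D (FO F a) (FO G a)"
    and naturality: "f \<in> hom C a b \<Longrightarrow> Cmp D (t b) (FA F f) = Cmp D (FA G f) (t a)"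

text \<open>F is the left adjoint, G the right adjoint.\<close>

locale adjunction = F: cat_functor B A F + G: cat_functor A B G
    + unit: natural_transformation B B id_ftor "comp_ftor G F" eta
    + counit: natural_transformation A A "comp_ftor F G" id_ftor eps
  for A :: "('o, 'm) cat" and B :: "('p, 'n) cat"
    and F :: "('p, 'n, 'o, 'm) ftor" and G :: "('o, 'm, 'p, 'n) ftor"
    and eta :: "'p \<Rightarrow> 'n" and eps :: "'o \<Rightarrow> 'm" +
  assumes triangle_F: "b \<in> Obj B \<Longrightarrow> Cmp A (eps (FO F b)) (FA F (eta b)) = Ide A (FO F b)"
    and triangle_G: "a \<in> Obj A \<Longrightarrow> Cmp B (FA G (eps a)) (eta (FO G a)) = Ide B (FO G a)"

locale adjunction_lifting = first: adjunction A B F G eta eps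
    + second: adjunction A' B' F' G' eta' eps'
    + T: cat_functor A A' T + R: cat_functor B B' R
  for A :: "('o, 'm) cat" and B :: "('p, 'n) cat" and F G eta eps
    and A' :: "('o', 'm') cat" and B' :: "('p', 'n') cat" and F' G' eta' eps' and T R +
  assumes lift_right: "ftor_eq A (comp_ftor G' T) (comp_ftor R G)"
    and lift_left: "ftor_eq B (comp_ftor F' R) (comp_ftor T F)"
    and lift_unit: "b \<in> Obj B \<Longrightarrow> FA R (eta b) = eta' (FO R b)"
    and lift_counit: "a \<in> Obj A \<Longrightarrow> FA T (eps a) = eps' (FO T a)"

definition power_cat :: "'s set \<Rightarrow> ('o, 'm) cat \<Rightarrow> ('s \<Rightarrow> 'o, 's \<Rightarrow> 'm) cat"
  where "power_cat Ss C =
    \<lparr>Obj = Ss \<rightarrow>\<^sub>E Obj C,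
     Arr = Ss \<rightarrow>\<^sub>E Arr C,
     Dom = \<lambda>f. \<lambda>s\<in>Ss. Dom C (f s),
     Cod = \<lambda>f. \<lambda>s\<in>Ss. Cod C (f s),
     Ide = \<lambda>X. \<lambda>s\<in>Ss. Ide C (X s),
     Cmp = \<lambda>g f. \<lambda>s\<in>Ss. Cmp C (g s) (f s)\<rparr>"

definition power_ftor ::
  "'s set \<Rightarrow> ('o, 'm, 'p, 'n) ftor \<Rightarrow> ('s \<Rightarrow> 'o, 's \<Rightarrow> 'm, 's \<Rightarrow> 'p, 's \<Rightarrow> 'n) ftor"
  where "power_ftor Ss F =
    \<lparr>FO = \<lambda>X. \<lambda>s\<in>Ss. FO F (X s), FA = \<lambda>f. \<lambda>s\<in>Ss. FA F (f s)\<rparr>"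

definition product_cone :: "('o, 'm) cat \<Rightarrow> 'o list \<Rightarrow> 'o \<Rightarrow> (nat \<Rightarrow> 'm) \<Rightarrow> bool"
  where "product_cone C Xs P p \<longleftrightarrow>
    P \<in> Obj C \<and> (\<forall>i < length Xs. p i \<in> hom C P (Xs ! i)) \<and>
    (\<forall>Q \<in> Obj C. \<forall>q. (\<forall>i < length Xs. q i \<in> hom C Q (Xs ! i)) \<longrightarrow>
      (\<exists>!h. h \<in> hom C Q P \<and> (\<forall>i < length Xs. Cmp C (p i) h = q i)))"

definition faithful :: "('o, 'm) cat \<Rightarrow> ('o, 'm, 'p, 'n) ftor \<Rightarrow> bool"
  where "faithful C U \<longleftrightarrow>
    (\<forall>a b. \<forall>f \<in> hom C a b. \<forall>g \<in> hom C a b. FA U f = FA U g \<longrightarrow> f = g)"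

definition concrete :: "('o, 'm) cat \<Rightarrow> ('p, 'n) cat \<Rightarrow> ('o, 'm, 'p, 'n) ftor \<Rightarrow> bool"
  where "concrete C D U \<longleftrightarrow> cat_functor C D U \<and> faithful C U"

definition admissible :: "('o, 'm) cat \<Rightarrow> ('o, 'm, 'p, 'n) ftor \<Rightarrow> 'o \<Rightarrow> 'o \<Rightarrow> 'n \<Rightarrow> bool"
  where "admissible C U V W f \<longleftrightarrow> (\<exists>g \<in> hom C V W. FA U g = f)"

definition amnestic :: "('o, 'm) cat \<Rightarrow> ('p, 'n) cat \<Rightarrow> ('o, 'm, 'p, 'n) ftor \<Rightarrow> bool"
  where "amnestic C D U \<longleftrightarrow>
    (\<forall>V \<in> Obj C. \<forall>W \<in> Obj C. FO U V = FO U W \<longrightarrow>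
      admissible C U V W (Ide D (FO U V)) \<longrightarrow> admissible C U W V (Ide D (FO U V)) \<longrightarrow> V = W)"

text \<open>
  A (possibly large) source is given by an arbitrary set of pairs (codomain object, arrow).
  Indexing families are not needed, as all notions below depend only on the set of members.
\<close>

definition structured_source ::
  "('o, 'm) cat \<Rightarrow> ('p, 'n) cat \<Rightarrow> ('o, 'm, 'p, 'n) ftor \<Rightarrow> 'p \<Rightarrow> ('o \<times> 'n) set \<Rightarrow> bool"
  where "structured_source C D U X src \<longleftrightarrow>
    X \<in> Obj D \<and> (\<forall>(W, f) \<in> src. W \<in> Obj C \<and> f \<in> hom D X (FO U W))"

definition initial_source ::
  "('o, 'm) cat \<Rightarrow> ('p, 'n) cat \<Rightarrow> ('o, 'm, 'p, 'n) ftor \<Rightarrow> 'o \<Rightarrow> ('o \<times> 'n) set \<Rightarrow> bool"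
  where "initial_source C D U V src \<longleftrightarrow>
    (\<forall>W \<in> Obj C. \<forall>f \<in> hom D (FO U W) (FO U V).
      admissible C U W V f \<longleftrightarrow> (\<forall>(V', f') \<in> src. admissible C U W V' (Cmp D f' f)))"

text \<open>V is the domain of an initial lift of the structured source src out of X.\<close>

definition initial_lift ::
  "('o, 'm) cat \<Rightarrow> ('p, 'n) cat \<Rightarrow> ('o, 'm, 'p, 'n) ftor \<Rightarrow> 'p \<Rightarrow> ('o \<times> 'n) set \<Rightarrow> 'o \<Rightarrow> bool"
  where "initial_lift C D U X src V \<longleftrightarrow>
    structured_source C D U X src \<and> V \<in> Obj C \<and> FO U V = X \<and>
    (\<forall>(W, f) \<in> src. admissible C U V W f) \<and> initial_source C D U V src"

definition topological :: "('o, 'm) cat \<Rightarrow> ('p, 'n) cat \<Rightarrow> ('o, 'm, 'p, 'n) ftor \<Rightarrow> bool"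
  where "topological C D U \<longleftrightarrow> concrete C D U \<and> amnestic C D U \<and>
    (\<forall>X src. structured_source C D U X src \<longrightarrow> (\<exists>V. initial_lift C D U X src V))"

record ('o, 'm) monoidal =
  TenO :: "'o \<Rightarrow> 'o \<Rightarrow> 'o"
  TenA :: "'m \<Rightarrow> 'm \<Rightarrow> 'm"
  Unit :: "'o"
  Assoc :: "'o \<Rightarrow> 'o \<Rightarrow> 'o \<Rightarrow> 'm"
  LUnit :: "'o \<Rightarrow> 'm"
  RUnit :: "'o \<Rightarrow> 'm"
  Symm :: "'o \<Rightarrow> 'o \<Rightarrow> 'm"

locale symmetric_monoidal = category C
  for C :: "('o, 'm) cat" +
  fixes M :: "('o, 'm) monoidal"
  assumes tenO_in: "a \<in> Obj C \<Longrightarrow> b \<in> Obj C \<Longrightarrow> TenO M a b \<in> Obj C"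
    and tenA_in: "f \<in> hom C a b \<Longrightarrow> g \<in> hom C c d \<Longrightarrow>
      TenA M f g \<in> hom C (TenO M a c) (TenO M b d)"
    and tenA_ide: "a \<in> Obj C \<Longrightarrow> b \<in> Obj C \<Longrightarrow> TenA M (Ide C a) (Ide C b) = Ide C (TenO M a b)"
    and tenA_cmp: "f \<in> hom C a b \<Longrightarrow> f' \<in> hom C b c \<Longrightarrow> g \<in> hom C d e \<Longrightarrow> g' \<in> hom C e k \<Longrightarrow>
      TenA M (Cmp C f' f) (Cmp C g' g) = Cmp C (TenA M f' g') (TenA M f g)"
    and unit_in: "Unit M \<in> Obj C"
    and assoc_iso: "a \<in> Obj C \<Longrightarrow> b \<in> Obj C \<Longrightarrow> c \<in> Obj C \<Longrightarrow>
      Assoc M a b c \<in> isos C (TenO M (TenO M a b) c) (TenO M a (TenO M b c))"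
    and assoc_natural: "f \<in> hom C a a' \<Longrightarrow> g \<in> hom C b b' \<Longrightarrow> h \<in> hom C c c' \<Longrightarrow>
      Cmp C (Assoc M a' b' c') (TenA M (TenA M f g) h) =
      Cmp C (TenA M f (TenA M g h)) (Assoc M a b c)"
    and lunit_iso: "a \<in> Obj C \<Longrightarrow> LUnit M a \<in> isos C (TenO M (Unit M) a) a"
    and lunit_natural: "f \<in> hom C a b \<Longrightarrow>
      Cmp C (LUnit M b) (TenA M (Ide C (Unit M)) f) = Cmp C f (LUnit M a)"
    and runit_iso: "a \<in> Obj C \<Longrightarrow> RUnit M a \<in> isos C (TenO M a (Unit M)) a"
    and runit_natural: "f \<in> hom C a b \<Longrightarrow>
      Cmp C (RUnit M b) (TenA M f (Ide C (Unit M))) = Cmp C f (RUnit M a)"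
    and symm_in: "a \<in> Obj C \<Longrightarrow> b \<in> Obj C \<Longrightarrow> Symm M a b \<in> hom C (TenO M a b) (TenO M b a)"
    and symm_natural: "f \<in> hom C a a' \<Longrightarrow> g \<in> hom C b b' \<Longrightarrow>
      Cmp C (Symm M a' b') (TenA M f g) = Cmp C (TenA M g f) (Symm M a b)"
    and symm_symm: "a \<in> Obj C \<Longrightarrow> b \<in> Obj C \<Longrightarrow>
      Cmp C (Symm M b a) (Symm M a b) = Ide C (TenO M a b)"
    and pentagon: "a \<in> Obj C \<Longrightarrow> b \<in> Obj C \<Longrightarrow> c \<in> Obj C \<Longrightarrow> d \<in> Obj C \<Longrightarrow>
      Cmp C (Assoc M a b (TenO M c d)) (Assoc M (TenO M a b) c d) =
      Cmp C (TenA M (Ide C a) (Assoc M b c d))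
        (Cmp C (Assoc M a (TenO M b c) d) (TenA M (Assoc M a b c) (Ide C d)))"
    and triangle: "a \<in> Obj C \<Longrightarrow> b \<in> Obj C \<Longrightarrow>
      Cmp C (TenA M (Ide C a) (LUnit M b)) (Assoc M a (Unit M) b) =
      TenA M (RUnit M a) (Ide C b)"
    and hexagon: "a \<in> Obj C \<Longrightarrow> b \<in> Obj C \<Longrightarrow> c \<in> Obj C \<Longrightarrow>
      Cmp C (Assoc M b c a) (Cmp C (Symm M a (TenO M b c)) (Assoc M a b c)) =
      Cmp C (TenA M (Ide C b) (Symm M a c))
        (Cmp C (Assoc M b a c) (TenA M (Symm M a b) (Ide C c)))"

definition strict_symmetric_monoidal_ftor ::
  "('o, 'm) cat \<Rightarrow> ('o, 'm) monoidal \<Rightarrow> ('p, 'n) cat \<Rightarrow> ('p, 'n) monoidal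
    \<Rightarrow> ('o, 'm, 'p, 'n) ftor \<Rightarrow> bool"
  where "strict_symmetric_monoidal_ftor C M D N U \<longleftrightarrow>
    cat_functor C D U \<and> symmetric_monoidal C M \<and> symmetric_monoidal D N \<and>
    FO U (Unit M) = Unit N \<and>
    (\<forall>a \<in> Obj C. \<forall>b \<in> Obj C. FO U (TenO M a b) = TenO N (FO U a) (FO U b)) \<and>
    (\<forall>f \<in> Arr C. \<forall>g \<in> Arr C. FA U (TenA M f g) = TenA N (FA U f) (FA U g)) \<and>
    (\<forall>a \<in> Obj C. \<forall>b \<in> Obj C. \<forall>c \<in> Obj C.
      FA U (Assoc M a b c) = Assoc N (FO U a) (FO U b) (FO U c)) \<and>
    (\<forall>a \<in> Obj C. FA U (LUnit M a) = LUnit N (FO U a)) \<and>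
    (\<forall>a \<in> Obj C. FA U (RUnit M a) = RUnit N (FO U a)) \<and>
    (\<forall>a \<in> Obj C. \<forall>b \<in> Obj C. FA U (Symm M a b) = Symm N (FO U a) (FO U b))"

datatype ('o, 'h) arrow = Arrow (source: 'o) (map_of_arrow: 'h) (target: 'o)

type_synonym 'u set_arrow = "('u set, 'u \<Rightarrow> 'u) arrow"

abbreviation app :: "'u set_arrow \<Rightarrow> 'u \<Rightarrow> 'u"
  where "app \<equiv> map_of_arrow"

definition set_cat :: "('u::set_universe set, 'u set_arrow) cat"
  where "set_cat =
    \<lparr>Obj = {X. small X},
     Arr = {f. small (source f) \<and> small (target f) \<and> app f \<in> source f \<rightarrow>\<^sub>E target f},
     Dom = source,
     Cod = target,
     Ide = \<lambda>X. Arrow X (\<lambda>x\<in>X. x) X,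
     Cmp = \<lambda>g f. Arrow (source f) (compose (source f) (app g) (app f)) (target g)\<rparr>"

definition set_proj :: "'u::set_universe set list \<Rightarrow> nat \<Rightarrow> 'u set_arrow"
  where "set_proj Xs i = Arrow (tprod Xs) (\<lambda>z\<in>tprod Xs. untup z ! i) (Xs ! i)"

definition arrow2 ::
  "'u::set_universe set \<Rightarrow> 'u set \<Rightarrow> ('u \<Rightarrow> 'u \<Rightarrow> 'u) \<Rightarrow> 'u set \<Rightarrow> 'u set_arrow"
  where "arrow2 X Y h Z =
    Arrow (tprod [X, Y]) (\<lambda>z\<in>tprod [X, Y]. h (untup z ! 0) (untup z ! 1)) Z"

definition set_cartesian :: "('u::set_universe set, 'u set_arrow) monoidal"
  where "set_cartesian =
    \<lparr>TenO = \<lambda>X Y. tprod [X, Y],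
     TenA = \<lambda>f g. arrow2 (source f) (source g) (\<lambda>x y. tup [app f x, app g y])
       (tprod [target f, target g]),
     Unit = tprod [],
     Assoc = \<lambda>X Y Z. arrow2 (tprod [X, Y]) Z (\<lambda>w z. tup [untup w ! 0, tup [untup w ! 1, z]])
       (tprod [X, tprod [Y, Z]]),
     LUnit = \<lambda>X. arrow2 (tprod []) X (\<lambda>u x. x) X,
     RUnit = \<lambda>X. arrow2 X (tprod []) (\<lambda>x u. x) X,
     Symm = \<lambda>X Y. arrow2 X Y (\<lambda>x y. tup [y, x]) (tprod [Y, X])\<rparr>"

text \<open>
  Finite products in a topological category over sets, chosen so that the underlying set and the
  underlying projections are the cartesian ones; amnesticity makes this choice unique.
\<close>

definition prodO ::
  "('v, 'm) cat \<Rightarrow> ('v, 'm, 'u::set_universe set, 'u set_arrow) ftor \<Rightarrow> 'v list \<Rightarrow> 'v"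
  where "prodO V U Xs = (THE P. FO U P = tprod (map (FO U) Xs) \<and>
    (\<exists>p. product_cone V Xs P p \<and>
      (\<forall>i < length Xs. FA U (p i) = set_proj (map (FO U) Xs) i)))"

definition proj ::
  "('v, 'm) cat \<Rightarrow> ('v, 'm, 'u::set_universe set, 'u set_arrow) ftor \<Rightarrow> 'v list \<Rightarrow> nat \<Rightarrow> 'm"
  where "proj V U Xs i = (THE p. p \<in> hom V (prodO V U Xs) (Xs ! i) \<and>
    FA U p = set_proj (map (FO U) Xs) i)"

definition prodA ::
  "('v, 'm) cat \<Rightarrow> ('v, 'm, 'u::set_universe set, 'u set_arrow) ftor \<Rightarrow> 'm list \<Rightarrow> 'm"
  where "prodA V U fs = (THE h.
    h \<in> hom V (prodO V U (map (Dom V) fs)) (prodO V U (map (Cod V) fs)) \<and>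
    (\<forall>i < length fs. Cmp V (proj V U (map (Cod V) fs) i) h =
      Cmp V (fs ! i) (proj V U (map (Dom V) fs) i)))"

record ('u, 's, 'v) signature =
  Ops :: "'u set"
  arity :: "'u \<Rightarrow> 's list"
  out :: "'u \<Rightarrow> 's"
  par :: "'u \<Rightarrow> 'v"

definition is_signature ::
  "('v, 'm) cat \<Rightarrow> 's set \<Rightarrow> ('u::set_universe, 's, 'v) signature \<Rightarrow> bool"
  where "is_signature V Ss \<Sigma> \<longleftrightarrow> small (Ops \<Sigma>) \<and>
    (\<forall>\<sigma> \<in> Ops \<Sigma>. set (arity \<Sigma> \<sigma>) \<subseteq> Ss \<and> out \<Sigma> \<sigma> \<in> Ss \<and> par \<Sigma> \<sigma> \<in> Obj V)"

datatype ('u, 's, 'v, 'm) algebra = Algebra (carrier: "'s \<Rightarrow> 'v") (oper: "'u \<Rightarrow> 'm")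

type_synonym ('u, 's, 'v, 'm) alg_arrow = "(('u, 's, 'v, 'm) algebra, 's \<Rightarrow> 'm) arrow"

definition algebras ::
  "('v, 'm) cat \<Rightarrow> ('v, 'm, 'u::set_universe set, 'u set_arrow) ftor \<Rightarrow> ('v, 'm) monoidal \<Rightarrow> 's set
    \<Rightarrow> ('u, 's, 'v) signature \<Rightarrow> ('u, 's, 'v, 'm) algebra set"
  where "algebras V U M Ss \<Sigma> = {A. carrier A \<in> Ss \<rightarrow>\<^sub>E Obj V \<and>
    oper A \<in> (\<Pi>\<^sub>E \<sigma> \<in> Ops \<Sigma>. hom V
      (TenO M (par \<Sigma> \<sigma>) (prodO V U (map (carrier A) (arity \<Sigma> \<sigma>)))) (carrier A (out \<Sigma> \<sigma>)))}"

definition alg_homs ::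
  "('v, 'm) cat \<Rightarrow> ('v, 'm, 'u::set_universe set, 'u set_arrow) ftor \<Rightarrow> ('v, 'm) monoidal \<Rightarrow> 's set
    \<Rightarrow> ('u, 's, 'v) signature \<Rightarrow> ('u, 's, 'v, 'm) algebra \<Rightarrow> ('u, 's, 'v, 'm) algebra \<Rightarrow> ('s \<Rightarrow> 'm) set"
  where "alg_homs V U M Ss \<Sigma> A B = {f \<in> hom (power_cat Ss V) (carrier A) (carrier B).
    \<forall>\<sigma> \<in> Ops \<Sigma>. Cmp V (f (out \<Sigma> \<sigma>)) (oper A \<sigma>) =
      Cmp V (oper B \<sigma>) (TenA M (Ide V (par \<Sigma> \<sigma>)) (prodA V U (map f (arity \<Sigma> \<sigma>))))}"

definition alg_cat ::
  "('v, 'm) cat \<Rightarrow> ('v, 'm, 'u::set_universe set, 'u set_arrow) ftor \<Rightarrow> ('v, 'm) monoidal \<Rightarrow> 's set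
    \<Rightarrow> ('u, 's, 'v) signature \<Rightarrow> (('u, 's, 'v, 'm) algebra, ('u, 's, 'v, 'm) alg_arrow) cat"
  where "alg_cat V U M Ss \<Sigma> =
    \<lparr>Obj = algebras V U M Ss \<Sigma>,
     Arr = {h. source h \<in> algebras V U M Ss \<Sigma> \<and> target h \<in> algebras V U M Ss \<Sigma> \<and>
       map_of_arrow h \<in> alg_homs V U M Ss \<Sigma> (source h) (target h)},
     Dom = source,
     Cod = target,
     Ide = \<lambda>A. Arrow A (Ide (power_cat Ss V) (carrier A)) A,
     Cmp = \<lambda>h k. Arrow (source k)
       (Cmp (power_cat Ss V) (map_of_arrow h) (map_of_arrow k)) (target h)\<rparr>"

definition alg_forget ::
  "(('u, 's, 'v, 'm) algebra, ('u, 's, 'v, 'm) alg_arrow, 's \<Rightarrow> 'v, 's \<Rightarrow> 'm) ftor"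
  where "alg_forget = \<lparr>FO = carrier, FA = map_of_arrow\<rparr>"

text \<open>
  A classical signature is a signature over the cartesian category of sets all of whose parameters
  are the one-point set tprod [].  The term constructions below use only the symbols, arities and
  output sorts, and are meant for such signatures; the one-point factor of the domain of an
  operation is kept as the first component of a pair.
\<close>

type_synonym ('u, 's) classical_signature = "('u, 's, 'u set) signature"

type_synonym ('u, 's) classical_algebra = "('u, 's, 'u set, 'u set_arrow) algebra"

abbreviation classical_alg_cat ::
  "'s set \<Rightarrow> ('u::set_universe, 's) classical_signature
    \<Rightarrow> (('u, 's) classical_algebra, ('u, 's, 'u set, 'u set_arrow) alg_arrow) cat"
  where "classical_alg_cat \<equiv> alg_cat set_cat id_ftor set_cartesian"

text \<open>
  Terms are coded by tuples: the constant y by the 1-tuple of y, and the application of an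
  operation symbol to a tuple of terms by the pair of the symbol and that tuple.
\<close>

inductive is_term ::
  "('u::set_universe, 's) classical_signature \<Rightarrow> ('s \<Rightarrow> 'u set) \<Rightarrow> 's \<Rightarrow> 'u \<Rightarrow> bool"
  for \<Omega> Y where
    "y \<in> Y s \<Longrightarrow> is_term \<Omega> Y s (tup [y])"
  | "\<tau> \<in> Ops \<Omega> \<Longrightarrow> length ts = length (arity \<Omega> \<tau>) \<Longrightarrow>
      (\<forall>i < length ts. is_term \<Omega> Y (arity \<Omega> \<tau> ! i) (ts ! i)) \<Longrightarrow>
      is_term \<Omega> Y (out \<Omega> \<tau>) (tup [\<tau>, tup ts])"

definition Term ::
  "'s set \<Rightarrow> ('u::set_universe, 's) classical_signature \<Rightarrow> ('s \<Rightarrow> 'u set) \<Rightarrow> 's \<Rightarrow> 'u set"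
  where "Term Ss \<Omega> Y = (\<lambda>s\<in>Ss. {t. is_term \<Omega> Y s t})"

definition term_algebra ::
  "'s set \<Rightarrow> ('u::set_universe, 's) classical_signature \<Rightarrow> ('s \<Rightarrow> 'u set) \<Rightarrow> ('u, 's) classical_algebra"
  where "term_algebra Ss \<Omega> Y = Algebra (Term Ss \<Omega> Y)
    (\<lambda>\<tau>\<in>Ops \<Omega>. arrow2 (tprod []) (tprod (map (Term Ss \<Omega> Y) (arity \<Omega> \<tau>)))
      (\<lambda>u z. tup [\<tau>, z]) (Term Ss \<Omega> Y (out \<Omega> \<tau>)))"

definition term_unit ::
  "'s set \<Rightarrow> ('u::set_universe, 's) classical_signature \<Rightarrow> ('s \<Rightarrow> 'u set) \<Rightarrow> 's \<Rightarrow> 'u set_arrow"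
  where "term_unit Ss \<Omega> Y = (\<lambda>s\<in>Ss. Arrow (Y s) (\<lambda>y\<in>Y s. tup [y]) (Term Ss \<Omega> Y s))"

definition sharp ::
  "'s set \<Rightarrow> ('u::set_universe, 's) classical_signature \<Rightarrow> ('s \<Rightarrow> 'u set) \<Rightarrow> ('u, 's) classical_algebra
    \<Rightarrow> ('s \<Rightarrow> 'u set_arrow) \<Rightarrow> ('u, 's, 'u set, 'u set_arrow) alg_arrow"
  where "sharp Ss \<Omega> Y B f = (THE h. h \<in> hom (classical_alg_cat Ss \<Omega>) (term_algebra Ss \<Omega> Y) B \<and>
    Cmp (power_cat Ss set_cat) (FA alg_forget h) (term_unit Ss \<Omega> Y) = f)"

definition term_ftor ::
  "'s set \<Rightarrow> ('u::set_universe, 's) classical_signature \<Rightarrow>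
    ('s \<Rightarrow> 'u set, 's \<Rightarrow> 'u set_arrow, ('u, 's) classical_algebra,
      ('u, 's, 'u set, 'u set_arrow) alg_arrow) ftor"
  where "term_ftor Ss \<Omega> =
    \<lparr>FO = term_algebra Ss \<Omega>,
     FA = \<lambda>f. sharp Ss \<Omega> (Dom (power_cat Ss set_cat) f)
       (term_algebra Ss \<Omega> (Cod (power_cat Ss set_cat) f))
       (Cmp (power_cat Ss set_cat) (term_unit Ss \<Omega> (Cod (power_cat Ss set_cat) f)) f)\<rparr>"

definition term_counit ::
  "'s set \<Rightarrow> ('u::set_universe, 's) classical_signature \<Rightarrow> ('u, 's) classical_algebra
    \<Rightarrow> ('u, 's, 'u set, 'u set_arrow) alg_arrow"
  where "term_counit Ss \<Omega> B = sharp Ss \<Omega> (carrier B) B (Ide (power_cat Ss set_cat) (carrier B))"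

text \<open>The operation symbol of the pair \<open>\<sigma>\<close>, p is the tuple \<open>tup [\<sigma>, p]\<close>.\<close>

definition under_sig ::
  "('v, 'm, 'u::set_universe set, 'u set_arrow) ftor \<Rightarrow> ('u, 's, 'v) signature
    \<Rightarrow> ('u, 's) classical_signature"
  where "under_sig U \<Sigma> =
    \<lparr>Ops = {tup [\<sigma>, p] |\<sigma> p. \<sigma> \<in> Ops \<Sigma> \<and> p \<in> FO U (par \<Sigma> \<sigma>)},
     arity = \<lambda>\<tau>. arity \<Sigma> (untup \<tau> ! 0),
     out = \<lambda>\<tau>. out \<Sigma> (untup \<tau> ! 0),
     par = \<lambda>\<tau>. tprod []\<rparr>"

definition under_alg ::
  "('v, 'm, 'u::set_universe set, 'u set_arrow) ftor \<Rightarrow> 's set \<Rightarrow> ('u, 's, 'v) signature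
    \<Rightarrow> ('u, 's, 'v, 'm) algebra \<Rightarrow> ('u, 's) classical_algebra"
  where "under_alg U Ss \<Sigma> A = Algebra (\<lambda>s\<in>Ss. FO U (carrier A s))
    (\<lambda>\<tau>\<in>Ops (under_sig U \<Sigma>). let \<sigma> = untup \<tau> ! 0; p = untup \<tau> ! 1 in
      arrow2 (tprod []) (tprod (map (\<lambda>s. FO U (carrier A s)) (arity \<Sigma> \<sigma>)))
        (\<lambda>u z. app (FA U (oper A \<sigma>)) (tup [p, z])) (FO U (carrier A (out \<Sigma> \<sigma>))))"

definition under_ftor ::
  "('v, 'm, 'u::set_universe set, 'u set_arrow) ftor \<Rightarrow> 's set \<Rightarrow> ('u, 's, 'v) signature \<Rightarrow>
    (('u, 's, 'v, 'm) algebra, ('u, 's, 'v, 'm) alg_arrow, ('u, 's) classical_algebra,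
      ('u, 's, 'u set, 'u set_arrow) alg_arrow) ftor"
  where "under_ftor U Ss \<Sigma> =
    \<lparr>FO = under_alg U Ss \<Sigma>,
     FA = \<lambda>h. Arrow (under_alg U Ss \<Sigma> (source h)) (\<lambda>s\<in>Ss. FA U (map_of_arrow h s))
       (under_alg U Ss \<Sigma> (target h))\<rparr>"

definition comma ::
  "('v, 'm) cat \<Rightarrow> ('v, 'm, 'u::set_universe set, 'u set_arrow) ftor \<Rightarrow> ('v, 'm) monoidal \<Rightarrow> 's set
    \<Rightarrow> ('u, 's, 'v) signature \<Rightarrow> ('s \<Rightarrow> 'v) \<Rightarrow> (('u, 's, 'v, 'm) algebra \<times> ('s \<Rightarrow> 'm)) set"
  where "comma V U M Ss \<Sigma> X = {(A, f). A \<in> Obj (alg_cat V U M Ss \<Sigma>) \<and>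
    f \<in> hom (power_cat Ss V) X (FO alg_forget A)}"

definition under_sharp ::
  "('v, 'm, 'u::set_universe set, 'u set_arrow) ftor \<Rightarrow> 's set \<Rightarrow> ('u, 's, 'v) signature \<Rightarrow> ('s \<Rightarrow> 'v)
    \<Rightarrow> ('u, 's, 'v, 'm) algebra \<Rightarrow> ('s \<Rightarrow> 'm) \<Rightarrow> ('u, 's, 'u set, 'u set_arrow) alg_arrow"
  where "under_sharp U Ss \<Sigma> X A f = sharp Ss (under_sig U \<Sigma>) (FO (power_ftor Ss U) X)
    (FO (under_ftor U Ss \<Sigma>) A) (FA (power_ftor Ss U) f)"

definition sharp_source ::
  "('v, 'm) cat \<Rightarrow> ('v, 'm, 'u::set_universe set, 'u set_arrow) ftor \<Rightarrow> ('v, 'm) monoidal \<Rightarrow> 's set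
    \<Rightarrow> ('u, 's, 'v) signature \<Rightarrow> ('s \<Rightarrow> 'v)
    \<Rightarrow> (('u, 's, 'v, 'm) algebra \<times> ('u, 's, 'u set, 'u set_arrow) alg_arrow) set"
  where "sharp_source V U M Ss \<Sigma> X =
    {(A, under_sharp U Ss \<Sigma> X A f) |A f. (A, f) \<in> comma V U M Ss \<Sigma> X}"

definition carrier_source ::
  "('v, 'm) cat \<Rightarrow> ('v, 'm, 'u::set_universe set, 'u set_arrow) ftor \<Rightarrow> ('v, 'm) monoidal \<Rightarrow> 's set
    \<Rightarrow> ('u, 's, 'v) signature \<Rightarrow> ('s \<Rightarrow> 'v) \<Rightarrow> (('s \<Rightarrow> 'v) \<times> ('s \<Rightarrow> 'u set_arrow)) set"
  where "carrier_source V U M Ss \<Sigma> X =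
    {(FO alg_forget A, FA alg_forget (under_sharp U Ss \<Sigma> X A f)) |A f.
      (A, f) \<in> comma V U M Ss \<Sigma> X}"

end

theory Submission
  imports Defs
begin

text \<open>
  This is an instance of the lifting of adjoints along topological functors.  Structured sources of
  \<open>\<Sigma>\<close>-algebras have initial lifts whose carriers are initial lifts of the carrier sources: every
  operation of the underlying classical algebra lifts, since its composites with the members of the
  source are composites of operations of the given algebras with tensors and products of admissible
  maps.  Taking the initial lift of all \<open>f\<^sup>\<sharp>\<close> makes every \<open>f\<^sup>\<sharp>\<close> admissible by construction, and it makes
  the classical unit \<open>\<eta>\<close> admissible because \<open>f\<^sup>\<sharp> \<circ> \<eta> = f\<close>; uniqueness and all equations descend
  along the faithful functors to the classical adjunction of term algebras.
\<close>

subsection \<open>Universal arrows and taut lifts of adjunctions\<close>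

text \<open>The delicate point is strictness: the lifted left adjoint has to satisfy an equality of
  functors, not merely an isomorphism. Amnesticity provides it, because two initial lifts of one
  source lie in the same fibre and are comparable in both directions. The same argument yields the
  equivalences in the conclusion, which characterise the free algebra and its carrier.

  The universal maps are lifted among algebras, but the unit is lifted in the power of
  \<open>V\<close>. The chosen lift therefore has to be initial at both levels at once. This
  compatibility, tautness of the square of forgetful functors, enters the abstract argument as the
  assumption \<open>lift_exists\<close>. The source is indexed by a whole comma class, and
  topological functors lift sources of that size.

  The classical side is not a separate theory: a classical signature is an enriched one over
  \<open>set_cat\<close> with the identity functor, so one development of algebras serves both
  levels, and only terms are treated specifically over sets.\<close>

lemma homD:
  assumes "f \<in> hom C a b"
  shows "f \<in> Arr C" "Dom C f = a" "Cod C f = b"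
  using assms by (auto simp: hom_def)

lemma (in category) hom_obj:
  assumes "f \<in> hom C a b"
  shows "a \<in> Obj C" "b \<in> Obj C"
  using assms dom_in cod_in by (auto simp: hom_def)

lemma Arr_hom: "f \<in> Arr C \<Longrightarrow> f \<in> hom C (Dom C f) (Cod C f)"
  by (simp add: hom_def)

lemma faithfulD:
  "faithful C U \<Longrightarrow> f \<in> hom C a b \<Longrightarrow> g \<in> hom C a b \<Longrightarrow> FA U f = FA U g \<Longrightarrow> f = g"
  unfolding faithful_def by blast

lemma (in cat_functor) admissible_cmp:
  assumes "admissible C F a b f" "admissible C F b c g"
  shows "admissible C F a c (Cmp D g f)"
proof -
  obtain f' g' where f': "f' \<in> hom C a b" "FA F f' = f" and g': "g' \<in> hom C b c" "FA F g' = g"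
    using assms by (auto simp: admissible_def)
  have "FA F (Cmp C g' f') = Cmp D g f" using fa_cmp[OF f'(1) g'(1)] f' g' by simp
  then show ?thesis
    unfolding admissible_def using C.cmp_in[OF f'(1) g'(1)] by blast
qed

text \<open>Composing a member of the source with the identity of \<open>X\<close> returns that
  member, which is admissible from either lift. So initiality makes the identity admissible both
  ways, and amnesticity is antisymmetry.\<close>

lemma initial_lift_unique:
  assumes "cat_functor C D U" and amn: "amnestic C D U"
    and a: "initial_lift C D U X src a" and b: "initial_lift C D U X src b"
  shows "a = b"
proof -
  interpret cat_functor C D U by fact
  have X: "X \<in> Obj D" "a \<in> Obj C" "b \<in> Obj C" "FO U a = X" "FO U b = X"
    using a b by (auto simp: initial_lift_def structured_source_def)
  have ide: "admissible C U c d (Ide D X)"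
    if c: "initial_lift C D U X src c" and d: "initial_lift C D U X src d" for c d
  proof -
    have *: "c \<in> Obj C" "FO U c = X" "FO U d = X" "Ide D X \<in> hom D X X"
      using c d X D.ide_in by (auto simp: initial_lift_def)
    have "admissible C U c W (Cmp D f (Ide D X))" if "(W, f) \<in> src" for W f
    proof -
      have "f \<in> hom D X (FO U W)" "admissible C U c W f"
        using c that by (auto simp: initial_lift_def structured_source_def)
      then show ?thesis by (simp add: D.cmp_ide_right)
    qed
    then show ?thesis
      using d * by (auto simp: initial_lift_def initial_source_def)
  qed
  show ?thesis
    using amn X ide[OF a b] ide[OF b a] unfolding amnestic_def by auto
qed

section \<open>Adjunctions from universal arrows\<close>

definition univ_map ::
  "('o, 'm) cat \<Rightarrow> ('p, 'n) cat \<Rightarrow> ('o, 'm, 'p, 'n) ftor \<Rightarrow> ('p \<Rightarrow> 'o) \<Rightarrow> ('p \<Rightarrow> 'n)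
    \<Rightarrow> 'p \<Rightarrow> 'o \<Rightarrow> 'n \<Rightarrow> 'm"
  where "univ_map A B G F0 eta b a f =
    (THE h. h \<in> hom A (F0 b) a \<and> Cmp B (FA G h) (eta b) = f)"

text \<open>The definitions of \<open>univ_map\<close>, \<open>free_ftor\<close> and
  \<open>free_counit\<close> copy the shape of \<open>sharp\<close>, \<open>term_ftor\<close> and
  \<open>term_counit\<close>, with the free object and the unit as parameters. The classical
  adjunction thereby becomes an instance of the general construction.\<close>

definition free_ftor ::
  "('o, 'm) cat \<Rightarrow> ('p, 'n) cat \<Rightarrow> ('o, 'm, 'p, 'n) ftor \<Rightarrow> ('p \<Rightarrow> 'o) \<Rightarrow> ('p \<Rightarrow> 'n)
    \<Rightarrow> ('p, 'n, 'o, 'm) ftor"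
  where "free_ftor A B G F0 eta =
    \<lparr>FO = F0, FA = \<lambda>f. univ_map A B G F0 eta (Dom B f) (F0 (Cod B f)) (Cmp B (eta (Cod B f)) f)\<rparr>"

definition free_counit ::
  "('o, 'm) cat \<Rightarrow> ('p, 'n) cat \<Rightarrow> ('o, 'm, 'p, 'n) ftor \<Rightarrow> ('p \<Rightarrow> 'o) \<Rightarrow> ('p \<Rightarrow> 'n)
    \<Rightarrow> 'o \<Rightarrow> 'm"
  where "free_counit A B G F0 eta a = univ_map A B G F0 eta (FO G a) a (Ide B (FO G a))"

text \<open>An adjunction in a small presentation: \<open>F0\<close> acts on objects only, and the
  rest of the left adjoint is recovered from the universal property. Both the term algebras and the
  lifted free algebras are verified in this form, and equations between the two adjunctions become
  equations between transposes.\<close>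

locale universal_arrows = G: cat_functor A B G
  for A :: "('o, 'm) cat" and B :: "('p, 'n) cat" and G :: "('o, 'm, 'p, 'n) ftor" +
  fixes F0 :: "'p \<Rightarrow> 'o" and eta :: "'p \<Rightarrow> 'n"
  assumes F0_in: "b \<in> Obj B \<Longrightarrow> F0 b \<in> Obj A"
    and eta_in: "b \<in> Obj B \<Longrightarrow> eta b \<in> hom B b (FO G (F0 b))"
    and universal: "b \<in> Obj B \<Longrightarrow> a \<in> Obj A \<Longrightarrow> f \<in> hom B b (FO G a) \<Longrightarrow>
      \<exists>!h. h \<in> hom A (F0 b) a \<and> Cmp B (FA G h) (eta b) = f"
begin

abbreviation "uni \<equiv> univ_map A B G F0 eta"
abbreviation "F \<equiv> free_ftor A B G F0 eta"
abbreviation "eps \<equiv> free_counit A B G F0 eta"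

lemma
  assumes "a \<in> Obj A" "f \<in> hom B b (FO G a)"
  shows uni_in: "uni b a f \<in> hom A (F0 b) a"
    and uni_eta: "Cmp B (FA G (uni b a f)) (eta b) = f"
  using theI'[OF universal[OF G.D.hom_obj(1)[OF assms(2)] assms]]
  unfolding univ_map_def by blast+

text \<open>The type of \<open>f\<close> is inherited from that of \<open>h\<close>, so the rule
  applies to every arrow of the form \<open>Cmp B (FA G h) (eta b)\<close>.\<close>

lemma uni_unique:
  assumes h: "h \<in> hom A (F0 b) a" and b: "b \<in> Obj B" and eq: "Cmp B (FA G h) (eta b) = f"
  shows "uni b a f = h"
proof -
  have a: "a \<in> Obj A" using G.C.hom_obj h by blast
  have "Cmp B (FA G h) (eta b) \<in> hom B b (FO G a)"
    by (rule G.D.cmp_in[OF eta_in[OF b] G.fa_in[OF h]])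
  then have f: "f \<in> hom B b (FO G a)" using eq by simp
  show ?thesis
    using universal[OF b a f] uni_in[OF a f] uni_eta[OF a f] h eq by blast
qed

text \<open>Naturality of transposition in the target: both sides restrict along the unit to the
  same arrow.\<close>

lemma cmp_uni:
  assumes f: "f \<in> hom B b (FO G a)" and a: "a \<in> Obj A" and k: "k \<in> hom A a a'"
  shows "Cmp A k (uni b a f) = uni b a' (Cmp B (FA G k) f)"
proof -
  have b: "b \<in> Obj B" by (rule G.D.hom_obj[OF f])
  have "Cmp B (FA G (Cmp A k (uni b a f))) (eta b)
    = Cmp B (Cmp B (FA G k) (FA G (uni b a f))) (eta b)"
    by (simp add: G.fa_cmp[OF uni_in[OF a f] k])
  also have "\<dots> = Cmp B (FA G k) (Cmp B (FA G (uni b a f)) (eta b))"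
    by (rule G.D.cmp_assoc[symmetric, OF eta_in[OF b] G.fa_in[OF uni_in[OF a f]] G.fa_in[OF k]])
  also have "\<dots> = Cmp B (FA G k) f" by (simp add: uni_eta[OF a f])
  finally show ?thesis
    using uni_unique G.C.cmp_in[OF uni_in[OF a f] k] b by metis
qed

lemma F_arr:
  assumes g: "g \<in> hom B b c"
  shows "FA F g = uni b (F0 c) (Cmp B (eta c) g)"
  using homD[OF g] by (simp add: free_ftor_def)

lemma F_in:
  assumes g: "g \<in> hom B b c"
  shows "FA F g \<in> hom A (F0 b) (F0 c)"
  using uni_in F0_in G.D.hom_obj[OF g] G.D.cmp_in[OF g eta_in] F_arr[OF g] by simp

lemma F_eta:
  assumes g: "g \<in> hom B b c"
  shows "Cmp B (FA G (FA F g)) (eta b) = Cmp B (eta c) g"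
  using uni_eta F0_in G.D.hom_obj[OF g] G.D.cmp_in[OF g eta_in] F_arr[OF g] by simp

text \<open>Naturality of transposition in the source. As \<open>FA F g\<close> is itself a
  transpose, \<open>cmp_uni\<close> applies to it.\<close>

lemma uni_F:
  assumes g: "g \<in> hom B b c" and f: "f \<in> hom B c (FO G a)" and a: "a \<in> Obj A"
  shows "Cmp A (uni c a f) (FA F g) = uni b a (Cmp B f g)"
proof -
  have c: "c \<in> Obj B" by (rule G.D.hom_obj[OF f])
  have "Cmp A (uni c a f) (FA F g)
    = uni b a (Cmp B (FA G (uni c a f)) (Cmp B (eta c) g))"
    unfolding F_arr[OF g]
    by (rule cmp_uni[OF G.D.cmp_in[OF g eta_in[OF c]] F0_in[OF c] uni_in[OF a f]])
  also have "Cmp B (FA G (uni c a f)) (Cmp B (eta c) g)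
    = Cmp B (Cmp B (FA G (uni c a f)) (eta c)) g"
    by (rule G.D.cmp_assoc[OF g eta_in[OF c] G.fa_in[OF uni_in[OF a f]]])
  finally show ?thesis by (simp add: uni_eta[OF a f])
qed

lemma eps_in: "a \<in> Obj A \<Longrightarrow> eps a \<in> hom A (F0 (FO G a)) a"
  unfolding free_counit_def by (intro uni_in G.D.ide_in G.fo_in)

lemma F_functor: "cat_functor B A F"
proof
  fix b assume b: "b \<in> Obj B"
  then show "FO F b \<in> Obj A" by (simp add: free_ftor_def F0_in)
  have "FA F (Ide B b) = uni b (F0 b) (eta b)"
    using F_arr[OF G.D.ide_in[OF b]] G.D.cmp_ide_right[OF eta_in[OF b]] by simp
  also have "\<dots> = Ide A (F0 b)"
    using b eta_in F0_in
    by (intro uni_unique) (auto simp: G.C.ide_in G.fa_ide intro!: G.D.cmp_ide_left)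
  finally show "FA F (Ide B b) = Ide A (FO F b)" by (simp add: free_ftor_def)
next
  fix f a b assume "f \<in> hom B a b"
  then show "FA F f \<in> hom A (FO F a) (FO F b)" using F_in by (simp add: free_ftor_def)
next
  fix f a b g c assume f: "f \<in> hom B a b" and g: "g \<in> hom B b c"
  have c: "c \<in> Obj B" by (rule G.D.hom_obj[OF g])
  have "Cmp A (FA F g) (FA F f) = uni a (F0 c) (Cmp B (Cmp B (eta c) g) f)"
    unfolding F_arr[OF g] by (rule uni_F[OF f G.D.cmp_in[OF g eta_in[OF c]] F0_in[OF c]])
  also have "Cmp B (Cmp B (eta c) g) f = Cmp B (eta c) (Cmp B g f)"
    by (rule G.D.cmp_assoc[symmetric, OF f g eta_in[OF c]])
  finally show "FA F (Cmp B g f) = Cmp A (FA F g) (FA F f)"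
    by (simp add: F_arr[OF G.D.cmp_in[OF f g]])
qed

text \<open>Each law compares two transposes. Both sides of the naturality square of the counit
  transpose \<open>FA G f\<close>; one triangle is the defining property of the transpose of an
  identity, and in the other both sides transpose the unit.\<close>

theorem free_adjunction: "adjunction A B F G eta eps"
proof -
  interpret F: cat_functor B A F by (rule F_functor)
  have FO: "FO F b = F0 b" for b by (simp add: free_ftor_def)
  show ?thesis
  proof
    fix a assume a: "a \<in> Obj B"
    show "FO id_ftor a \<in> Obj B" "FO (comp_ftor G F) a \<in> Obj B"
      using a F0_in G.fo_in by (simp_all add: id_ftor_def comp_ftor_def FO)
    show "FA id_ftor (Ide B a) = Ide B (FO id_ftor a)" by (simp add: id_ftor_def)
    show "FA (comp_ftor G F) (Ide B a) = Ide B (FO (comp_ftor G F) a)"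
      using a by (simp add: comp_ftor_def F.fa_ide G.fa_ide F.fo_in)
    show "eta a \<in> hom B (FO id_ftor a) (FO (comp_ftor G F) a)"
      using eta_in[OF a] by (simp add: id_ftor_def comp_ftor_def FO)
    have "Cmp A (eps (F0 a)) (FA F (eta a))
      = uni a (F0 a) (Cmp B (Ide B (FO G (F0 a))) (eta a))"
      unfolding free_counit_def
      by (rule uni_F[OF eta_in[OF a] G.D.ide_in[OF G.fo_in[OF F0_in[OF a]]] F0_in[OF a]])
    also have "\<dots> = uni a (F0 a) (eta a)" by (simp add: G.D.cmp_ide_left[OF eta_in[OF a]])
    also have "\<dots> = Ide A (F0 a)"
      using a eta_in F0_in
      by (intro uni_unique) (auto simp: G.C.ide_in G.fa_ide intro!: G.D.cmp_ide_left)
    finally show "Cmp A (eps (FO F a)) (FA F (eta a)) = Ide A (FO F a)" by (simp add: FO)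
  next
    fix f a b assume f: "f \<in> hom B a b"
    show "FA id_ftor f \<in> hom B (FO id_ftor a) (FO id_ftor b)" using f by (simp add: id_ftor_def)
    show "FA (comp_ftor G F) f \<in> hom B (FO (comp_ftor G F) a) (FO (comp_ftor G F) b)"
      using G.fa_in[OF F.fa_in[OF f]] by (simp add: comp_ftor_def)
    show "Cmp B (eta b) (FA id_ftor f) = Cmp B (FA (comp_ftor G F) f) (eta a)"
      using F_eta[OF f] by (simp add: id_ftor_def comp_ftor_def)
    fix g c assume g: "g \<in> hom B b c"
    show "FA id_ftor (Cmp B g f) = Cmp B (FA id_ftor g) (FA id_ftor f)" by (simp add: id_ftor_def)
    show "FA (comp_ftor G F) (Cmp B g f) = Cmp B (FA (comp_ftor G F) g) (FA (comp_ftor G F) f)"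
      using f g by (simp add: comp_ftor_def F.fa_cmp G.fa_cmp[OF F.fa_in F.fa_in])
  next
    fix a assume a: "a \<in> Obj A"
    show "FO id_ftor a \<in> Obj A" "FO (comp_ftor F G) a \<in> Obj A"
      using a F0_in G.fo_in by (simp_all add: id_ftor_def comp_ftor_def FO)
    show "FA id_ftor (Ide A a) = Ide A (FO id_ftor a)" by (simp add: id_ftor_def)
    show "FA (comp_ftor F G) (Ide A a) = Ide A (FO (comp_ftor F G) a)"
      using a by (simp add: comp_ftor_def F.fa_ide G.fa_ide G.fo_in)
    show "eps a \<in> hom A (FO (comp_ftor F G) a) (FO id_ftor a)"
      using eps_in[OF a] by (simp add: id_ftor_def comp_ftor_def FO)
    show "Cmp B (FA G (eps a)) (eta (FO G a)) = Ide B (FO G a)"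
      unfolding free_counit_def by (rule uni_eta[OF a G.D.ide_in[OF G.fo_in[OF a]]])
  next
    fix f a b assume f: "f \<in> hom A a b"
    have a: "a \<in> Obj A" and b: "b \<in> Obj A" using G.C.hom_obj[OF f] by auto
    show "FA id_ftor f \<in> hom A (FO id_ftor a) (FO id_ftor b)" using f by (simp add: id_ftor_def)
    show "FA (comp_ftor F G) f \<in> hom A (FO (comp_ftor F G) a) (FO (comp_ftor F G) b)"
      using F.fa_in[OF G.fa_in[OF f]] by (simp add: comp_ftor_def)
    have "Cmp A (eps b) (FA F (FA G f)) = uni (FO G a) b (Cmp B (Ide B (FO G b)) (FA G f))"
      unfolding free_counit_def
      by (rule uni_F[OF G.fa_in[OF f] G.D.ide_in[OF G.fo_in[OF b]] b])
    also have "\<dots> = uni (FO G a) b (Cmp B (FA G f) (Ide B (FO G a)))"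
      by (simp add: G.D.cmp_ide_left[OF G.fa_in[OF f]] G.D.cmp_ide_right[OF G.fa_in[OF f]])
    also have "\<dots> = Cmp A f (eps a)"
      unfolding free_counit_def
      by (rule cmp_uni[symmetric, OF G.D.ide_in[OF G.fo_in[OF a]] a f])
    finally show "Cmp A (eps b) (FA (comp_ftor F G) f) = Cmp A (FA id_ftor f) (eps a)"
      by (simp add: id_ftor_def comp_ftor_def)
    fix g c assume g: "g \<in> hom A b c"
    show "FA id_ftor (Cmp A g f) = Cmp A (FA id_ftor g) (FA id_ftor f)" by (simp add: id_ftor_def)
    show "FA (comp_ftor F G) (Cmp A g f) = Cmp A (FA (comp_ftor F G) g) (FA (comp_ftor F G) f)"
      using f g by (simp add: comp_ftor_def G.fa_cmp F.fa_cmp[OF G.fa_in G.fa_in])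
  qed
qed

end

section \<open>Lifting universal arrows along a taut square\<close>

locale taut_lift = G: cat_functor A B G + T: cat_functor A A' T + R: cat_functor B B' R
    + W: universal_arrows A' B' G' F0' eta'
  for A :: "('o, 'm) cat" and B :: "('p, 'n) cat" and A' :: "('o', 'm') cat"
    and B' :: "('p', 'n') cat" and G T R G' F0' eta' +
  assumes faithful_T: "faithful A T" and amnestic_T: "amnestic A A' T"
    and faithful_R: "faithful B R" and amnestic_R: "amnestic B B' R"
    and square: "ftor_eq A (comp_ftor G' T) (comp_ftor R G)"
    and lift_exists: "structured_source A A' T X src \<Longrightarrow> \<exists>a. initial_lift A A' T X src a \<and>
      initial_lift B B' R (FO G' X) ((\<lambda>(W, h). (FO G W, FA G' h)) ` src) (FO G a)"
begin

lemma square_obj: "a \<in> Obj A \<Longrightarrow> FO G' (FO T a) = FO R (FO G a)"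
  using square by (simp add: ftor_eq_def comp_ftor_def)

lemma square_arr: "f \<in> hom A a b \<Longrightarrow> FA G' (FA T f) = FA R (FA G f)"
  using square by (simp add: ftor_eq_def comp_ftor_def hom_def)

text \<open>The structured source of the theorem in abstract form: the transposes, taken in the
  lower adjunction, of the underlying maps of all \<open>f\<close> out of \<open>X\<close>.\<close>

definition src :: "'p \<Rightarrow> ('o \<times> 'm') set"
  where "src X = {(a, W.uni (FO R X) (FO T a) (FA R f)) |a f.
    a \<in> Obj A \<and> f \<in> hom B X (FO G a)}"

text \<open>Initial lifts being unique, the choice is no choice: \<open>F0_lift\<close> turns it
  into an equivalence.\<close>

definition F0 :: "'p \<Rightarrow> 'o"
  where "F0 X = (SOME a. initial_lift A A' T (F0' (FO R X)) (src X) a)"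

definition eta :: "'p \<Rightarrow> 'n"
  where "eta X = (SOME e. e \<in> hom B X (FO G (F0 X)) \<and> FA R e = eta' (FO R X))"

lemma R_hom: "a \<in> Obj A \<Longrightarrow> f \<in> hom B X (FO G a) \<Longrightarrow> FA R f \<in> hom B' (FO R X) (FO G' (FO T a))"
  using R.fa_in by (simp add: square_obj)

lemma src_structured:
  assumes X: "X \<in> Obj B"
  shows "structured_source A A' T (F0' (FO R X)) (src X)"
proof -
  have "F0' (FO R X) \<in> Obj A'" by (rule W.F0_in[OF R.fo_in[OF X]])
  moreover have "W.uni (FO R X) (FO T a) (FA R f) \<in> hom A' (F0' (FO R X)) (FO T a)"
    if "a \<in> Obj A" "f \<in> hom B X (FO G a)" for a f
    using W.uni_in[OF T.fo_in R_hom] that by blast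
  ultimately show ?thesis
    unfolding structured_source_def src_def by auto
qed

lemma F0_lift:
  assumes X: "X \<in> Obj B"
  shows "initial_lift A A' T (F0' (FO R X)) (src X) a \<longleftrightarrow> a = F0 X"
proof -
  have ex: "\<exists>a. initial_lift A A' T (F0' (FO R X)) (src X) a"
    using lift_exists[OF src_structured[OF X]] by blast
  have "initial_lift A A' T (F0' (FO R X)) (src X) (F0 X)"
    unfolding F0_def by (rule someI_ex[OF ex])
  then show ?thesis
    using initial_lift_unique[OF T.cat_functor_axioms amnestic_T] by metis
qed

text \<open>Tautness enters here. The object supplied by \<open>lift_exists\<close> is initial at
  both levels, and by \<open>F0_lift\<close> it is \<open>F0 X\<close>, which therefore inherits the
  initiality of its image under \<open>G\<close>.\<close>

lemma GF0_lift:
  assumes X: "X \<in> Obj B"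
  shows "initial_lift B B' R (FO G' (F0' (FO R X)))
    ((\<lambda>(W, h). (FO G W, FA G' h)) ` src X) b \<longleftrightarrow> b = FO G (F0 X)" (is "?L b \<longleftrightarrow> _")
proof -
  have "?L (FO G (F0 X))"
    using lift_exists[OF src_structured[OF X]] F0_lift[OF X] by metis
  then show ?thesis
    using initial_lift_unique[OF R.cat_functor_axioms amnestic_R] by metis
qed

lemma F0_obj: "X \<in> Obj B \<Longrightarrow> F0 X \<in> Obj A \<and> FO T (F0 X) = F0' (FO R X)"
  using F0_lift by (auto simp: initial_lift_def)

text \<open>The lower unit is tested against the source in \<open>B\<close>: composed with the
  member belonging to \<open>f\<close> it gives \<open>FA R f\<close>, which is lifted by
  \<open>f\<close> itself.\<close>

lemma eta:
  assumes X: "X \<in> Obj B"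
  shows "eta X \<in> hom B X (FO G (F0 X)) \<and> FA R (eta X) = eta' (FO R X)"
proof -
  have RX: "FO R X \<in> Obj B'" by (rule R.fo_in[OF X])
  have "admissible B R X (FO G (F0 X)) (eta' (FO R X))"
  proof -
    have init: "initial_source B B' R (FO G (F0 X)) ((\<lambda>(W, h). (FO G W, FA G' h)) ` src X)"
      and eq: "FO R (FO G (F0 X)) = FO G' (F0' (FO R X))"
      using GF0_lift[OF X] by (auto simp: initial_lift_def)
    have "admissible B R X (FO G a)
        (Cmp B' (FA G' (W.uni (FO R X) (FO T a) (FA R f))) (eta' (FO R X)))"
      if "a \<in> Obj A" "f \<in> hom B X (FO G a)" for a f
      using W.uni_eta[OF T.fo_in R_hom] that by (auto simp: admissible_def)
    then have "\<forall>(W, h)\<in>(\<lambda>(W, h). (FO G W, FA G' h)) ` src X.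
        admissible B R X W (Cmp B' h (eta' (FO R X)))"
      by (auto simp: src_def)
    moreover have "eta' (FO R X) \<in> hom B' (FO R X) (FO R (FO G (F0 X)))"
      using W.eta_in[OF RX] eq by simp
    ultimately show ?thesis using init X unfolding initial_source_def by blast
  qed
  then show ?thesis
    unfolding eta_def admissible_def Bex_def by (rule someI_ex)
qed

text \<open>The transpose of \<open>FA R f\<close> is a member of \<open>src X\<close>, hence
  admissible out of \<open>F0 X\<close>. The triangle for its lift holds after applying the faithful
  \<open>R\<close>, where it is the triangle of the lower adjunction.\<close>

lemma lifted_universal:
  assumes X: "X \<in> Obj B" and a: "a \<in> Obj A" and f: "f \<in> hom B X (FO G a)"
  shows "\<exists>h. h \<in> hom A (F0 X) a \<and> FA T h = W.uni (FO R X) (FO T a) (FA R f) \<and>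
    Cmp B (FA G h) (eta X) = f"
proof -
  have "admissible A T (F0 X) a (W.uni (FO R X) (FO T a) (FA R f))"
    using F0_lift[OF X, of "F0 X"] a f unfolding initial_lift_def src_def by auto
  then obtain h where h: "h \<in> hom A (F0 X) a"
    and Th: "FA T h = W.uni (FO R X) (FO T a) (FA R f)"
    by (auto simp: admissible_def)
  have Gh: "FA G h \<in> hom B (FO G (F0 X)) (FO G a)" by (rule G.fa_in[OF h])
  have e: "eta X \<in> hom B X (FO G (F0 X))" using eta[OF X] by blast
  have "FA R (Cmp B (FA G h) (eta X)) = Cmp B' (FA G' (FA T h)) (eta' (FO R X))"
    using R.fa_cmp[OF e Gh] eta[OF X] square_arr[OF h] by simp
  also have "\<dots> = FA R f" unfolding Th by (rule W.uni_eta[OF T.fo_in[OF a] R_hom[OF a f]])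
  finally have "Cmp B (FA G h) (eta X) = f"
    by (rule faithfulD[OF faithful_R G.D.cmp_in[OF e Gh] f])
  with h Th show ?thesis by blast
qed

text \<open>Since the unit lies over the lower unit, the image of \<open>h\<close> below is forced
  to be the transpose of the restriction of \<open>h\<close> along \<open>eta X\<close>.
  Faithfulness of \<open>T\<close> then leaves at most one \<open>h\<close> with a given
  restriction.\<close>

lemma universal_unique:
  assumes X: "X \<in> Obj B" and h: "h \<in> hom A (F0 X) a"
  shows "FA T h = W.uni (FO R X) (FO T a) (FA R (Cmp B (FA G h) (eta X)))"
proof -
  have "FA R (Cmp B (FA G h) (eta X)) = Cmp B' (FA G' (FA T h)) (eta' (FO R X))"
    using R.fa_cmp[OF conjunct1[OF eta[OF X]] G.fa_in[OF h]] eta[OF X] square_arr[OF h] by simp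
  then show ?thesis
    using W.uni_unique T.fa_in[OF h] F0_obj[OF X] R.fo_in[OF X] by metis
qed

sublocale L: universal_arrows A B G F0 eta
proof
  fix X assume X: "X \<in> Obj B"
  show "F0 X \<in> Obj A" "eta X \<in> hom B X (FO G (F0 X))" using F0_obj eta X by auto
  fix a f assume a: "a \<in> Obj A" and f: "f \<in> hom B X (FO G a)"
  obtain h where h: "h \<in> hom A (F0 X) a" "Cmp B (FA G h) (eta X) = f"
    using lifted_universal[OF X a f] by blast
  show "\<exists>!h. h \<in> hom A (F0 X) a \<and> Cmp B (FA G h) (eta X) = f"
  proof (rule ex1I[of _ h])
    fix k assume k: "k \<in> hom A (F0 X) a \<and> Cmp B (FA G k) (eta X) = f"
    then have "FA T k = FA T h" using universal_unique[OF X] h by metis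
    then show "k = h" using faithfulD[OF faithful_T] k h by blast
  qed (use h in blast)
qed

text \<open>Transposes lie over transposes. Applied to \<open>Cmp B (eta Y) f\<close> and to
  identities, this gives strict equality of the left adjoints on arrows and of the counits.\<close>

lemma T_uni:
  assumes X: "X \<in> Obj B" and a: "a \<in> Obj A" and f: "f \<in> hom B X (FO G a)"
  shows "FA T (L.uni X a f) = W.uni (FO R X) (FO T a) (FA R f)"
  using lifted_universal[OF assms] L.uni_unique[OF _ X] by metis

theorem lifting:
  "adjunction_lifting A B L.F G eta L.eps A' B' W.F G' eta' W.eps T R"
proof -
  interpret first: adjunction A B L.F G eta L.eps by (rule L.free_adjunction)
  interpret second: adjunction A' B' W.F G' eta' W.eps by (rule W.free_adjunction)
  show ?thesis
  proof
    show "ftor_eq A (comp_ftor G' T) (comp_ftor R G)" by (rule square)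
    show "ftor_eq B (comp_ftor W.F R) (comp_ftor T L.F)"
      unfolding ftor_eq_def
    proof (intro conjI ballI)
      fix X assume "X \<in> Obj B"
      then show "FO (comp_ftor W.F R) X = FO (comp_ftor T L.F) X"
        using F0_obj by (simp add: comp_ftor_def free_ftor_def)
    next
      fix f assume "f \<in> Arr B"
      then obtain X Y where f: "f \<in> hom B X Y" by (rule that[OF Arr_hom])
      note XY = G.D.hom_obj[OF f]
      note e = conjunct1[OF eta[OF XY(2)]]
      \<comment> \<open>Both sides transpose the same map, because \<open>R\<close> sends
        \<open>Cmp B (eta Y) f\<close> to the composite of the lower unit with
        \<open>FA R f\<close>.\<close>
      have "FA T (FA L.F f) = W.uni (FO R X) (FO T (F0 Y)) (FA R (Cmp B (eta Y) f))"
        unfolding L.F_arr[OF f]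
        by (rule T_uni[OF XY(1) L.F0_in[OF XY(2)] G.D.cmp_in[OF f e]])
      also have "\<dots> = FA W.F (FA R f)"
        using F0_obj[OF XY(2)] eta[OF XY(2)]
        by (simp add: W.F_arr[OF R.fa_in[OF f]] R.fa_cmp[OF f e])
      finally show "FA (comp_ftor W.F R) f = FA (comp_ftor T L.F) f"
        by (simp add: comp_ftor_def)
    qed
    show "FA R (eta b) = eta' (FO R b)" if "b \<in> Obj B" for b
      by (rule conjunct2[OF eta[OF that]])
    show "FA T (L.eps a) = W.eps (FO T a)" if a: "a \<in> Obj A" for a
      unfolding free_counit_def
      using T_uni[OF G.fo_in[OF a] a G.D.ide_in[OF G.fo_in[OF a]]]
      by (simp add: R.fa_ide[OF G.fo_in[OF a]] square_obj[OF a])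
  qed
qed

end

subsection \<open>Small sets, the category of sets and powers of categories\<close>

lemma tup_eq_iff [simp]: "tup xs = tup ys \<longleftrightarrow> xs = ys"
  by (rule inj_eq[OF inj_tup])

lemma untup_tup [simp]: "untup (tup xs) = xs"
  by (simp add: untup_def inv_f_f[OF inj_tup])

lemma listset_iff: "zs \<in> listset Xs \<longleftrightarrow> list_all2 (\<in>) zs Xs"
  by (induction Xs arbitrary: zs) (auto simp: set_Cons_def list_all2_Cons2)

lemma tprod_iff: "z \<in> tprod Xs \<longleftrightarrow> (\<exists>zs. z = tup zs \<and> list_all2 (\<in>) zs Xs)"
  by (auto simp: tprod_def listset_iff)

lemma tup_in_tprod [simp]: "tup zs \<in> tprod Xs \<longleftrightarrow> list_all2 (\<in>) zs Xs"
  by (auto simp: tprod_iff)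

lemma tprod_pair_iff: "z \<in> tprod [X, Y] \<longleftrightarrow> (\<exists>x y. z = tup [x, y] \<and> x \<in> X \<and> y \<in> Y)"
  by (auto simp: tprod_iff list_all2_Cons2)

lemma small_empty: "small ({} :: 'u::set_universe set)"
  using small_infinite small_subset by blast

lemma small_singleton: "small {x :: 'u::set_universe}"
proof -
  obtain X :: "'u set" where X: "small X" "infinite X" using small_infinite by blast
  have "X \<noteq> {}" using X(2) by auto
  then have "(\<lambda>_. x) ` X = {x}" by auto
  then show ?thesis using small_image[OF X(1)] by metis
qed

text \<open>The axioms allow unions indexed by small subsets of the universe only. An infinite small
  set contains a copy of the natural numbers, and the union is reindexed along it.\<close>

lemma small_UN_nat:
  fixes F :: "nat \<Rightarrow> 'u::set_universe set"
  assumes "\<And>n. small (F n)"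
  shows "small (\<Union>n. F n)"
proof -
  obtain X :: "'u set" where X: "small X" "infinite X" using small_infinite by blast
  obtain g :: "nat \<Rightarrow> 'u" where g: "inj g" "range g \<subseteq> X"
    using infinite_countable_subset[OF X(2)] by blast
  have "small (\<Union>x\<in>range g. F (inv g x))"
    using assms by (intro small_UN small_subset[OF X(1) g(2)])
  also have "(\<Union>x\<in>range g. F (inv g x)) = (\<Union>n. F n)"
    using g(1) by simp
  finally show ?thesis .
qed

lemma small_Un:
  fixes X Y :: "'u::set_universe set"
  assumes "small X" "small Y"
  shows "small (X \<union> Y)"
proof -
  have "small (\<Union>n::nat. if n = 0 then X else Y)" using assms by (intro small_UN_nat) simp
  then show ?thesis by (rule small_subset) (auto intro: exI[of _ "Suc 0"])
qed

text \<open>A tuple over \<open>X # Xs\<close> is a head from \<open>X\<close> put before a tuple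
  over \<open>Xs\<close>, so the product is covered by a small union of images of a small set; this
  replaces an appeal to power sets.\<close>

lemma small_tprod:
  fixes Xs :: "'u::set_universe set list"
  assumes "\<And>X. X \<in> set Xs \<Longrightarrow> small X"
  shows "small (tprod Xs)"
  using assms
proof (induction Xs)
  case Nil
  then show ?case by (simp add: tprod_def small_singleton)
next
  case (Cons X Xs)
  have "small (\<Union>x\<in>X. (\<lambda>z. tup (x # untup z)) ` tprod Xs)"
    using Cons by (intro small_UN small_image) auto
  moreover have "tprod (X # Xs) \<subseteq> (\<Union>x\<in>X. (\<lambda>z. tup (x # untup z)) ` tprod Xs)"
    by (force simp: tprod_iff list_all2_Cons2)
  ultimately show ?case by (rule small_subset)
qed

section \<open>The category of small sets\<close>

lemma set_hom_iff:
  "f \<in> hom set_cat X Y \<longleftrightarrow>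
    small X \<and> small Y \<and> source f = X \<and> target f = Y \<and> app f \<in> X \<rightarrow>\<^sub>E Y"
  by (auto simp: hom_def set_cat_def)

lemma set_cmp_hom:
  assumes "f \<in> hom set_cat X Y" "g \<in> hom set_cat Y Z"
  shows "Cmp set_cat g f = Arrow X (\<lambda>x\<in>X. app g (app f x)) Z"
  using assms unfolding set_hom_iff by (simp add: set_cat_def compose_def)

lemma app_cmp:
  assumes "f \<in> hom set_cat X Y" "g \<in> hom set_cat Y Z" "x \<in> X"
  shows "app (Cmp set_cat g f) x = app g (app f x)"
  using assms by (simp add: set_cmp_hom)

lemma app_in: "f \<in> hom set_cat X Y \<Longrightarrow> x \<in> X \<Longrightarrow> app f x \<in> Y"
  by (auto simp: set_hom_iff)

text \<open>Functions of arrows are extensional, so off the source both are \<open>undefined\<close>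
  and agreement on the source is equality.\<close>

lemma set_arrow_eqI:
  assumes "f \<in> hom set_cat X Y" "g \<in> hom set_cat X Y" "\<And>x. x \<in> X \<Longrightarrow> app f x = app g x"
  shows "f = g"
proof -
  have "app f = app g"
    using assms by (intro PiE_ext[of "app f" X "\<lambda>_. Y"]) (auto simp: set_hom_iff)
  then show ?thesis using assms by (cases f; cases g) (auto simp: set_hom_iff)
qed

lemma set_ide: "Ide set_cat X = Arrow X (\<lambda>x\<in>X. x) X"
  by (simp add: set_cat_def)

lemma set_obj [simp]: "X \<in> Obj set_cat \<longleftrightarrow> small X"
  by (simp add: set_cat_def)

lemma app_ide: "x \<in> X \<Longrightarrow> app (Ide set_cat X) x = x"
  by (simp add: set_ide)

lemma set_ide_in: "small X \<Longrightarrow> Ide set_cat X \<in> hom set_cat X X"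
  by (auto simp: set_hom_iff set_ide)

lemma set_cmp_in: "f \<in> hom set_cat X Y \<Longrightarrow> g \<in> hom set_cat Y Z \<Longrightarrow> Cmp set_cat g f \<in> hom set_cat X Z"
  by (auto simp: set_cmp_hom) (auto simp: set_hom_iff)

lemma category_set_cat: "category (set_cat :: ('u::set_universe set, 'u set_arrow) cat)"
proof
  fix a :: "'u set"
  assume "a \<in> Obj set_cat"
  then show "Ide set_cat a \<in> hom set_cat a a" by (simp add: set_ide_in)
next
  fix f :: "'u set_arrow" and a b
  assume f: "f \<in> hom set_cat a b"
  then have ab: "Ide set_cat a \<in> hom set_cat a a" "Ide set_cat b \<in> hom set_cat b b"
    using set_ide_in unfolding set_hom_iff[of f] by auto
  show "Cmp set_cat f (Ide set_cat a) = f"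
    by (rule set_arrow_eqI[OF set_cmp_in[OF ab(1) f] f]) (simp add: app_cmp[OF ab(1) f] app_ide)
  show "Cmp set_cat (Ide set_cat b) f = f"
    using app_in[OF f]
    by (intro set_arrow_eqI[OF set_cmp_in[OF f ab(2)] f]) (simp add: app_cmp[OF f ab(2)] app_ide)
  fix g :: "'u set_arrow" and c
  assume g: "g \<in> hom set_cat b c"
  show gf: "Cmp set_cat g f \<in> hom set_cat a c" by (rule set_cmp_in[OF f g])
  fix h :: "'u set_arrow" and d
  assume h: "h \<in> hom set_cat c d"
  note hg = set_cmp_in[OF g h]
  show "Cmp set_cat h (Cmp set_cat g f) = Cmp set_cat (Cmp set_cat h g) f"
    using app_in[OF f]
    by (intro set_arrow_eqI[OF set_cmp_in[OF gf h] set_cmp_in[OF f hg]])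
      (simp add: app_cmp[OF f g] app_cmp[OF f hg] app_cmp[OF gf h] app_cmp[OF g h])
qed (auto simp: set_cat_def)

section \<open>Powers of categories and functors\<close>

lemma power_hom_iff:
  "f \<in> hom (power_cat Ss C) X Y \<longleftrightarrow> f \<in> extensional Ss \<and> X \<in> extensional Ss \<and>
    Y \<in> extensional Ss \<and> (\<forall>s\<in>Ss. f s \<in> hom C (X s) (Y s))"
  by (auto simp: hom_def power_cat_def PiE_iff extensional_def fun_eq_iff)

lemma power_obj_iff:
  "X \<in> Obj (power_cat Ss C) \<longleftrightarrow> X \<in> extensional Ss \<and> (\<forall>s\<in>Ss. X s \<in> Obj C)"
  by (auto simp: power_cat_def PiE_iff)

lemma power_ide: "Ide (power_cat Ss C) X = (\<lambda>s\<in>Ss. Ide C (X s))"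
  by (simp add: power_cat_def)

lemma power_cmp: "Cmp (power_cat Ss C) g f = (\<lambda>s\<in>Ss. Cmp C (g s) (f s))"
  by (simp add: power_cat_def)

lemma power_ftor_simps:
  "FO (power_ftor Ss F) X = (\<lambda>s\<in>Ss. FO F (X s))"
  "FA (power_ftor Ss F) f = (\<lambda>s\<in>Ss. FA F (f s))"
  by (simp_all add: power_ftor_def)

lemma category_power:
  assumes "category C"
  shows "category (power_cat Ss C)"
proof -
  interpret category C by fact
  show ?thesis
  proof
    fix f assume "f \<in> Arr (power_cat Ss C)"
    then show "Dom (power_cat Ss C) f \<in> Obj (power_cat Ss C)"
      "Cod (power_cat Ss C) f \<in> Obj (power_cat Ss C)"
      using dom_in cod_in by (auto simp: power_cat_def)
  next
    fix X assume "X \<in> Obj (power_cat Ss C)"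
    then show "Ide (power_cat Ss C) X \<in> hom (power_cat Ss C) X X"
      using ide_in by (simp add: power_hom_iff power_obj_iff power_ide)
  next
    fix f X Y assume f: "f \<in> hom (power_cat Ss C) X Y"
    have "Cmp C (f s) (Ide C (X s)) = f s" "Cmp C (Ide C (Y s)) (f s) = f s" if "s \<in> Ss" for s
      using f that cmp_ide_right cmp_ide_left by (auto simp: power_hom_iff)
    then show "Cmp (power_cat Ss C) f (Ide (power_cat Ss C) X) = f"
      "Cmp (power_cat Ss C) (Ide (power_cat Ss C) Y) f = f"
      using f by (auto simp: power_hom_iff power_ide power_cmp intro!: extensionalityI[of _ Ss])
    fix g Z assume g: "g \<in> hom (power_cat Ss C) Y Z"
    show "Cmp (power_cat Ss C) g f \<in> hom (power_cat Ss C) X Z"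
      using f g cmp_in unfolding power_hom_iff power_cmp by auto
    fix h W assume h: "h \<in> hom (power_cat Ss C) Z W"
    have "Cmp C (h s) (Cmp C (g s) (f s)) = Cmp C (Cmp C (h s) (g s)) (f s)" if "s \<in> Ss" for s
      using cmp_assoc[of "f s" "X s" "Y s" "g s" "Z s" "h s" "W s"] f g h that
      by (auto simp: power_hom_iff)
    then show "Cmp (power_cat Ss C) h (Cmp (power_cat Ss C) g f) =
        Cmp (power_cat Ss C) (Cmp (power_cat Ss C) h g) f"
      by (auto simp: power_cmp intro!: restrict_ext)
  qed
qed

lemma power_functor:
  assumes "cat_functor C D F"
  shows "cat_functor (power_cat Ss C) (power_cat Ss D) (power_ftor Ss F)"
proof -
  interpret cat_functor C D F by fact
  interpret pC: category "power_cat Ss C" by (rule category_power[OF C.category_axioms])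
  interpret pD: category "power_cat Ss D" by (rule category_power[OF D.category_axioms])
  show ?thesis
  proof
    fix X assume "X \<in> Obj (power_cat Ss C)"
    then show "FO (power_ftor Ss F) X \<in> Obj (power_cat Ss D)"
      "FA (power_ftor Ss F) (Ide (power_cat Ss C) X) =
        Ide (power_cat Ss D) (FO (power_ftor Ss F) X)"
      using fo_in fa_ide by (auto simp: power_obj_iff power_ide power_ftor_simps intro!: restrict_ext)
  next
    fix f X Y assume f: "f \<in> hom (power_cat Ss C) X Y"
    then show "FA (power_ftor Ss F) f
      \<in> hom (power_cat Ss D) (FO (power_ftor Ss F) X) (FO (power_ftor Ss F) Y)"
      using fa_in by (auto simp: power_hom_iff power_ftor_simps)
    fix g Z assume g: "g \<in> hom (power_cat Ss C) Y Z"
    have "FA F (Cmp C (g s) (f s)) = Cmp D (FA F (g s)) (FA F (f s))" if "s \<in> Ss" for s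
      using fa_cmp[of "f s" "X s" "Y s" "g s" "Z s"] f g that by (auto simp: power_hom_iff)
    then show "FA (power_ftor Ss F) (Cmp (power_cat Ss C) g f) =
        Cmp (power_cat Ss D) (FA (power_ftor Ss F) g) (FA (power_ftor Ss F) f)"
      by (auto simp: power_cmp power_ftor_simps intro!: restrict_ext)
  qed
qed

lemma power_faithful:
  assumes "faithful C U"
  shows "faithful (power_cat Ss C) (power_ftor Ss U)"
  unfolding faithful_def
proof (intro allI ballI impI)
  fix X Y f g
  assume f: "f \<in> hom (power_cat Ss C) X Y" and g: "g \<in> hom (power_cat Ss C) X Y"
    and eq: "FA (power_ftor Ss U) f = FA (power_ftor Ss U) g"
  have "f s = g s" if s: "s \<in> Ss" for s
  proof (rule faithfulD[OF assms])
    show "f s \<in> hom C (X s) (Y s)" "g s \<in> hom C (X s) (Y s)"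
      using f g s by (auto simp: power_hom_iff)
    show "FA U (f s) = FA U (g s)"
      using fun_cong[OF eq, of s] s by (simp add: power_ftor_simps)
  qed
  then show "f = g" using f g by (intro extensionalityI[of _ Ss]) (auto simp: power_hom_iff)
qed

text \<open>Lifts at the separate sorts are chosen independently and collected by
  \<open>restrict\<close>. The extensionality conjuncts are what the hom sets of a power add to the
  sortwise conditions.\<close>

lemma admissible_power_iff:
  "admissible (power_cat Ss C) (power_ftor Ss U) X Y f \<longleftrightarrow>
    X \<in> extensional Ss \<and> Y \<in> extensional Ss \<and> f \<in> extensional Ss \<and>
    (\<forall>s\<in>Ss. admissible C U (X s) (Y s) (f s))" (is "?L \<longleftrightarrow> ?R")
proof
  assume ?L
  then show ?R by (auto simp: admissible_def power_hom_iff power_ftor_simps)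
next
  assume R: ?R
  then obtain g where g: "\<forall>s\<in>Ss. g s \<in> hom C (X s) (Y s) \<and> FA U (g s) = f s"
    unfolding admissible_def by metis
  show ?L
    unfolding admissible_def
  proof (rule bexI[of _ "restrict g Ss"])
    show "FA (power_ftor Ss U) (restrict g Ss) = f"
      using g R by (auto simp: power_ftor_simps intro!: extensionalityI[of _ Ss])
    show "restrict g Ss \<in> hom (power_cat Ss C) X Y"
      using g R by (auto simp: power_hom_iff)
  qed
qed

lemma power_amnestic:
  assumes "amnestic C D U"
  shows "amnestic (power_cat Ss C) (power_cat Ss D) (power_ftor Ss U)"
  unfolding amnestic_def
proof (intro ballI impI)
  fix X Y
  assume X: "X \<in> Obj (power_cat Ss C)" and Y: "Y \<in> Obj (power_cat Ss C)"
    and eq: "FO (power_ftor Ss U) X = FO (power_ftor Ss U) Y"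
    and XY: "admissible (power_cat Ss C) (power_ftor Ss U) X Y
      (Ide (power_cat Ss D) (FO (power_ftor Ss U) X))"
    and YX: "admissible (power_cat Ss C) (power_ftor Ss U) Y X
      (Ide (power_cat Ss D) (FO (power_ftor Ss U) X))"
  have "X s = Y s" if s: "s \<in> Ss" for s
  proof -
    have "FO U (X s) = FO U (Y s)" using fun_cong[OF eq, of s] s by (simp add: power_ftor_simps)
    moreover have "admissible C U (X s) (Y s) (Ide D (FO U (X s)))"
      "admissible C U (Y s) (X s) (Ide D (FO U (X s)))"
      using XY YX s unfolding admissible_power_iff by (auto simp: power_ide power_ftor_simps)
    ultimately show ?thesis
      using assms X Y s unfolding amnestic_def by (auto simp: power_obj_iff)
  qed
  then show "X = Y" using X Y by (intro extensionalityI[of _ Ss]) (auto simp: power_obj_iff)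
qed

text \<open>Admissibility in a power is sortwise, so initiality is as well. The sortwise sources
  forget how \<open>W\<close> and \<open>f\<close> behave outside \<open>Ss\<close>, which is why
  extensionality of the members appears as an assumption.\<close>

lemma power_initial_lift:
  assumes X: "X \<in> extensional Ss" and Y: "Y \<in> extensional Ss"
    and src: "\<And>W f. (W, f) \<in> src \<Longrightarrow> W \<in> extensional Ss \<and> f \<in> extensional Ss"
    and lift: "\<And>s. s \<in> Ss \<Longrightarrow> initial_lift C D U (X s) ((\<lambda>(W, f). (W s, f s)) ` src) (Y s)"
  shows "initial_lift (power_cat Ss C) (power_cat Ss D) (power_ftor Ss U) X src Y"
proof -
  have lift': "X s \<in> Obj D" "Y s \<in> Obj C" "FO U (Y s) = X s"
    "initial_source C D U (Y s) ((\<lambda>(W, f). (W s, f s)) ` src)" if "s \<in> Ss" for s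
    using lift[OF that] by (auto simp: initial_lift_def structured_source_def)
  have mem: "W s \<in> Obj C" "f s \<in> hom D (X s) (FO U (W s))" "admissible C U (Y s) (W s) (f s)"
    if "(W, f) \<in> src" "s \<in> Ss" for W f s
    using lift[OF that(2)] that(1) by (auto simp: initial_lift_def structured_source_def)
  have UY: "FO (power_ftor Ss U) Y = X"
    using X lift'(3) by (auto simp: power_ftor_simps intro!: extensionalityI[of _ Ss])
  have "structured_source (power_cat Ss C) (power_cat Ss D) (power_ftor Ss U) X src"
    using X lift'(1) src mem
    by (auto simp: structured_source_def power_obj_iff power_hom_iff power_ftor_simps)
  moreover have "Y \<in> Obj (power_cat Ss C)" using Y lift'(2) by (simp add: power_obj_iff)
  moreover have "admissible (power_cat Ss C) (power_ftor Ss U) Y W f" if "(W, f) \<in> src" for W f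
    using mem(3)[OF that] src[OF that] Y by (simp add: admissible_power_iff)
  moreover have "initial_source (power_cat Ss C) (power_cat Ss D) (power_ftor Ss U) Y src"
    unfolding initial_source_def
  proof (intro ballI)
    fix Q f
    assume Q: "Q \<in> Obj (power_cat Ss C)"
      and f: "f \<in> hom (power_cat Ss D) (FO (power_ftor Ss U) Q) (FO (power_ftor Ss U) Y)"
    have fs: "admissible C U (Q s) (Y s) (f s) \<longleftrightarrow>
        (\<forall>(W, g) \<in> src. admissible C U (Q s) (W s) (Cmp D (g s) (f s)))" if s: "s \<in> Ss" for s
    proof -
      have "Q s \<in> Obj C" "f s \<in> hom D (FO U (Q s)) (FO U (Y s))"
        using Q f s by (auto simp: power_obj_iff power_hom_iff power_ftor_simps)
      then show ?thesis using lift'(4)[OF s] unfolding initial_source_def by auto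
    qed
    have "admissible (power_cat Ss C) (power_ftor Ss U) Q Y f \<longleftrightarrow>
        (\<forall>s\<in>Ss. admissible C U (Q s) (Y s) (f s))"
      using Q Y f by (auto simp: admissible_power_iff power_obj_iff power_hom_iff)
    \<comment> \<open>Sortwise initiality, followed by an exchange of the quantifiers over sorts and
      over members.\<close>
    also have "\<dots> \<longleftrightarrow> (\<forall>(W, g) \<in> src. \<forall>s\<in>Ss. admissible C U (Q s) (W s) (Cmp D (g s) (f s)))"
      using fs by auto
    also have "\<dots> \<longleftrightarrow> (\<forall>(W, g) \<in> src. admissible (power_cat Ss C) (power_ftor Ss U) Q W
        (Cmp (power_cat Ss D) g f))"
      using Q src by (auto simp: admissible_power_iff power_obj_iff power_cmp)
    finally show "admissible (power_cat Ss C) (power_ftor Ss U) Q Y f \<longleftrightarrow>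
        (\<forall>(W, g) \<in> src. admissible (power_cat Ss C) (power_ftor Ss U) Q W
          (Cmp (power_cat Ss D) g f))" .
  qed
  ultimately show ?thesis using UY by (auto simp: initial_lift_def)
qed

subsection \<open>Products and tensors over sets\<close>

lemma list_all2_mem_iff:
  "list_all2 (\<in>) zs Xs \<longleftrightarrow> length zs = length Xs \<and> (\<forall>i < length Xs. zs ! i \<in> Xs ! i)"
  by (auto simp: list_all2_conv_all_nth)

lemma set_proj_in:
  assumes "\<And>X. X \<in> set Xs \<Longrightarrow> small X" "i < length Xs"
  shows "set_proj Xs i \<in> hom set_cat (tprod Xs) (Xs ! i)"
  using assms by (auto simp: set_hom_iff set_proj_def small_tprod tprod_iff list_all2_mem_iff)

lemma app_set_proj: "list_all2 (\<in>) zs Xs \<Longrightarrow> app (set_proj Xs i) (tup zs) = zs ! i"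
  by (simp add: set_proj_def)

lemma app_arrow2: "x \<in> X \<Longrightarrow> y \<in> Y \<Longrightarrow> app (arrow2 X Y h Z) (tup [x, y]) = h x y"
  by (simp add: arrow2_def)

lemma arrow2_in:
  assumes "small X" "small Y" "small Z" "\<And>x y. x \<in> X \<Longrightarrow> y \<in> Y \<Longrightarrow> h x y \<in> Z"
  shows "arrow2 X Y h Z \<in> hom set_cat (tprod [X, Y]) Z"
proof -
  have "small (tprod [X, Y])" using assms by (intro small_tprod) auto
  then show ?thesis
    using assms by (auto simp: set_hom_iff arrow2_def tprod_pair_iff simp del: tup_in_tprod)
qed

lemma id_ftor_simps [simp]: "FO id_ftor X = X" "FA id_ftor f = f"
  by (simp_all add: id_ftor_def)

lemma id_functor: "category C \<Longrightarrow> cat_functor C C id_ftor"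
  by (simp add: cat_functor_def cat_functor_axioms_def)

text \<open>Over the identity functor, being admissible means being an arrow, so \<open>X\<close>
  itself lifts every source out of \<open>X\<close>. This is what makes classical signatures a case
  of enriched ones.\<close>

lemma topological_set_cat:
  "topological (set_cat :: ('u::set_universe set, 'u set_arrow) cat) set_cat id_ftor"
proof -
  have adm: "admissible set_cat id_ftor X Y f \<longleftrightarrow> f \<in> hom set_cat X Y"
    for X Y :: "'u set" and f
    by (auto simp: admissible_def)
  have "initial_lift set_cat set_cat id_ftor X src X"
    if "structured_source set_cat set_cat id_ftor X src" for X :: "'u set" and src
    using that unfolding initial_lift_def initial_source_def structured_source_def
    by (auto simp: adm dest: set_cmp_in)
  then show ?thesis
    unfolding topological_def concrete_def faithful_def amnestic_def
    using id_functor[OF category_set_cat] by auto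
qed

section \<open>Finite products lying over cartesian products of sets\<close>

locale topological_monoidal =
  fixes V :: "('v, 'm) cat"
    and U :: "('v, 'm, 'u::set_universe set, 'u set_arrow) ftor"
    and M :: "('v, 'm) monoidal"
  assumes topological: "topological V set_cat U"
    and monoidal: "strict_symmetric_monoidal_ftor V M set_cat set_cartesian U"
begin

sublocale U: cat_functor V set_cat U
  using topological by (simp add: topological_def concrete_def)

lemma faithful: "faithful V U"
  using topological by (simp add: topological_def concrete_def)

lemma amnestic: "amnestic V set_cat U"
  using topological by (simp add: topological_def)

lemma initial_lift_exists:
  "structured_source V set_cat U X src \<Longrightarrow> \<exists>W. initial_lift V set_cat U X src W"
  using topological by (simp add: topological_def)

lemma small_FO: "X \<in> Obj V \<Longrightarrow> small (FO U X)"
  using U.fo_in by simp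

lemma small_tprod_FO: "set Xs \<subseteq> Obj V \<Longrightarrow> small (tprod (map (FO U) Xs))"
  using small_FO by (intro small_tprod) auto

lemma set_proj_FO_in:
  assumes "set Xs \<subseteq> Obj V" "i < length Xs"
  shows "set_proj (map (FO U) Xs) i \<in> hom set_cat (tprod (map (FO U) Xs)) (FO U (Xs ! i))"
  using set_proj_in[of "map (FO U) Xs" i] small_FO assms by auto

text \<open>The condition in \<open>prodO\<close> with the projections as an explicit argument, so
  that a product can be handled together with its cone.\<close>

definition set_product :: "'v list \<Rightarrow> 'v \<Rightarrow> (nat \<Rightarrow> 'm) \<Rightarrow> bool"
  where "set_product Xs P p \<longleftrightarrow> FO U P = tprod (map (FO U) Xs) \<and> product_cone V Xs P p \<and>
    (\<forall>i < length Xs. FA U (p i) = set_proj (map (FO U) Xs) i)"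

lemma set_productD:
  assumes "set_product Xs P p"
  shows "P \<in> Obj V" "FO U P = tprod (map (FO U) Xs)"
    and "i < length Xs \<Longrightarrow> p i \<in> hom V P (Xs ! i) \<and> FA U (p i) = set_proj (map (FO U) Xs) i"
    and "Q \<in> Obj V \<Longrightarrow> (\<And>i. i < length Xs \<Longrightarrow> q i \<in> hom V Q (Xs ! i)) \<Longrightarrow>
      \<exists>!h. h \<in> hom V Q P \<and> (\<forall>i < length Xs. Cmp V (p i) h = q i)"
  using assms by (simp_all add: set_product_def product_cone_def)

text \<open>The set-level candidate for the mediating arrow into a product; that it lifts is a
  matter of initiality.\<close>

lemma tuple_arrow:
  assumes "set Xs \<subseteq> Obj V" and Q: "Q \<in> Obj V"
    and q: "\<And>i. i < length Xs \<Longrightarrow> q i \<in> hom V Q (Xs ! i)"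
  defines "h \<equiv> Arrow (FO U Q) (\<lambda>x\<in>FO U Q. tup (map (\<lambda>i. app (FA U (q i)) x) [0..<length Xs]))
      (tprod (map (FO U) Xs))"
  shows "h \<in> hom set_cat (FO U Q) (tprod (map (FO U) Xs))"
    and "\<And>i. i < length Xs \<Longrightarrow> Cmp set_cat (set_proj (map (FO U) Xs) i) h = FA U (q i)"
proof -
  have mem: "list_all2 (\<in>) (map (\<lambda>i. app (FA U (q i)) x) [0..<length Xs]) (map (FO U) Xs)"
    if "x \<in> FO U Q" for x
    using app_in[OF U.fa_in[OF q] that] by (simp add: list_all2_mem_iff)
  show h: "h \<in> hom set_cat (FO U Q) (tprod (map (FO U) Xs))"
    using mem small_FO[OF Q] small_tprod_FO[OF assms(1)]
    by (auto simp: h_def set_hom_iff)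
  fix i assume i: "i < length Xs"
  have pr: "set_proj (map (FO U) Xs) i \<in> hom set_cat (tprod (map (FO U) Xs)) (FO U (Xs ! i))"
    by (rule set_proj_FO_in[OF assms(1) i])
  show "Cmp set_cat (set_proj (map (FO U) Xs) i) h = FA U (q i)"
  proof (rule set_arrow_eqI[OF set_cmp_in[OF h pr] U.fa_in[OF q[OF i]]])
    fix x assume x: "x \<in> FO U Q"
    have "app h x = tup (map (\<lambda>i. app (FA U (q i)) x) [0..<length Xs])"
      using x by (simp add: h_def)
    then show "app (Cmp set_cat (set_proj (map (FO U) Xs) i) h) x = app (FA U (q i)) x"
      using app_set_proj[OF mem[OF x], of i] i by (simp add: app_cmp[OF h pr x])
  qed
qed

text \<open>The initial lift of the cartesian projections is a product: composites of the tupling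
  with the projections are the underlying functions of the \<open>q i\<close>, so the tupling is
  admissible. Uniqueness compares coordinates and then uses faithfulness.\<close>

lemma set_product_exists:
  assumes Xs: "set Xs \<subseteq> Obj V"
  shows "\<exists>P p. set_product Xs P p"
proof -
  let ?Y = "map (FO U) Xs"
  let ?src = "{(Xs ! i, set_proj ?Y i) |i. i < length Xs}"
  have pr: "set_proj ?Y i \<in> hom set_cat (tprod ?Y) (FO U (Xs ! i))" if "i < length Xs" for i
    by (rule set_proj_FO_in[OF Xs that])
  have obj: "Xs ! i \<in> Obj V" if "i < length Xs" for i using Xs that by auto
  have "structured_source V set_cat U (tprod ?Y) ?src"
    using pr obj small_tprod_FO[OF Xs] by (auto simp: structured_source_def)
  then obtain P where P: "initial_lift V set_cat U (tprod ?Y) ?src P"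
    using initial_lift_exists by blast
  then have PO: "P \<in> Obj V" "FO U P = tprod ?Y" by (auto simp: initial_lift_def)
  have "admissible V U P (Xs ! i) (set_proj ?Y i)" if "i < length Xs" for i
    using P that unfolding initial_lift_def by auto
  then have "\<forall>i. \<exists>p. i < length Xs \<longrightarrow> p \<in> hom V P (Xs ! i) \<and> FA U p = set_proj ?Y i"
    unfolding admissible_def by metis
  then obtain p where p: "\<And>i. i < length Xs \<Longrightarrow> p i \<in> hom V P (Xs ! i) \<and> FA U (p i) = set_proj ?Y i"
    by metis
  have "\<exists>!h. h \<in> hom V Q P \<and> (\<forall>i < length Xs. Cmp V (p i) h = q i)"
    if Q: "Q \<in> Obj V" and q: "\<And>i. i < length Xs \<Longrightarrow> q i \<in> hom V Q (Xs ! i)" for Q q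
  proof -
    obtain h where h: "h \<in> hom set_cat (FO U Q) (tprod ?Y)"
      and hq: "\<And>i. i < length Xs \<Longrightarrow> Cmp set_cat (set_proj ?Y i) h = FA U (q i)"
      using tuple_arrow[OF Xs Q q] by metis
    have "\<forall>(W, f) \<in> ?src. admissible V U Q W (Cmp set_cat f h)"
      using hq q by (auto simp: admissible_def)
    then have "admissible V U Q P h"
      using P Q h PO unfolding initial_lift_def initial_source_def by auto
    then obtain k where k: "k \<in> hom V Q P" "FA U k = h" by (auto simp: admissible_def)
    show ?thesis
    proof (rule ex1I[of _ k])
      have "Cmp V (p i) k = q i" if i: "i < length Xs" for i
        by (rule faithfulD[OF faithful U.C.cmp_in[OF k(1)] q[OF i]])
          (use p[OF i] hq[OF i] k U.fa_cmp[OF k(1)] in auto)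
      then show "k \<in> hom V Q P \<and> (\<forall>i < length Xs. Cmp V (p i) k = q i)" using k by simp
    next
      fix l assume l: "l \<in> hom V Q P \<and> (\<forall>i < length Xs. Cmp V (p i) l = q i)"
      then have Ul: "FA U l \<in> hom set_cat (FO U Q) (tprod ?Y)" using U.fa_in PO by metis
      have "FA U l = FA U k"
      proof (rule set_arrow_eqI[OF Ul])
        show "FA U k \<in> hom set_cat (FO U Q) (tprod ?Y)" using k h by simp
        fix x assume x: "x \<in> FO U Q"
        obtain zs ws where zw: "app (FA U l) x = tup zs" "app (FA U k) x = tup ws"
          "list_all2 (\<in>) zs ?Y" "list_all2 (\<in>) ws ?Y"
          using app_in[OF Ul x] app_in[OF h x] k(2) by (auto simp: tprod_iff)
        have "zs ! i = ws ! i" if i: "i < length Xs" for i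
        proof -
          have "Cmp set_cat (set_proj ?Y i) (FA U l) = FA U (Cmp V (p i) l)"
            using l p[OF i] U.fa_cmp by metis
          also have "\<dots> = Cmp set_cat (set_proj ?Y i) h" using l hq[OF i] i by simp
          finally have "app (Cmp set_cat (set_proj ?Y i) (FA U l)) x = app (Cmp set_cat (set_proj ?Y i) h) x"
            by simp
          then show ?thesis
            using zw k(2) by (simp add: app_cmp[OF Ul pr[OF i] x] app_cmp[OF h pr[OF i] x] app_set_proj)
        qed
        moreover have "length zs = length Xs" "length ws = length Xs"
          using zw by (auto simp: list_all2_mem_iff)
        ultimately have "zs = ws" by (intro nth_equalityI) auto
        then show "app (FA U l) x = app (FA U k) x" using zw by simp
      qed
      then show "l = k" by (rule faithfulD[OF faithful conjunct1[OF l] k(1)])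
    qed
  qed
  then have "product_cone V Xs P p" using PO p unfolding product_cone_def by auto
  then show ?thesis using PO p unfolding set_product_def by blast
qed

text \<open>The comparison arrow from \<open>Q\<close> to \<open>P\<close> commutes with the same
  set projections on both sides, so its underlying function fixes every coordinate. With the roles
  exchanged as well, amnesticity identifies the two products.\<close>

lemma set_product_admissible:
  assumes Xs: "set Xs \<subseteq> Obj V" and P: "set_product Xs P p" and Q: "set_product Xs Q q"
  shows "admissible V U Q P (Ide set_cat (tprod (map (FO U) Xs)))"
proof -
  let ?Y = "map (FO U) Xs"
  note Po = set_productD[OF P] and Qo = set_productD[OF Q]
  have "\<exists>!h. h \<in> hom V Q P \<and> (\<forall>i < length Xs. Cmp V (p i) h = q i)"
    by (rule Po(4)[OF Qo(1) conjunct1[OF Qo(3)]])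
  then obtain h where h: "h \<in> hom V Q P" "\<And>i. i < length Xs \<Longrightarrow> Cmp V (p i) h = q i" by blast
  have Uh: "FA U h \<in> hom set_cat (tprod ?Y) (tprod ?Y)" using U.fa_in[OF h(1)] Po Qo by simp
  have "FA U h = Ide set_cat (tprod ?Y)"
  proof (rule set_arrow_eqI[OF Uh])
    show "Ide set_cat (tprod ?Y) \<in> hom set_cat (tprod ?Y) (tprod ?Y)"
      by (rule set_ide_in[OF small_tprod_FO[OF Xs]])
    fix x assume x: "x \<in> tprod ?Y"
    obtain zs ws where zw: "x = tup zs" "app (FA U h) x = tup ws"
      "list_all2 (\<in>) zs ?Y" "list_all2 (\<in>) ws ?Y"
      using app_in[OF Uh x] x by (auto simp: tprod_iff)
    have "ws ! i = zs ! i" if i: "i < length Xs" for i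
    proof -
      have Up: "set_proj ?Y i \<in> hom set_cat (tprod ?Y) (FO U (Xs ! i))"
        using U.fa_in Po(2) Po(3)[OF i] by metis
      have "Cmp set_cat (set_proj ?Y i) (FA U h) = FA U (Cmp V (p i) h)"
        using h(1) Po(3)[OF i] U.fa_cmp by metis
      also have "\<dots> = set_proj ?Y i" using h(2)[OF i] Qo(3)[OF i] by simp
      finally have "app (set_proj ?Y i) (app (FA U h) x) = app (set_proj ?Y i) x"
        using app_cmp[OF Uh Up x] by simp
      then show ?thesis using zw by (simp add: app_set_proj)
    qed
    moreover have "length zs = length Xs" "length ws = length Xs"
      using zw by (auto simp: list_all2_mem_iff)
    ultimately have "zs = ws" by (intro nth_equalityI) auto
    then show "app (FA U h) x = app (Ide set_cat (tprod ?Y)) x" using zw x by (simp add: app_ide)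
  qed
  then show ?thesis using h(1) by (auto simp: admissible_def)
qed

lemma set_product_unique:
  assumes Xs: "set Xs \<subseteq> Obj V" and P: "set_product Xs P p" and Q: "set_product Xs Q q"
  shows "P = Q"
proof -
  show ?thesis
    using amnestic set_product_admissible[OF Xs P Q] set_product_admissible[OF Xs Q P]
      set_productD(1,2)[OF P] set_productD(1,2)[OF Q]
    unfolding amnestic_def by auto
qed

lemma prodO_set_product:
  assumes Xs: "set Xs \<subseteq> Obj V"
  shows "\<exists>p. set_product Xs (prodO V U Xs) p"
proof -
  obtain P p where P: "set_product Xs P p" using set_product_exists[OF Xs] by blast
  have "prodO V U Xs = P"
    unfolding prodO_def
  proof (rule the_equality)
    show "FO U P = tprod (map (FO U) Xs) \<and> (\<exists>p. product_cone V Xs P p \<and>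
        (\<forall>i < length Xs. FA U (p i) = set_proj (map (FO U) Xs) i))"
      using P unfolding set_product_def by blast
    fix Q assume "FO U Q = tprod (map (FO U) Xs) \<and> (\<exists>p. product_cone V Xs Q p \<and>
        (\<forall>i < length Xs. FA U (p i) = set_proj (map (FO U) Xs) i))"
    then show "Q = P" using set_product_unique[OF Xs _ P] unfolding set_product_def by blast
  qed
  then show ?thesis using P by blast
qed

text \<open>The definite descriptions are legitimate: amnesticity fixes the object, and faithfulness
  fixes each projection by its underlying function. The existence of product arrows and their
  formula rest on these facts alone.\<close>

lemma
  assumes Xs: "set Xs \<subseteq> Obj V"
  shows prodO_in: "prodO V U Xs \<in> Obj V"
    and FO_prodO: "FO U (prodO V U Xs) = tprod (map (FO U) Xs)"
    and proj_in: "\<And>i. i < length Xs \<Longrightarrow> proj V U Xs i \<in> hom V (prodO V U Xs) (Xs ! i)"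
    and FA_proj: "\<And>i. i < length Xs \<Longrightarrow> FA U (proj V U Xs i) = set_proj (map (FO U) Xs) i"
    and prodO_universal: "\<And>Q q. Q \<in> Obj V \<Longrightarrow> (\<And>i. i < length Xs \<Longrightarrow> q i \<in> hom V Q (Xs ! i)) \<Longrightarrow>
      \<exists>!h. h \<in> hom V Q (prodO V U Xs) \<and> (\<forall>i < length Xs. Cmp V (proj V U Xs i) h = q i)"
proof -
  obtain p where p: "set_product Xs (prodO V U Xs) p" using prodO_set_product[OF Xs] by blast
  show "prodO V U Xs \<in> Obj V" "FO U (prodO V U Xs) = tprod (map (FO U) Xs)"
    by (rule set_productD[OF p])+
  have pi: "p i \<in> hom V (prodO V U Xs) (Xs ! i)" "FA U (p i) = set_proj (map (FO U) Xs) i"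
    if "i < length Xs" for i
    using set_productD(3)[OF p that] by simp_all
  have proj: "proj V U Xs i = p i" if i: "i < length Xs" for i
    unfolding proj_def
  proof (rule the_equality)
    fix p' assume p': "p' \<in> hom V (prodO V U Xs) (Xs ! i) \<and> FA U p' = set_proj (map (FO U) Xs) i"
    show "p' = p i" by (rule faithfulD[OF faithful _ pi(1)[OF i]]) (use p' pi(2)[OF i] in auto)
  qed (use pi[OF i] in simp)
  show "\<And>i. i < length Xs \<Longrightarrow> proj V U Xs i \<in> hom V (prodO V U Xs) (Xs ! i)"
    "\<And>i. i < length Xs \<Longrightarrow> FA U (proj V U Xs i) = set_proj (map (FO U) Xs) i"
    using proj pi by simp_all
  fix Q q
  assume "Q \<in> Obj V" and "\<And>i. i < length Xs \<Longrightarrow> q i \<in> hom V Q (Xs ! i)"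
  then have "\<exists>!h. h \<in> hom V Q (prodO V U Xs) \<and> (\<forall>i < length Xs. Cmp V (p i) h = q i)"
    by (rule set_productD(4)[OF p])
  then show "\<exists>!h. h \<in> hom V Q (prodO V U Xs) \<and> (\<forall>i < length Xs. Cmp V (proj V U Xs i) h = q i)"
    using proj by simp
qed

text \<open>A product arrow is pinned down by its composites with the projections; reading these
  composites on a coded tuple gives its value coordinate by coordinate.\<close>

lemma
  assumes f: "\<And>s. s \<in> set ss \<Longrightarrow> f s \<in> hom V (X s) (Y s)"
  shows prodA_in: "prodA V U (map f ss) \<in> hom V (prodO V U (map X ss)) (prodO V U (map Y ss))"
    and app_prodA: "list_all2 (\<in>) zs (map (\<lambda>s. FO U (X s)) ss) \<Longrightarrow>
      app (FA U (prodA V U (map f ss))) (tup zs) = tup (map2 (\<lambda>s. app (FA U (f s))) ss zs)"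
proof -
  let ?X = "map X ss" and ?Y = "map Y ss" and ?h = "prodA V U (map f ss)"
  have XY: "set ?X \<subseteq> Obj V" "set ?Y \<subseteq> Obj V" using U.C.hom_obj[OF f] by auto
  have DC: "map (Dom V) (map f ss) = ?X" "map (Cod V) (map f ss) = ?Y"
    using homD[OF f] by auto
  have pX: "proj V U ?X i \<in> hom V (prodO V U ?X) (X (ss ! i))"
    and pY: "proj V U ?Y i \<in> hom V (prodO V U ?Y) (Y (ss ! i))"
    and fi: "f (ss ! i) \<in> hom V (X (ss ! i)) (Y (ss ! i))" if "i < length ss" for i
    using proj_in[OF XY(1), of i] proj_in[OF XY(2), of i] f that by auto
  have "\<exists>!h. h \<in> hom V (prodO V U ?X) (prodO V U ?Y) \<and>
      (\<forall>i < length ?Y. Cmp V (proj V U ?Y i) h = Cmp V (f (ss ! i)) (proj V U ?X i))"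
  proof (rule prodO_universal[OF XY(2) prodO_in[OF XY(1)]])
    fix i assume "i < length ?Y"
    then show "Cmp V (f (ss ! i)) (proj V U ?X i) \<in> hom V (prodO V U ?X) (?Y ! i)"
      using U.C.cmp_in[OF pX fi] by simp
  qed
  then have "\<exists>!h. h \<in> hom V (prodO V U ?X) (prodO V U ?Y) \<and> (\<forall>i < length (map f ss).
      Cmp V (proj V U ?Y i) h = Cmp V (map f ss ! i) (proj V U ?X i))"
    by (simp cong: conj_cong)
  from theI'[OF this] have h: "?h \<in> hom V (prodO V U ?X) (prodO V U ?Y)"
    and hi: "\<And>i. i < length ss \<Longrightarrow> Cmp V (proj V U ?Y i) ?h = Cmp V (f (ss ! i)) (proj V U ?X i)"
    unfolding prodA_def DC by auto
  show "?h \<in> hom V (prodO V U ?X) (prodO V U ?Y)" by (rule h)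
  have FOX: "FO U (prodO V U ?X) = tprod (map (\<lambda>s. FO U (X s)) ss)"
    and FOY: "FO U (prodO V U ?Y) = tprod (map (\<lambda>s. FO U (Y s)) ss)"
    using FO_prodO[OF XY(1)] FO_prodO[OF XY(2)] by (simp_all add: comp_def)
  have FApX: "FA U (proj V U ?X i) = set_proj (map (\<lambda>s. FO U (X s)) ss) i"
    and FApY: "FA U (proj V U ?Y i) = set_proj (map (\<lambda>s. FO U (Y s)) ss) i"
    if "i < length ss" for i
    using FA_proj[OF XY(1), of i] FA_proj[OF XY(2), of i] that by (simp_all add: comp_def)
  assume zs: "list_all2 (\<in>) zs (map (\<lambda>s. FO U (X s)) ss)"
  then have z: "tup zs \<in> FO U (prodO V U ?X)" by (simp add: FOX)
  obtain ws where ws: "app (FA U ?h) (tup zs) = tup ws" "list_all2 (\<in>) ws (map (\<lambda>s. FO U (Y s)) ss)"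
    using app_in[OF U.fa_in[OF h] z] by (auto simp: FOY tprod_iff)
  have "ws ! i = app (FA U (f (ss ! i))) (zs ! i)" if i: "i < length ss" for i
  proof -
    have "app (FA U (proj V U ?Y i)) (app (FA U ?h) (tup zs))
        = app (FA U (f (ss ! i))) (app (FA U (proj V U ?X i)) (tup zs))"
      using arg_cong[OF hi[OF i], of "\<lambda>k. app (FA U k) (tup zs)"]
      by (simp add: U.fa_cmp[OF h pY[OF i]] U.fa_cmp[OF pX[OF i] fi[OF i]]
        app_cmp[OF U.fa_in[OF h] U.fa_in[OF pY[OF i]] z]
        app_cmp[OF U.fa_in[OF pX[OF i]] U.fa_in[OF fi[OF i]] z])
    then show ?thesis using i ws zs by (simp add: FApX FApY app_set_proj)
  qed
  moreover have "length ws = length ss" "length zs = length ss"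
    using ws zs by (auto simp: list_all2_mem_iff)
  ultimately have "ws = map2 (\<lambda>s. app (FA U (f s))) ss zs"
    by (intro nth_equalityI) auto
  then show "app (FA U ?h) (tup zs) = tup (map2 (\<lambda>s. app (FA U (f s))) ss zs)" using ws by simp
qed

lemma monoidal_V: "symmetric_monoidal V M"
  using monoidal by (simp add: strict_symmetric_monoidal_ftor_def)

lemma FO_TenO: "a \<in> Obj V \<Longrightarrow> b \<in> Obj V \<Longrightarrow> FO U (TenO M a b) = tprod [FO U a, FO U b]"
  using monoidal by (simp add: strict_symmetric_monoidal_ftor_def set_cartesian_def)

lemma TenO_in: "a \<in> Obj V \<Longrightarrow> b \<in> Obj V \<Longrightarrow> TenO M a b \<in> Obj V"
  by (rule symmetric_monoidal.tenO_in[OF monoidal_V])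

text \<open>Strict monoidality makes the underlying function of a tensor the cartesian one, which
  can be evaluated on coded pairs.\<close>

lemma
  assumes P: "P \<in> Obj V" and f: "f \<in> hom V a b"
  shows TenA_in: "TenA M (Ide V P) f \<in> hom V (TenO M P a) (TenO M P b)"
    and app_TenA: "p \<in> FO U P \<Longrightarrow> x \<in> FO U a \<Longrightarrow>
      app (FA U (TenA M (Ide V P) f)) (tup [p, x]) = tup [p, app (FA U f) x]"
proof -
  have I: "Ide V P \<in> hom V P P" by (rule U.C.ide_in[OF P])
  show "TenA M (Ide V P) f \<in> hom V (TenO M P a) (TenO M P b)"
    by (rule symmetric_monoidal.tenA_in[OF monoidal_V I f])
  assume p: "p \<in> FO U P" and x: "x \<in> FO U a"
  have "FA U (TenA M (Ide V P) f) = TenA set_cartesian (FA U (Ide V P)) (FA U f)"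
    using monoidal homD(1)[OF I] homD(1)[OF f] by (simp add: strict_symmetric_monoidal_ftor_def)
  also have "\<dots> = arrow2 (FO U P) (FO U a) (\<lambda>x y. tup [app (Ide set_cat (FO U P)) x, app (FA U f) y])
      (tprod [FO U P, FO U b])"
    using U.fa_in[OF f] U.fa_ide[OF P] by (simp add: set_cartesian_def set_hom_iff set_ide)
  finally show "app (FA U (TenA M (Ide V P) f)) (tup [p, x]) = tup [p, app (FA U f) x]"
    using p x by (simp add: app_arrow2 app_ide)
qed

end

subsection \<open>Algebras and their underlying classical algebras\<close>

locale enriched_signature = topological_monoidal V U M
  for V :: "('v, 'm) cat"
    and U :: "('v, 'm, 'u::set_universe set, 'u set_arrow) ftor"
    and M :: "('v, 'm) monoidal" +
  fixes Ss :: "'s set" and \<Sigma> :: "('u, 's, 'v) signature"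
  assumes signature: "is_signature V Ss \<Sigma>"
begin

abbreviation "Alg \<equiv> alg_cat V U M Ss \<Sigma>"
text \<open>Arguments are kept as lists and coded by \<open>tup\<close> only when an operation is
  applied. In this vocabulary the homomorphism law involves neither tensors nor product
  arrows.\<close>

abbreviation "args X \<sigma> \<equiv> listset (map (\<lambda>s. FO U (X s)) (arity \<Sigma> \<sigma>))"
abbreviation "act A \<sigma> p zs \<equiv> app (FA U (oper A \<sigma>)) (tup [p, tup zs])"
abbreviation "argmap f \<sigma> zs \<equiv> map2 (\<lambda>s. app (FA U (f s))) (arity \<Sigma> \<sigma>) zs"

lemma sigD:
  assumes "\<sigma> \<in> Ops \<Sigma>"
  shows "s \<in> set (arity \<Sigma> \<sigma>) \<Longrightarrow> s \<in> Ss" "out \<Sigma> \<sigma> \<in> Ss" "par \<Sigma> \<sigma> \<in> Obj V"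
  using signature assms by (auto simp: is_signature_def)

lemma small_Ops: "small (Ops \<Sigma>)"
  using signature by (simp add: is_signature_def)

lemma Alg_simps:
  "Obj Alg = algebras V U M Ss \<Sigma>" "Dom Alg = source" "Cod Alg = target"
  "Ide Alg A = Arrow A (Ide (power_cat Ss V) (carrier A)) A"
  "Cmp Alg h k = Arrow (source k) (Cmp (power_cat Ss V) (map_of_arrow h) (map_of_arrow k)) (target h)"
  by (simp_all add: alg_cat_def)

lemma Alg_hom_iff:
  "h \<in> hom Alg A B \<longleftrightarrow> (\<exists>f. h = Arrow A f B \<and> A \<in> Obj Alg \<and> B \<in> Obj Alg \<and>
    f \<in> alg_homs V U M Ss \<Sigma> A B)"
  by (cases h) (auto simp: hom_def alg_cat_def)

section \<open>Operations and homomorphisms on elements\<close>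

lemma domain_obj:
  assumes X: "X \<in> Obj (power_cat Ss V)" and \<sigma>: "\<sigma> \<in> Ops \<Sigma>"
  defines "D \<equiv> TenO M (par \<Sigma> \<sigma>) (prodO V U (map X (arity \<Sigma> \<sigma>)))"
  shows "D \<in> Obj V"
    and "FO U D = tprod [FO U (par \<Sigma> \<sigma>), tprod (map (\<lambda>s. FO U (X s)) (arity \<Sigma> \<sigma>))]"
proof -
  have m: "set (map X (arity \<Sigma> \<sigma>)) \<subseteq> Obj V" using X sigD(1)[OF \<sigma>] by (auto simp: power_obj_iff)
  show "D \<in> Obj V" "FO U D = tprod [FO U (par \<Sigma> \<sigma>), tprod (map (\<lambda>s. FO U (X s)) (arity \<Sigma> \<sigma>))]"
    unfolding D_def using TenO_in[OF sigD(3)[OF \<sigma>] prodO_in[OF m]]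
      FO_TenO[OF sigD(3)[OF \<sigma>] prodO_in[OF m]] FO_prodO[OF m]
    by (simp_all add: comp_def)
qed

lemma domain_iff:
  "z \<in> tprod [P, tprod Xs] \<longleftrightarrow> (\<exists>p zs. z = tup [p, tup zs] \<and> p \<in> P \<and> zs \<in> listset Xs)"
  unfolding tprod_pair_iff tprod_iff[of _ Xs] listset_iff by blast

lemma
  assumes A: "A \<in> Obj Alg"
  shows alg_carrier: "carrier A \<in> Obj (power_cat Ss V)"
    and alg_oper: "\<sigma> \<in> Ops \<Sigma> \<Longrightarrow> oper A \<sigma> \<in> hom V
      (TenO M (par \<Sigma> \<sigma>) (prodO V U (map (carrier A) (arity \<Sigma> \<sigma>)))) (carrier A (out \<Sigma> \<sigma>))"
  using A by (auto simp: Alg_simps algebras_def power_cat_def)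

lemma alg_oper_set:
  assumes A: "A \<in> Obj Alg" and \<sigma>: "\<sigma> \<in> Ops \<Sigma>"
  shows "FA U (oper A \<sigma>) \<in> hom set_cat
    (tprod [FO U (par \<Sigma> \<sigma>), tprod (map (\<lambda>s. FO U (carrier A s)) (arity \<Sigma> \<sigma>))])
    (FO U (carrier A (out \<Sigma> \<sigma>)))"
  using U.fa_in[OF alg_oper[OF A \<sigma>]] domain_obj(2)[OF alg_carrier[OF A] \<sigma>] by simp

lemma act_in:
  assumes "A \<in> Obj Alg" "\<sigma> \<in> Ops \<Sigma>" "p \<in> FO U (par \<Sigma> \<sigma>)" "zs \<in> args (carrier A) \<sigma>"
  shows "act A \<sigma> p zs \<in> FO U (carrier A (out \<Sigma> \<sigma>))"
  using app_in[OF alg_oper_set[OF assms(1,2)]] assms(3,4) unfolding domain_iff by blast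

lemma argmap_in:
  assumes f: "f \<in> hom (power_cat Ss V) X Y" and \<sigma>: "\<sigma> \<in> Ops \<Sigma>" and zs: "zs \<in> args X \<sigma>"
  shows "argmap f \<sigma> zs \<in> args Y \<sigma>"
proof -
  have "app (FA U (f s)) z \<in> FO U (Y s)" if "s \<in> set (arity \<Sigma> \<sigma>)" "z \<in> FO U (X s)" for s z
    using app_in[OF U.fa_in[of "f s" "X s" "Y s"]] f sigD(1)[OF \<sigma>] that
    by (auto simp: power_hom_iff)
  then show ?thesis using zs by (auto simp: listset_iff list_all2_mem_iff)
qed

lemma
  assumes f: "f \<in> hom (power_cat Ss V) X Y" and \<sigma>: "\<sigma> \<in> Ops \<Sigma>"
  defines "k \<equiv> TenA M (Ide V (par \<Sigma> \<sigma>)) (prodA V U (map f (arity \<Sigma> \<sigma>)))"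
  shows domain_map_in: "k \<in> hom V (TenO M (par \<Sigma> \<sigma>) (prodO V U (map X (arity \<Sigma> \<sigma>))))
      (TenO M (par \<Sigma> \<sigma>) (prodO V U (map Y (arity \<Sigma> \<sigma>))))"
    and app_domain_map: "p \<in> FO U (par \<Sigma> \<sigma>) \<Longrightarrow> zs \<in> args X \<sigma> \<Longrightarrow>
      app (FA U k) (tup [p, tup zs]) = tup [p, tup (argmap f \<sigma> zs)]"
proof -
  have fs: "f s \<in> hom V (X s) (Y s)" if "s \<in> set (arity \<Sigma> \<sigma>)" for s
    using f sigD(1)[OF \<sigma> that] by (simp add: power_hom_iff)
  have k: "prodA V U (map f (arity \<Sigma> \<sigma>))
      \<in> hom V (prodO V U (map X (arity \<Sigma> \<sigma>))) (prodO V U (map Y (arity \<Sigma> \<sigma>)))"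
    by (rule prodA_in[OF fs])
  show "k \<in> hom V (TenO M (par \<Sigma> \<sigma>) (prodO V U (map X (arity \<Sigma> \<sigma>))))
      (TenO M (par \<Sigma> \<sigma>) (prodO V U (map Y (arity \<Sigma> \<sigma>))))"
    unfolding k_def by (rule TenA_in[OF sigD(3)[OF \<sigma>] k])
  assume p: "p \<in> FO U (par \<Sigma> \<sigma>)" and zs: "zs \<in> args X \<sigma>"
  have m: "set (map X (arity \<Sigma> \<sigma>)) \<subseteq> Obj V" using U.C.hom_obj[OF fs] by auto
  have "tup zs \<in> FO U (prodO V U (map X (arity \<Sigma> \<sigma>)))"
    using zs by (simp add: FO_prodO[OF m] listset_iff comp_def)
  moreover have "app (FA U (prodA V U (map f (arity \<Sigma> \<sigma>)))) (tup zs) = tup (argmap f \<sigma> zs)"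
    using zs unfolding listset_iff by (intro app_prodA[OF fs])
  ultimately show "app (FA U k) (tup [p, tup zs]) = tup [p, tup (argmap f \<sigma> zs)]"
    unfolding k_def using app_TenA[OF sigD(3)[OF \<sigma>] k p] by simp
qed

text \<open>Both composites are parallel arrows of \<open>V\<close>, so by faithfulness they may be
  compared as functions, and the elements of their domain are exactly the codes of a parameter with
  an argument list. Homomorphisms are verified in this form from here on.\<close>

lemma alg_homs_iff:
  assumes A: "A \<in> Obj Alg" and B: "B \<in> Obj Alg"
  shows "f \<in> alg_homs V U M Ss \<Sigma> A B \<longleftrightarrow> f \<in> hom (power_cat Ss V) (carrier A) (carrier B) \<and>
    (\<forall>\<sigma>\<in>Ops \<Sigma>. \<forall>p\<in>FO U (par \<Sigma> \<sigma>). \<forall>zs\<in>args (carrier A) \<sigma>.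
      app (FA U (f (out \<Sigma> \<sigma>))) (act A \<sigma> p zs) = act B \<sigma> p (argmap f \<sigma> zs))"
proof -
  have "Cmp V (f (out \<Sigma> \<sigma>)) (oper A \<sigma>) =
      Cmp V (oper B \<sigma>) (TenA M (Ide V (par \<Sigma> \<sigma>)) (prodA V U (map f (arity \<Sigma> \<sigma>)))) \<longleftrightarrow>
    (\<forall>p\<in>FO U (par \<Sigma> \<sigma>). \<forall>zs\<in>args (carrier A) \<sigma>.
      app (FA U (f (out \<Sigma> \<sigma>))) (act A \<sigma> p zs) = act B \<sigma> p (argmap f \<sigma> zs))"
    (is "?l = ?r \<longleftrightarrow> _")
    if f: "f \<in> hom (power_cat Ss V) (carrier A) (carrier B)" and \<sigma>: "\<sigma> \<in> Ops \<Sigma>" for \<sigma>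
  proof -
    have fo: "f (out \<Sigma> \<sigma>) \<in> hom V (carrier A (out \<Sigma> \<sigma>)) (carrier B (out \<Sigma> \<sigma>))"
      using f sigD(2)[OF \<sigma>] by (simp add: power_hom_iff)
    note k = domain_map_in[OF f \<sigma>]
    note l = U.C.cmp_in[OF alg_oper[OF A \<sigma>] fo] and r = U.C.cmp_in[OF k alg_oper[OF B \<sigma>]]
    note dom = domain_obj(2)[OF alg_carrier[OF A] \<sigma>]
    have app: "app (FA U ?l) (tup [p, tup zs]) = app (FA U (f (out \<Sigma> \<sigma>))) (act A \<sigma> p zs)"
      "app (FA U ?r) (tup [p, tup zs]) = act B \<sigma> p (argmap f \<sigma> zs)"
      if "p \<in> FO U (par \<Sigma> \<sigma>)" "zs \<in> args (carrier A) \<sigma>" for p zs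
    proof -
      have z: "tup [p, tup zs] \<in> FO U (TenO M (par \<Sigma> \<sigma>) (prodO V U (map (carrier A) (arity \<Sigma> \<sigma>))))"
        using that unfolding dom domain_iff by blast
      show "app (FA U ?l) (tup [p, tup zs]) = app (FA U (f (out \<Sigma> \<sigma>))) (act A \<sigma> p zs)"
        by (simp add: U.fa_cmp[OF alg_oper[OF A \<sigma>] fo]
          app_cmp[OF U.fa_in[OF alg_oper[OF A \<sigma>]] U.fa_in[OF fo] z])
      show "app (FA U ?r) (tup [p, tup zs]) = act B \<sigma> p (argmap f \<sigma> zs)"
        by (simp add: U.fa_cmp[OF k alg_oper[OF B \<sigma>]] app_domain_map[OF f \<sigma> that]
          app_cmp[OF U.fa_in[OF k] U.fa_in[OF alg_oper[OF B \<sigma>]] z])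
    qed
    have "?l = ?r \<longleftrightarrow> FA U ?l = FA U ?r" using faithfulD[OF faithful l r] by auto
    also have "\<dots> \<longleftrightarrow> (\<forall>z\<in>tprod [FO U (par \<Sigma> \<sigma>), tprod (map (\<lambda>s. FO U (carrier A s)) (arity \<Sigma> \<sigma>))].
        app (FA U ?l) z = app (FA U ?r) z)"
      using set_arrow_eqI[OF U.fa_in[OF l] U.fa_in[OF r]] unfolding dom by auto
    also have "\<dots> \<longleftrightarrow> (\<forall>p\<in>FO U (par \<Sigma> \<sigma>). \<forall>zs\<in>args (carrier A) \<sigma>.
        app (FA U ?l) (tup [p, tup zs]) = app (FA U ?r) (tup [p, tup zs]))"
      by (simp only: Ball_def domain_iff) blast
    finally show ?thesis using app by simp
  qed
  then show ?thesis unfolding alg_homs_def by auto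
qed

lemma Alg_homD:
  assumes "h \<in> hom Alg A B"
  shows "A \<in> Obj Alg" "B \<in> Obj Alg" "h = Arrow A (map_of_arrow h) B"
    and "map_of_arrow h \<in> hom (power_cat Ss V) (carrier A) (carrier B)"
    and "\<sigma> \<in> Ops \<Sigma> \<Longrightarrow> p \<in> FO U (par \<Sigma> \<sigma>) \<Longrightarrow> zs \<in> args (carrier A) \<sigma> \<Longrightarrow>
      app (FA U (map_of_arrow h (out \<Sigma> \<sigma>))) (act A \<sigma> p zs) = act B \<sigma> p (argmap (map_of_arrow h) \<sigma> zs)"
proof -
  show AB: "A \<in> Obj Alg" "B \<in> Obj Alg" and "h = Arrow A (map_of_arrow h) B"
    using assms by (auto simp: Alg_hom_iff)
  have "map_of_arrow h \<in> alg_homs V U M Ss \<Sigma> A B" using assms by (auto simp: Alg_hom_iff)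
  then show "map_of_arrow h \<in> hom (power_cat Ss V) (carrier A) (carrier B)"
    "\<sigma> \<in> Ops \<Sigma> \<Longrightarrow> p \<in> FO U (par \<Sigma> \<sigma>) \<Longrightarrow> zs \<in> args (carrier A) \<sigma> \<Longrightarrow>
      app (FA U (map_of_arrow h (out \<Sigma> \<sigma>))) (act A \<sigma> p zs) = act B \<sigma> p (argmap (map_of_arrow h) \<sigma> zs)"
    unfolding alg_homs_iff[OF AB] by blast+
qed

lemma Alg_homI:
  assumes "A \<in> Obj Alg" "B \<in> Obj Alg" "f \<in> hom (power_cat Ss V) (carrier A) (carrier B)"
    and "\<And>\<sigma> p zs. \<sigma> \<in> Ops \<Sigma> \<Longrightarrow> p \<in> FO U (par \<Sigma> \<sigma>) \<Longrightarrow> zs \<in> args (carrier A) \<sigma> \<Longrightarrow>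
      app (FA U (f (out \<Sigma> \<sigma>))) (act A \<sigma> p zs) = act B \<sigma> p (argmap f \<sigma> zs)"
  shows "Arrow A f B \<in> hom Alg A B"
proof -
  have "f \<in> alg_homs V U M Ss \<Sigma> A B" unfolding alg_homs_iff[OF assms(1,2)] using assms(3,4) by blast
  then show ?thesis using assms(1,2) unfolding Alg_hom_iff by blast
qed

lemma category_power_V: "category (power_cat Ss V)"
  by (rule category_power[OF U.C.category_axioms])

lemma argmap_ide:
  assumes "X \<in> Obj (power_cat Ss V)" "\<sigma> \<in> Ops \<Sigma>" "zs \<in> args X \<sigma>"
  shows "argmap (Ide (power_cat Ss V) X) \<sigma> zs = zs"
proof -
  have "FA U (Ide V (X s)) = Ide set_cat (FO U (X s))" if "s \<in> Ss" for s
    using assms(1) that U.fa_ide by (simp add: power_obj_iff)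
  then have "app (FA U (Ide (power_cat Ss V) X s)) z = z"
    if "s \<in> set (arity \<Sigma> \<sigma>)" "z \<in> FO U (X s)" for s z
    using sigD(1)[OF assms(2) that(1)] that(2) by (simp add: power_ide app_ide)
  then show ?thesis
    using assms(3) by (intro nth_equalityI) (auto simp: listset_iff list_all2_mem_iff)
qed

lemma app_power_cmp:
  assumes f: "f \<in> hom (power_cat Ss V) X Y" and g: "g \<in> hom (power_cat Ss V) Y Z"
    and s: "s \<in> Ss" and x: "x \<in> FO U (X s)"
  shows "app (FA U (Cmp (power_cat Ss V) g f s)) x = app (FA U (g s)) (app (FA U (f s)) x)"
proof -
  have fs: "f s \<in> hom V (X s) (Y s)" and gs: "g s \<in> hom V (Y s) (Z s)"
    using f g s by (auto simp: power_hom_iff)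
  show ?thesis
    using s by (simp add: power_cmp U.fa_cmp[OF fs gs] app_cmp[OF U.fa_in[OF fs] U.fa_in[OF gs] x])
qed

lemma argmap_cmp:
  assumes f: "f \<in> hom (power_cat Ss V) X Y" and g: "g \<in> hom (power_cat Ss V) Y Z"
    and "\<sigma> \<in> Ops \<Sigma>" "zs \<in> args X \<sigma>"
  shows "argmap (Cmp (power_cat Ss V) g f) \<sigma> zs = argmap g \<sigma> (argmap f \<sigma> zs)"
  using assms(4) app_power_cmp[OF f g sigD(1)[OF assms(3)]]
  by (intro nth_equalityI) (auto simp: listset_iff list_all2_mem_iff)

lemma category_Alg: "category Alg"
proof -
  interpret P: category "power_cat Ss V" by (rule category_power_V)
  show ?thesis
  proof
    fix f assume "f \<in> Arr Alg"
    then show "Dom Alg f \<in> Obj Alg" "Cod Alg f \<in> Obj Alg" by (auto simp: alg_cat_def)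
  next
    fix A assume A: "A \<in> Obj Alg"
    show "Ide Alg A \<in> hom Alg A A"
      unfolding Alg_simps
    proof (rule Alg_homI[OF A A P.ide_in[OF alg_carrier[OF A]]])
      fix \<sigma> p zs
      assume h: "\<sigma> \<in> Ops \<Sigma>" "p \<in> FO U (par \<Sigma> \<sigma>)" "zs \<in> args (carrier A) \<sigma>"
      have "carrier A (out \<Sigma> \<sigma>) \<in> Obj V"
        using alg_carrier[OF A] sigD(2)[OF h(1)] by (simp add: power_obj_iff)
      then show "app (FA U (Ide (power_cat Ss V) (carrier A) (out \<Sigma> \<sigma>))) (act A \<sigma> p zs)
          = act A \<sigma> p (argmap (Ide (power_cat Ss V) (carrier A)) \<sigma> zs)"
        unfolding argmap_ide[OF alg_carrier[OF A] h(1,3)]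
        using act_in[OF A h] sigD(2)[OF h(1)] by (simp add: power_ide U.fa_ide app_ide)
    qed
  next
    fix f A B assume f: "f \<in> hom Alg A B"
    note fD = Alg_homD[OF f]
    have "Cmp Alg (Arrow A (map_of_arrow f) B) (Ide Alg A) = Arrow A (map_of_arrow f) B"
      "Cmp Alg (Ide Alg B) (Arrow A (map_of_arrow f) B) = Arrow A (map_of_arrow f) B"
      by (simp_all add: Alg_simps P.cmp_ide_left[OF fD(4)] P.cmp_ide_right[OF fD(4)])
    then show "Cmp Alg f (Ide Alg A) = f" "Cmp Alg (Ide Alg B) f = f"
      unfolding fD(3)[symmetric] .
    fix g C assume g: "g \<in> hom Alg B C"
    note gD = Alg_homD[OF g]
    have st: "source f = A" "target f = B" "source g = B" "target g = C"
      using f g by (auto simp: Alg_hom_iff)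
    show "Cmp Alg g f \<in> hom Alg A C"
      unfolding Alg_simps st
    proof (rule Alg_homI[OF fD(1) gD(2) P.cmp_in[OF fD(4) gD(4)]])
      fix \<sigma> p zs
      assume h: "\<sigma> \<in> Ops \<Sigma>" "p \<in> FO U (par \<Sigma> \<sigma>)" "zs \<in> args (carrier A) \<sigma>"
      have "app (FA U (Cmp (power_cat Ss V) (map_of_arrow g) (map_of_arrow f) (out \<Sigma> \<sigma>))) (act A \<sigma> p zs)
          = app (FA U (map_of_arrow g (out \<Sigma> \<sigma>))) (act B \<sigma> p (argmap (map_of_arrow f) \<sigma> zs))"
        by (simp only: app_power_cmp[OF fD(4) gD(4) sigD(2)[OF h(1)] act_in[OF fD(1) h]] fD(5)[OF h])
      also have "\<dots> = act C \<sigma> p (argmap (map_of_arrow g) \<sigma> (argmap (map_of_arrow f) \<sigma> zs))"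
        by (rule gD(5)[OF h(1,2) argmap_in[OF fD(4) h(1,3)]])
      finally show "app (FA U (Cmp (power_cat Ss V) (map_of_arrow g) (map_of_arrow f) (out \<Sigma> \<sigma>))) (act A \<sigma> p zs)
          = act C \<sigma> p (argmap (Cmp (power_cat Ss V) (map_of_arrow g) (map_of_arrow f)) \<sigma> zs)"
        by (simp only: argmap_cmp[OF fD(4) gD(4) h(1,3)])
    qed
    fix h D assume h: "h \<in> hom Alg C D"
    show "Cmp Alg h (Cmp Alg g f) = Cmp Alg (Cmp Alg h g) f"
      using P.cmp_assoc[OF fD(4) gD(4) Alg_homD(4)[OF h]] by (simp add: Alg_simps)
  qed
qed

lemma forget_functor: "cat_functor Alg (power_cat Ss V) alg_forget"
proof -
  interpret P: category "power_cat Ss V" by (rule category_power_V)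
  interpret A: category Alg by (rule category_Alg)
  show ?thesis
  proof
    fix A assume "A \<in> Obj Alg"
    then show "FO alg_forget A \<in> Obj (power_cat Ss V)" by (simp add: alg_forget_def alg_carrier)
  next
    fix f A B assume "f \<in> hom Alg A B"
    then show "FA alg_forget f \<in> hom (power_cat Ss V) (FO alg_forget A) (FO alg_forget B)"
      by (simp add: alg_forget_def Alg_homD(4))
  qed (simp_all add: alg_forget_def Alg_simps)
qed

section \<open>The underlying classical signature and its algebras\<close>

lemma is_signature_under: "is_signature set_cat Ss (under_sig U \<Sigma>)"
proof -
  have "small (\<Union>\<sigma>\<in>Ops \<Sigma>. (\<lambda>p. tup [\<sigma>, p]) ` FO U (par \<Sigma> \<sigma>))"
    using small_Ops small_FO sigD(3) by (intro small_UN small_image) auto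
  moreover have "Ops (under_sig U \<Sigma>) = (\<Union>\<sigma>\<in>Ops \<Sigma>. (\<lambda>p. tup [\<sigma>, p]) ` FO U (par \<Sigma> \<sigma>))"
    by (auto simp: under_sig_def)
  ultimately show ?thesis
    using sigD(1,2) by (auto simp: is_signature_def under_sig_def intro: small_tprod)
qed

lemma enriched_signature_under:
  "enriched_signature set_cat id_ftor set_cartesian Ss (under_sig U \<Sigma>)"
proof
  show "strict_symmetric_monoidal_ftor set_cat set_cartesian set_cat set_cartesian
    (id_ftor :: ('u set, 'u set_arrow, 'u set, 'u set_arrow) ftor)"
    using monoidal id_functor[OF category_set_cat] by (simp add: strict_symmetric_monoidal_ftor_def)
qed (rule topological_set_cat is_signature_under)+

end

text \<open>The same theory is imported twice: unprefixed for \<Sigma> over \<open>V\<close>, and as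
  \<open>K\<close> for the underlying signature over sets with the identity functor.\<close>

locale under_signature = enriched_signature V U M Ss \<Sigma>
    + K: enriched_signature set_cat id_ftor set_cartesian Ss "under_sig U \<Sigma>"
  for V :: "('v, 'm) cat"
    and U :: "('v, 'm, 'u::set_universe set, 'u set_arrow) ftor"
    and M :: "('v, 'm) monoidal"
    and Ss :: "'s set" and \<Sigma> :: "('u, 's, 'v) signature"
begin

abbreviation "T \<equiv> under_ftor U Ss \<Sigma>"

lemma under_Ops_iff:
  "\<tau> \<in> Ops (under_sig U \<Sigma>) \<longleftrightarrow> (\<exists>\<sigma> p. \<tau> = tup [\<sigma>, p] \<and> \<sigma> \<in> Ops \<Sigma> \<and> p \<in> FO U (par \<Sigma> \<sigma>))"
  by (auto simp: under_sig_def)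

lemma under_sig_simps [simp]:
  "arity (under_sig U \<Sigma>) (tup [\<sigma>, p]) = arity \<Sigma> \<sigma>"
  "out (under_sig U \<Sigma>) (tup [\<sigma>, p]) = out \<Sigma> \<sigma>"
  "par (under_sig U \<Sigma>) \<tau> = tprod []"
  by (simp_all add: under_sig_def)

lemma tprod_Nil: "tprod [] = {tup []}"
  by (simp add: tprod_def)

lemma carrier_under: "carrier (under_alg U Ss \<Sigma> A) = FO (power_ftor Ss U) (carrier A)"
  by (simp add: under_alg_def power_ftor_simps)

text \<open>The family \<open>Y\<close> is arbitrary on purpose: it is the carrier of an underlying
  algebra in one use, and in another the carrier of a given classical algebra for which a lift is
  still being built.\<close>

lemma args_under:
  assumes "\<sigma> \<in> Ops \<Sigma>" "\<And>s. s \<in> Ss \<Longrightarrow> Y s = FO U (X s)"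
  shows "K.args Y (tup [\<sigma>, p]) = args X \<sigma>"
proof -
  have "map Y (arity \<Sigma> \<sigma>) = map (\<lambda>s. FO U (X s)) (arity \<Sigma> \<sigma>)"
    using sigD(1)[OF assms(1)] assms(2) by simp
  then show ?thesis unfolding under_sig_simps id_ftor_simps by (rule arg_cong)
qed

lemma argmap_under:
  assumes "\<sigma> \<in> Ops \<Sigma>" "zs \<in> args X \<sigma>" "\<And>s. s \<in> Ss \<Longrightarrow> g s = FA U (f s)"
  shows "K.argmap g (tup [\<sigma>, p]) zs = argmap f \<sigma> zs"
  using assms(2,3) sigD(1)[OF assms(1)]
  by (intro nth_equalityI) (auto simp: listset_iff list_all2_mem_iff)

text \<open>The parameter moves from the argument pair into the operation symbol;
  \<open>tup []\<close> is the only point of the parameter set of that symbol.\<close>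

lemma act_under:
  assumes "\<sigma> \<in> Ops \<Sigma>" "p \<in> FO U (par \<Sigma> \<sigma>)" "zs \<in> args (carrier A) \<sigma>"
  shows "K.act (under_alg U Ss \<Sigma> A) (tup [\<sigma>, p]) (tup []) zs = act A \<sigma> p zs"
proof -
  have "tup zs \<in> tprod (map (\<lambda>s. FO U (carrier A s)) (arity \<Sigma> \<sigma>))"
    using assms(3) by (simp add: listset_iff)
  moreover have "tup [\<sigma>, p] \<in> Ops (under_sig U \<Sigma>)" using assms by (auto simp: under_Ops_iff)
  ultimately show ?thesis
    by (simp add: under_alg_def Let_def app_arrow2 tprod_Nil del: tup_in_tprod)
qed

lemma K_domain:
  assumes "Y \<in> Obj (power_cat Ss set_cat)" "\<tau> \<in> Ops (under_sig U \<Sigma>)"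
  shows "TenO set_cartesian (par (under_sig U \<Sigma>) \<tau>)
      (prodO set_cat id_ftor (map Y (arity (under_sig U \<Sigma>) \<tau>)))
    = tprod [tprod [], tprod (map Y (arity (under_sig U \<Sigma>) \<tau>))]"
  using K.domain_obj(2)[OF assms] by simp

lemma under_alg_in:
  assumes A: "A \<in> Obj Alg"
  shows "under_alg U Ss \<Sigma> A \<in> Obj K.Alg"
proof -
  interpret R: cat_functor "power_cat Ss V" "power_cat Ss set_cat" "power_ftor Ss U"
    by (rule power_functor[OF U.cat_functor_axioms])
  let ?B = "under_alg U Ss \<Sigma> A"
  have c: "carrier ?B \<in> Obj (power_cat Ss set_cat)"
    unfolding carrier_under by (rule R.fo_in[OF alg_carrier[OF A]])
  have "oper ?B \<tau> \<in> hom set_cat (TenO set_cartesian (par (under_sig U \<Sigma>) \<tau>)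
      (prodO set_cat id_ftor (map (carrier ?B) (arity (under_sig U \<Sigma>) \<tau>))))
      (carrier ?B (out (under_sig U \<Sigma>) \<tau>))" if \<tau>: "\<tau> \<in> Ops (under_sig U \<Sigma>)" for \<tau>
    unfolding K_domain[OF c \<tau>]
  proof -
    obtain \<sigma> p where \<sigma>: "\<tau> = tup [\<sigma>, p]" "\<sigma> \<in> Ops \<Sigma>" "p \<in> FO U (par \<Sigma> \<sigma>)"
      using \<tau> by (auto simp: under_Ops_iff)
    have m: "map (carrier ?B) (arity \<Sigma> \<sigma>) = map (\<lambda>s. FO U (carrier A s)) (arity \<Sigma> \<sigma>)"
      using sigD(1)[OF \<sigma>(2)] by (simp add: under_alg_def)
    have o: "carrier ?B (out \<Sigma> \<sigma>) = FO U (carrier A (out \<Sigma> \<sigma>))"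
      using sigD(2)[OF \<sigma>(2)] by (simp add: under_alg_def)
    have sm: "small (FO U (carrier A s))" if "s \<in> Ss" for s
      using alg_carrier[OF A] that small_FO by (simp add: power_obj_iff)
    have "oper ?B \<tau> = arrow2 (tprod []) (tprod (map (\<lambda>s. FO U (carrier A s)) (arity \<Sigma> \<sigma>)))
        (\<lambda>u z. app (FA U (oper A \<sigma>)) (tup [p, z])) (FO U (carrier A (out \<Sigma> \<sigma>)))"
      using \<tau> \<sigma>(1) by (simp add: under_alg_def Let_def)
    also have "\<dots> \<in> hom set_cat (tprod [tprod [], tprod (map (\<lambda>s. FO U (carrier A s)) (arity \<Sigma> \<sigma>))])
        (FO U (carrier A (out \<Sigma> \<sigma>)))"
    proof (rule arrow2_in)
      show "small (tprod (map (\<lambda>s. FO U (carrier A s)) (arity \<Sigma> \<sigma>)))"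
        using sm sigD(1)[OF \<sigma>(2)] by (intro small_tprod) auto
      show "small (FO U (carrier A (out \<Sigma> \<sigma>)))" using sm sigD(2)[OF \<sigma>(2)] by simp
      fix x y assume "y \<in> tprod (map (\<lambda>s. FO U (carrier A s)) (arity \<Sigma> \<sigma>))"
      then show "app (FA U (oper A \<sigma>)) (tup [p, y]) \<in> FO U (carrier A (out \<Sigma> \<sigma>))"
        using app_in[OF alg_oper_set[OF A \<sigma>(2)]] \<sigma>(3) unfolding tprod_pair_iff by blast
    qed (simp add: tprod_Nil small_singleton)
    finally show "oper ?B \<tau> \<in> hom set_cat
        (tprod [tprod [], tprod (map (carrier ?B) (arity (under_sig U \<Sigma>) \<tau>))])
        (carrier ?B (out (under_sig U \<Sigma>) \<tau>))"
      by (simp add: \<sigma>(1) m o)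
  qed
  moreover have "oper ?B \<in> extensional (Ops (under_sig U \<Sigma>))" by (simp add: under_alg_def)
  ultimately show ?thesis
    using c by (auto simp: K.Alg_simps algebras_def PiE_iff power_obj_iff)
qed

text \<open>One enriched law, read for all parameters \<open>p\<close>, is the family of classical
  laws for the symbols \<open>tup [\<sigma>, p]\<close>. The homomorphism property is therefore
  decided by the underlying function.\<close>

lemma Alg_hom_under_iff:
  assumes A: "A \<in> Obj Alg" and B: "B \<in> Obj Alg"
    and f: "f \<in> hom (power_cat Ss V) (carrier A) (carrier B)"
  shows "Arrow A f B \<in> hom Alg A B \<longleftrightarrow>
    Arrow (under_alg U Ss \<Sigma> A) (FA (power_ftor Ss U) f) (under_alg U Ss \<Sigma> B)
      \<in> hom K.Alg (under_alg U Ss \<Sigma> A) (under_alg U Ss \<Sigma> B)" (is "?L \<longleftrightarrow> ?R")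
proof -
  interpret R: cat_functor "power_cat Ss V" "power_cat Ss set_cat" "power_ftor Ss U"
    by (rule power_functor[OF U.cat_functor_axioms])
  let ?A = "under_alg U Ss \<Sigma> A" and ?B = "under_alg U Ss \<Sigma> B" and ?f = "FA (power_ftor Ss U) f"
  have Rf: "?f \<in> hom (power_cat Ss set_cat) (carrier ?A) (carrier ?B)"
    unfolding carrier_under by (rule R.fa_in[OF f])
  have f_at: "?f s = FA U (f s)" if "s \<in> Ss" for s using that by (simp add: power_ftor_simps)
  have cA: "carrier ?A s = FO U (carrier A s)" if "s \<in> Ss" for s
    using that by (simp add: under_alg_def)
  have eqs: "app (?f (out \<Sigma> \<sigma>)) (K.act ?A (tup [\<sigma>, p]) (tup []) zs)
        = app (FA U (f (out \<Sigma> \<sigma>))) (act A \<sigma> p zs)"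
      "K.act ?B (tup [\<sigma>, p]) (tup []) (K.argmap ?f (tup [\<sigma>, p]) zs) = act B \<sigma> p (argmap f \<sigma> zs)"
    if h: "\<sigma> \<in> Ops \<Sigma>" "p \<in> FO U (par \<Sigma> \<sigma>)" "zs \<in> args (carrier A) \<sigma>" for \<sigma> p zs
  proof -
    have "K.argmap ?f (tup [\<sigma>, p]) zs = argmap f \<sigma> zs"
      by (rule argmap_under[OF h(1,3)]) (rule f_at)
    then show "app (?f (out \<Sigma> \<sigma>)) (K.act ?A (tup [\<sigma>, p]) (tup []) zs)
        = app (FA U (f (out \<Sigma> \<sigma>))) (act A \<sigma> p zs)"
      "K.act ?B (tup [\<sigma>, p]) (tup []) (K.argmap ?f (tup [\<sigma>, p]) zs) = act B \<sigma> p (argmap f \<sigma> zs)"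
      using act_under[OF h] f_at[OF sigD(2)[OF h(1)]] act_under[OF h(1,2) argmap_in[OF f h(1,3)]]
      by (simp_all del: map_eq_conv)
  qed
  show ?thesis
  proof
    assume L: ?L
    show ?R
    proof (rule K.Alg_homI[OF under_alg_in[OF A] under_alg_in[OF B] Rf])
      fix \<tau> q zs
      assume \<tau>: "\<tau> \<in> Ops (under_sig U \<Sigma>)" and q: "q \<in> FO id_ftor (par (under_sig U \<Sigma>) \<tau>)"
        and zs: "zs \<in> K.args (carrier ?A) \<tau>"
      obtain \<sigma> p where h: "\<tau> = tup [\<sigma>, p]" "\<sigma> \<in> Ops \<Sigma>" "p \<in> FO U (par \<Sigma> \<sigma>)"
        using \<tau> by (auto simp: under_Ops_iff)
      have zs': "zs \<in> args (carrier A) \<sigma>" using zs args_under[OF h(2) cA] unfolding h(1) by simp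
      have q': "q = tup []" using q by (simp add: tprod_Nil)
      show "app (FA id_ftor (?f (out (under_sig U \<Sigma>) \<tau>))) (K.act ?A \<tau> q zs)
          = K.act ?B \<tau> q (K.argmap ?f \<tau> zs)"
        using eqs[OF h(2,3) zs'] Alg_homD(5)[OF L h(2,3) zs'] unfolding h(1) q' by simp
    qed
  next
    assume R: ?R
    show ?L
    proof (rule Alg_homI[OF A B f])
      fix \<sigma> p zs
      assume h: "\<sigma> \<in> Ops \<Sigma>" "p \<in> FO U (par \<Sigma> \<sigma>)" "zs \<in> args (carrier A) \<sigma>"
      have "tup [\<sigma>, p] \<in> Ops (under_sig U \<Sigma>)" using h by (auto simp: under_Ops_iff)
      moreover have "zs \<in> K.args (carrier ?A) (tup [\<sigma>, p])" using h args_under[OF h(1) cA] by simp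
      ultimately show "app (FA U (f (out \<Sigma> \<sigma>))) (act A \<sigma> p zs) = act B \<sigma> p (argmap f \<sigma> zs)"
        using K.Alg_homD(5)[OF R, of "tup [\<sigma>, p]" "tup []" zs] eqs[OF h] by (simp add: tprod_Nil)
    qed
  qed
qed

lemma T_simps: "FO T A = under_alg U Ss \<Sigma> A"
  "FA T h = Arrow (under_alg U Ss \<Sigma> (source h)) (FA (power_ftor Ss U) (map_of_arrow h))
    (under_alg U Ss \<Sigma> (target h))"
  by (simp_all add: under_ftor_def power_ftor_simps)

lemma T_functor: "cat_functor Alg K.Alg T"
proof -
  interpret R: cat_functor "power_cat Ss V" "power_cat Ss set_cat" "power_ftor Ss U"
    by (rule power_functor[OF U.cat_functor_axioms])
  interpret A: category Alg by (rule category_Alg)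
  interpret KA: category K.Alg by (rule K.category_Alg)
  show ?thesis
  proof
    fix A assume A: "A \<in> Obj Alg"
    show "FO T A \<in> Obj K.Alg" by (simp add: T_simps under_alg_in[OF A])
    show "FA T (Ide Alg A) = Ide K.Alg (FO T A)"
      by (simp add: T_simps Alg_simps K.Alg_simps carrier_under R.fa_ide[OF alg_carrier[OF A]])
  next
    fix f A B assume f: "f \<in> hom Alg A B"
    note fD = Alg_homD[OF f]
    have st: "source f = A" "target f = B" using f by (auto simp: Alg_hom_iff)
    show "FA T f \<in> hom K.Alg (FO T A) (FO T B)"
      using Alg_hom_under_iff[OF fD(1,2,4)] f unfolding T_simps st fD(3)[symmetric] by simp
    fix g C assume g: "g \<in> hom Alg B C"
    show "FA T (Cmp Alg g f) = Cmp K.Alg (FA T g) (FA T f)"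
      by (simp add: T_simps Alg_simps K.Alg_simps R.fa_cmp[OF fD(4) Alg_homD(4)[OF g]])
  qed
qed

lemma square: "ftor_eq Alg (comp_ftor alg_forget T) (comp_ftor (power_ftor Ss U) alg_forget)"
  by (simp add: ftor_eq_def comp_ftor_def alg_forget_def T_simps carrier_under)

lemma T_faithful: "faithful Alg T"
  unfolding faithful_def
proof (intro allI ballI impI)
  fix A B f g assume f: "f \<in> hom Alg A B" and g: "g \<in> hom Alg A B" and eq: "FA T f = FA T g"
  have "FA (power_ftor Ss U) (map_of_arrow f) = FA (power_ftor Ss U) (map_of_arrow g)"
    using arg_cong[OF eq, of map_of_arrow] by (simp add: T_simps)
  then have "map_of_arrow f = map_of_arrow g"
    by (rule faithfulD[OF power_faithful[OF faithful] Alg_homD(4)[OF f] Alg_homD(4)[OF g]])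
  then show "f = g" using Alg_homD(3)[OF f] Alg_homD(3)[OF g] by metis
qed

text \<open>Because the homomorphism property is visible below, an arrow of underlying algebras
  lifts as soon as its carrier map does. Amnesticity and initiality for algebras are reduced to
  carriers by this splitting.\<close>

lemma admissible_T_iff:
  assumes A: "A \<in> Obj Alg" and B: "B \<in> Obj Alg"
  shows "admissible Alg T A B h \<longleftrightarrow> h \<in> hom K.Alg (FO T A) (FO T B) \<and>
    admissible (power_cat Ss V) (power_ftor Ss U) (carrier A) (carrier B) (map_of_arrow h)"
    (is "?L \<longleftrightarrow> ?R")
proof
  assume ?L
  then obtain k where k: "k \<in> hom Alg A B" "FA T k = h" by (auto simp: admissible_def)
  have "h \<in> hom K.Alg (FO T A) (FO T B)"
    using cat_functor.fa_in[OF T_functor k(1)] k(2) by simp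
  moreover have "FA (power_ftor Ss U) (map_of_arrow k) = map_of_arrow h"
    using arg_cong[OF k(2), of map_of_arrow] by (simp add: T_simps)
  ultimately show ?R using Alg_homD(4)[OF k(1)] unfolding admissible_def by blast
next
  assume R: ?R
  then obtain f where f: "f \<in> hom (power_cat Ss V) (carrier A) (carrier B)"
    "FA (power_ftor Ss U) f = map_of_arrow h"
    by (auto simp: admissible_def)
  have h: "h = Arrow (under_alg U Ss \<Sigma> A) (FA (power_ftor Ss U) f) (under_alg U Ss \<Sigma> B)"
    using K.Alg_homD(3)[OF conjunct1[OF R]] f(2) by (simp add: T_simps)
  then have "Arrow A f B \<in> hom Alg A B"
    using Alg_hom_under_iff[OF A B f(1)] R by (simp add: T_simps)
  moreover have "FA T (Arrow A f B) = h" by (simp add: T_simps h)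
  ultimately show ?L unfolding admissible_def by blast
qed

text \<open>Every pair of a parameter and an argument list is seen by one of the symbols
  \<open>tup [\<sigma>, p]\<close>, so the underlying operations determine the function of each
  enriched one, and faithfulness returns to arrows of \<open>V\<close>. Equality of carriers is a
  separate assumption, since many objects may share an underlying set.\<close>

lemma under_alg_cong:
  assumes A: "A \<in> Obj Alg" and B: "B \<in> Obj Alg" and c: "carrier A = carrier B"
    and eq: "under_alg U Ss \<Sigma> A = under_alg U Ss \<Sigma> B"
  shows "A = B"
proof -
  have "oper A \<sigma> = oper B \<sigma>" if \<sigma>: "\<sigma> \<in> Ops \<Sigma>" for \<sigma>
  proof (rule faithfulD[OF faithful alg_oper[OF A \<sigma>]])
    show "oper B \<sigma> \<in> hom V (TenO M (par \<Sigma> \<sigma>) (prodO V U (map (carrier A) (arity \<Sigma> \<sigma>))))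
        (carrier A (out \<Sigma> \<sigma>))"
      unfolding c by (rule alg_oper[OF B \<sigma>])
    show "FA U (oper A \<sigma>) = FA U (oper B \<sigma>)"
    proof (rule set_arrow_eqI[OF alg_oper_set[OF A \<sigma>]])
      show "FA U (oper B \<sigma>) \<in> hom set_cat
          (tprod [FO U (par \<Sigma> \<sigma>), tprod (map (\<lambda>s. FO U (carrier A s)) (arity \<Sigma> \<sigma>))])
          (FO U (carrier A (out \<Sigma> \<sigma>)))"
        unfolding c by (rule alg_oper_set[OF B \<sigma>])
      fix z assume "z \<in> tprod [FO U (par \<Sigma> \<sigma>), tprod (map (\<lambda>s. FO U (carrier A s)) (arity \<Sigma> \<sigma>))]"
      then obtain p zs where z: "z = tup [p, tup zs]" "p \<in> FO U (par \<Sigma> \<sigma>)" "zs \<in> args (carrier A) \<sigma>"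
        unfolding domain_iff by blast
      then show "app (FA U (oper A \<sigma>)) z = app (FA U (oper B \<sigma>)) z"
        using act_under[OF \<sigma> z(2), of zs A] act_under[OF \<sigma> z(2), of zs B] c eq by simp
    qed
  qed
  then have "oper A = oper B"
    using A B by (intro extensionalityI[of _ "Ops \<Sigma>"]) (auto simp: Alg_simps algebras_def PiE_iff)
  then show ?thesis using c by (cases A; cases B) simp
qed

lemma T_amnestic: "amnestic Alg K.Alg T"
  unfolding amnestic_def
proof (intro ballI impI)
  fix A B assume A: "A \<in> Obj Alg" and B: "B \<in> Obj Alg" and eq: "FO T A = FO T B"
    and AB: "admissible Alg T A B (Ide K.Alg (FO T A))"
    and BA: "admissible Alg T B A (Ide K.Alg (FO T A))"
  have c: "FO (power_ftor Ss U) (carrier A) = FO (power_ftor Ss U) (carrier B)"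
    using arg_cong[OF eq, of carrier] by (simp add: T_simps carrier_under)
  have i: "map_of_arrow (Ide K.Alg (FO T A))
      = Ide (power_cat Ss set_cat) (FO (power_ftor Ss U) (carrier A))"
    by (simp add: K.Alg_simps T_simps carrier_under)
  have "carrier A = carrier B"
    using power_amnestic[OF amnestic, of Ss] alg_carrier[OF A] alg_carrier[OF B] c
      AB[unfolded admissible_T_iff[OF A B] i] BA[unfolded admissible_T_iff[OF B A] i]
    unfolding amnestic_def by blast
  then show "A = B" using under_alg_cong[OF A B] eq by (simp add: T_simps)
qed

section \<open>Initial lifts of sources of algebras\<close>

lemma T_lift_exists:
  assumes src: "structured_source Alg K.Alg T X src"
  shows "\<exists>A. initial_lift Alg K.Alg T X src A \<and>
    initial_lift (power_cat Ss V) (power_cat Ss set_cat) (power_ftor Ss U) (FO alg_forget X)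
      ((\<lambda>(W, h). (FO alg_forget W, FA alg_forget h)) ` src) (FO alg_forget A)"
proof -
  interpret R: cat_functor "power_cat Ss V" "power_cat Ss set_cat" "power_ftor Ss U"
    by (rule power_functor[OF U.cat_functor_axioms])
  interpret TF: cat_functor Alg K.Alg T by (rule T_functor)
  let ?csrc = "(\<lambda>(W, h). (FO alg_forget W, FA alg_forget h)) ` src"
  have X: "X \<in> Obj K.Alg" using src by (simp add: structured_source_def)
  have mem: "W \<in> Obj Alg" "h \<in> hom K.Alg X (FO T W)" if "(W, h) \<in> src" for W h
    using src that by (auto simp: structured_source_def)
  have hs: "map_of_arrow h s \<in> hom set_cat (carrier X s) (FO U (carrier W s))"
    if "(W, h) \<in> src" "s \<in> Ss" for W h s
    using K.Alg_homD(4)[OF mem(2)[OF that(1)]] that(2)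
    by (simp add: power_hom_iff T_simps carrier_under power_ftor_simps)
  have "\<exists>C. initial_lift V set_cat U (carrier X s) ((\<lambda>(W, f). (W s, f s)) ` ?csrc) C"
    if s: "s \<in> Ss" for s
  proof (rule initial_lift_exists)
    have "carrier X s \<in> Obj set_cat"
      using K.alg_carrier[OF X] s unfolding power_obj_iff by blast
    then show "structured_source V set_cat U (carrier X s) ((\<lambda>(W, f). (W s, f s)) ` ?csrc)"
      using hs[OF _ s] alg_carrier[OF mem(1)] s
      by (auto simp: structured_source_def alg_forget_def power_obj_iff)
  qed
  then obtain C0 where C0: "\<And>s. s \<in> Ss \<Longrightarrow>
      initial_lift V set_cat U (carrier X s) ((\<lambda>(W, f). (W s, f s)) ` ?csrc) (C0 s)"
    by metis
  \<comment> \<open>Off \<open>Ss\<close> the family has to be \<open>undefined\<close> in order to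
    be an object of the power.\<close>
  define C where "C = restrict C0 Ss"
  have Cl: "initial_lift V set_cat U (carrier X s) ((\<lambda>(W, f). (W s, f s)) ` ?csrc) (C s)"
    if "s \<in> Ss" for s using C0[OF that] that by (simp add: C_def)
  have lift: "initial_lift (power_cat Ss V) (power_cat Ss set_cat) (power_ftor Ss U) (carrier X) ?csrc C"
  proof (rule power_initial_lift[OF _ _ _ Cl])
    show "carrier X \<in> extensional Ss" using K.alg_carrier[OF X] by (simp add: power_obj_iff)
    show "C \<in> extensional Ss" by (simp add: C_def)
    fix W f assume "(W, f) \<in> ?csrc"
    then obtain A h where h: "(A, h) \<in> src" "W = carrier A" "f = map_of_arrow h"
      by (auto simp: alg_forget_def)
    then show "W \<in> extensional Ss \<and> f \<in> extensional Ss"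
      using alg_carrier[OF mem(1)[OF h(1)]] K.Alg_homD(4)[OF mem(2)[OF h(1)]]
      by (simp add: power_obj_iff power_hom_iff)
  qed
  then have C: "C \<in> Obj (power_cat Ss V)" "FO (power_ftor Ss U) C = carrier X"
    by (auto simp: initial_lift_def)
  have UC: "FO U (C s) = carrier X s" if "s \<in> Ss" for s
    using fun_cong[OF C(2), of s] that by (simp add: power_ftor_simps)
  have h_lift: "admissible (power_cat Ss V) (power_ftor Ss U) C (carrier W) (map_of_arrow h)"
    if "(W, h) \<in> src" for W h
    using lift that unfolding initial_lift_def alg_forget_def by auto
  have "\<exists>k. k \<in> hom V (TenO M (par \<Sigma> \<sigma>) (prodO V U (map C (arity \<Sigma> \<sigma>)))) (C (out \<Sigma> \<sigma>)) \<and>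
      (\<forall>p\<in>FO U (par \<Sigma> \<sigma>). \<forall>zs\<in>args C \<sigma>.
        app (FA U k) (tup [p, tup zs]) = K.act X (tup [\<sigma>, p]) (tup []) zs)"
    if \<sigma>: "\<sigma> \<in> Ops \<Sigma>" for \<sigma>
  proof -
    let ?D = "TenO M (par \<Sigma> \<sigma>) (prodO V U (map C (arity \<Sigma> \<sigma>)))"
    let ?Z = "tprod (map (\<lambda>s. FO U (C s)) (arity \<Sigma> \<sigma>))"
    \<comment> \<open>The classical operations of \<open>X\<close> for all symbols
      \<open>tup [\<sigma>, p]\<close> are glued into one function of \<open>p\<close> and
      \<open>z\<close>; the inner \<open>tup []\<close> fills their one-point parameter
      slot.\<close>
    define k where "k = arrow2 (FO U (par \<Sigma> \<sigma>)) ?Z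
      (\<lambda>p z. app (oper X (tup [\<sigma>, p])) (tup [tup [], z])) (FO U (C (out \<Sigma> \<sigma>)))"
    note D = domain_obj[OF C(1) \<sigma>]
    have Xact: "K.act X (tup [\<sigma>, p]) (tup []) zs \<in> FO U (C (out \<Sigma> \<sigma>))"
      if "p \<in> FO U (par \<Sigma> \<sigma>)" "zs \<in> args C \<sigma>" for p zs
    proof -
      have t: "tup [\<sigma>, p] \<in> Ops (under_sig U \<Sigma>)" using \<sigma> that by (auto simp: under_Ops_iff)
      have "zs \<in> K.args (carrier X) (tup [\<sigma>, p])"
        using that args_under[OF \<sigma>, of "carrier X" C] UC by simp
      then show ?thesis
        using K.act_in[OF X t, of "tup []" zs] UC[OF sigD(2)[OF \<sigma>]] by (simp add: tprod_Nil)
    qed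
    have appk: "app k (tup [p, tup zs]) = K.act X (tup [\<sigma>, p]) (tup []) zs"
      if "p \<in> FO U (par \<Sigma> \<sigma>)" "zs \<in> args C \<sigma>" for p zs
      using that by (simp add: k_def app_arrow2 listset_iff)
    have smC: "small (FO U (C s))" if "s \<in> Ss" for s
      using C(1) that small_FO by (simp add: power_obj_iff)
    have k: "k \<in> hom set_cat (FO U ?D) (FO U (C (out \<Sigma> \<sigma>)))"
      unfolding D(2) k_def
    proof (rule arrow2_in)
      show "small (FO U (par \<Sigma> \<sigma>))" by (rule small_FO[OF sigD(3)[OF \<sigma>]])
      show "small ?Z" using smC sigD(1)[OF \<sigma>] by (intro small_tprod) auto
      show "small (FO U (C (out \<Sigma> \<sigma>)))" by (rule smC[OF sigD(2)[OF \<sigma>]])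
      fix p z assume "p \<in> FO U (par \<Sigma> \<sigma>)" "z \<in> ?Z"
      then show "app (oper X (tup [\<sigma>, p])) (tup [tup [], z]) \<in> FO U (C (out \<Sigma> \<sigma>))"
        using Xact by (auto simp: tprod_iff listset_iff)
    qed
    \<comment> \<open>As \<open>h\<close> is a homomorphism into the underlying algebra of
      \<open>W\<close>, this composite also factors as the tensor of the parameter with the product
      of a lift \<open>l\<close> of \<open>h\<close>, followed by \<open>oper W \<sigma>\<close>; in
      this form it visibly lifts.\<close>
    have "admissible V U ?D (carrier W (out \<Sigma> \<sigma>)) (Cmp set_cat (map_of_arrow h (out \<Sigma> \<sigma>)) k)"
      if W: "(W, h) \<in> src" for W h
    proof -
      obtain l where l: "l \<in> hom (power_cat Ss V) C (carrier W)"
        "FA (power_ftor Ss U) l = map_of_arrow h"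
        using h_lift[OF W] by (auto simp: admissible_def)
      have l_at: "FA U (l s) = map_of_arrow h s" if "s \<in> Ss" for s
        using fun_cong[OF l(2), of s] that by (simp add: power_ftor_simps)
      note d = domain_map_in[OF l(1) \<sigma>] and o = alg_oper[OF mem(1)[OF W] \<sigma>]
      let ?d = "TenA M (Ide V (par \<Sigma> \<sigma>)) (prodA V U (map l (arity \<Sigma> \<sigma>)))"
      have ho: "map_of_arrow h (out \<Sigma> \<sigma>)
          \<in> hom set_cat (FO U (C (out \<Sigma> \<sigma>))) (FO U (carrier W (out \<Sigma> \<sigma>)))"
        using hs[OF W sigD(2)[OF \<sigma>]] UC[OF sigD(2)[OF \<sigma>]] by simp
      have "FA U (Cmp V (oper W \<sigma>) ?d) = Cmp set_cat (map_of_arrow h (out \<Sigma> \<sigma>)) k"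
      proof (rule set_arrow_eqI[OF U.fa_in[OF U.C.cmp_in[OF d o]] set_cmp_in[OF k ho]])
        fix z assume z: "z \<in> FO U ?D"
        then obtain p zs where pz: "z = tup [p, tup zs]" "p \<in> FO U (par \<Sigma> \<sigma>)" "zs \<in> args C \<sigma>"
          unfolding D(2) domain_iff by blast
        have t: "tup [\<sigma>, p] \<in> Ops (under_sig U \<Sigma>)" using \<sigma> pz by (auto simp: under_Ops_iff)
        have zsX: "zs \<in> K.args (carrier X) (tup [\<sigma>, p])"
          using pz args_under[OF \<sigma>, of "carrier X" C] UC by simp
        have am: "K.argmap (map_of_arrow h) (tup [\<sigma>, p]) zs = argmap l \<sigma> zs"
          by (rule argmap_under[OF \<sigma> pz(3)]) (simp add: l_at)
        have "app (FA U (Cmp V (oper W \<sigma>) ?d)) z = act W \<sigma> p (argmap l \<sigma> zs)"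
          unfolding U.fa_cmp[OF d o] app_cmp[OF U.fa_in[OF d] U.fa_in[OF o] z]
          by (simp only: pz(1) app_domain_map[OF l(1) \<sigma> pz(2,3)])
        also have "\<dots> = K.act (under_alg U Ss \<Sigma> W) (tup [\<sigma>, p]) (tup []) (argmap l \<sigma> zs)"
          by (rule act_under[symmetric, OF \<sigma> pz(2) argmap_in[OF l(1) \<sigma> pz(3)]])
        also have "\<dots> = app (map_of_arrow h (out \<Sigma> \<sigma>)) (K.act X (tup [\<sigma>, p]) (tup []) zs)"
          using K.Alg_homD(5)[OF mem(2)[OF W] t _ zsX, of "tup []"] am
          by (simp add: T_simps tprod_Nil del: map_eq_conv)
        also have "\<dots> = app (Cmp set_cat (map_of_arrow h (out \<Sigma> \<sigma>)) k) z"
          unfolding app_cmp[OF k ho z] by (simp only: pz(1) appk[OF pz(2,3)])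
        finally show "app (FA U (Cmp V (oper W \<sigma>) ?d)) z
            = app (Cmp set_cat (map_of_arrow h (out \<Sigma> \<sigma>)) k) z" .
      qed
      then show ?thesis using U.C.cmp_in[OF d o] unfolding admissible_def by blast
    qed
    then have "\<forall>(W, f)\<in>(\<lambda>(W, f). (W (out \<Sigma> \<sigma>), f (out \<Sigma> \<sigma>))) ` ?csrc.
        admissible V U ?D W (Cmp set_cat f k)"
      by (auto simp: alg_forget_def)
    \<comment> \<open>Initiality of the carrier at the output sort passes from the composites to
      \<open>k\<close> itself.\<close>
    then have "admissible V U ?D (C (out \<Sigma> \<sigma>)) k"
      using Cl[OF sigD(2)[OF \<sigma>]] D(1) k unfolding initial_lift_def initial_source_def by simp
    then show ?thesis using appk unfolding admissible_def by auto
  qed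
  then obtain op where op: "\<And>\<sigma>. \<sigma> \<in> Ops \<Sigma> \<Longrightarrow>
      op \<sigma> \<in> hom V (TenO M (par \<Sigma> \<sigma>) (prodO V U (map C (arity \<Sigma> \<sigma>)))) (C (out \<Sigma> \<sigma>))"
    and op_app: "\<And>\<sigma> p zs. \<sigma> \<in> Ops \<Sigma> \<Longrightarrow> p \<in> FO U (par \<Sigma> \<sigma>) \<Longrightarrow> zs \<in> args C \<sigma> \<Longrightarrow>
        app (FA U (op \<sigma>)) (tup [p, tup zs]) = K.act X (tup [\<sigma>, p]) (tup []) zs"
    by metis
  define A where "A = Algebra C (restrict op (Ops \<Sigma>))"
  have cA: "carrier A = C" by (simp add: A_def)
  have A: "A \<in> Obj Alg"
    using C(1) op by (auto simp: A_def Alg_simps algebras_def PiE_iff power_obj_iff)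
  \<comment> \<open>The lift has to lie over \<open>X\<close> exactly. Both families of operations
    are extensional, so agreement on coded arguments gives equality of the algebras.\<close>
  have TA: "FO T A = X"
  proof -
    let ?B = "under_alg U Ss \<Sigma> A"
    note B = under_alg_in[OF A]
    have c: "carrier ?B = carrier X" by (simp add: carrier_under cA C(2))
    have "oper ?B \<tau> = oper X \<tau>" if \<tau>: "\<tau> \<in> Ops (under_sig U \<Sigma>)" for \<tau>
    proof (rule set_arrow_eqI)
      show "oper X \<tau> \<in> hom set_cat (tprod [tprod [], tprod (map (carrier X) (arity (under_sig U \<Sigma>) \<tau>))])
          (carrier X (out (under_sig U \<Sigma>) \<tau>))"
        using K.alg_oper_set[OF X \<tau>] by simp
      show "oper ?B \<tau> \<in> hom set_cat (tprod [tprod [], tprod (map (carrier X) (arity (under_sig U \<Sigma>) \<tau>))])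
          (carrier X (out (under_sig U \<Sigma>) \<tau>))"
        using K.alg_oper_set[OF B \<tau>] by (simp add: c)
      fix z assume "z \<in> tprod [tprod [], tprod (map (carrier X) (arity (under_sig U \<Sigma>) \<tau>))]"
      then obtain zs where z: "z = tup [tup [], tup zs]" "zs \<in> K.args (carrier X) \<tau>"
        unfolding domain_iff by (auto simp: tprod_Nil)
      obtain \<sigma> p where h: "\<tau> = tup [\<sigma>, p]" "\<sigma> \<in> Ops \<Sigma>" "p \<in> FO U (par \<Sigma> \<sigma>)"
        using \<tau> by (auto simp: under_Ops_iff)
      have zs: "zs \<in> args C \<sigma>" using z(2) args_under[OF h(2), of "carrier X" C] UC unfolding h(1) by simp
      show "app (oper ?B \<tau>) z = app (oper X \<tau>) z"
        using act_under[OF h(2,3), of zs A] op_app[OF h(2,3) zs] zs h(2) cA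
        unfolding h(1) z(1) by (simp add: A_def)
    qed
    then have "oper ?B = oper X"
      using B X by (intro extensionalityI[of _ "Ops (under_sig U \<Sigma>)"])
        (auto simp: K.Alg_simps algebras_def PiE_iff)
    then show ?thesis using c by (cases "?B"; cases X) (simp add: T_simps)
  qed
  have adm: "admissible Alg T A W h" if "(W, h) \<in> src" for W h
    using mem[OF that] h_lift[OF that] by (simp add: admissible_T_iff[OF A] TA cA)
  \<comment> \<open>Only the converse direction uses initiality: by \<open>admissible_T_iff\<close>
    it is inherited from the carrier source \<open>lift\<close>, as \<open>f\<close> is already a
    classical homomorphism.\<close>
  have "initial_source Alg K.Alg T A src"
    unfolding initial_source_def
  proof (intro ballI)
    fix W f assume W: "W \<in> Obj Alg" and f: "f \<in> hom K.Alg (FO T W) (FO T A)"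
    show "admissible Alg T W A f \<longleftrightarrow>
        (\<forall>(V', f') \<in> src. admissible Alg T W V' (Cmp K.Alg f' f))"
    proof
      assume "admissible Alg T W A f"
      then show "\<forall>(V', f') \<in> src. admissible Alg T W V' (Cmp K.Alg f' f)"
        using TF.admissible_cmp adm by blast
    next
      assume *: "\<forall>(V', f') \<in> src. admissible Alg T W V' (Cmp K.Alg f' f)"
      have "admissible (power_cat Ss V) (power_ftor Ss U) (carrier W) V'
          (Cmp (power_cat Ss set_cat) f' (map_of_arrow f))" if m: "(V', f') \<in> ?csrc" for V' f'
      proof -
        obtain B h where h: "(B, h) \<in> src" "V' = carrier B" "f' = map_of_arrow h"
          using m by (auto simp: alg_forget_def)
        have "admissible Alg T W B (Cmp K.Alg h f)" using * h(1) by blast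
        then show ?thesis
          unfolding admissible_T_iff[OF W mem(1)[OF h(1)]] by (simp add: h K.Alg_simps)
      qed
      moreover have "map_of_arrow f \<in> hom (power_cat Ss set_cat)
          (FO (power_ftor Ss U) (carrier W)) (FO (power_ftor Ss U) C)"
        using K.Alg_homD(4)[OF f] by (simp add: T_simps carrier_under cA)
      ultimately have "admissible (power_cat Ss V) (power_ftor Ss U) (carrier W) C (map_of_arrow f)"
        using lift alg_carrier[OF W] unfolding initial_lift_def initial_source_def by blast
      then show "admissible Alg T W A f" using f by (simp add: admissible_T_iff[OF W A] cA)
    qed
  qed
  then have "initial_lift Alg K.Alg T X src A"
    using src A TA adm by (auto simp: initial_lift_def)
  then show ?thesis using lift cA by (auto simp: alg_forget_def)
qed

end

subsection \<open>Term algebras\<close>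

locale classical_signature = enriched_signature set_cat id_ftor set_cartesian Ss \<Omega>
  for Ss :: "'s set" and \<Omega> :: "('u::set_universe, 's) classical_signature" +
  assumes par: "\<tau> \<in> Ops \<Omega> \<Longrightarrow> par \<Omega> \<tau> = tprod []"
begin

lemma mem_par: "\<tau> \<in> Ops \<Omega> \<Longrightarrow> p \<in> FO id_ftor (par \<Omega> \<tau>) \<longleftrightarrow> p = tup []"
  by (simp add: par tprod_def)

lemma oper_hom_iff:
  assumes "X \<in> Obj (power_cat Ss set_cat)" "\<tau> \<in> Ops \<Omega>"
  shows "TenO set_cartesian (par \<Omega> \<tau>) (prodO set_cat id_ftor (map X (arity \<Omega> \<tau>)))
    = tprod [tprod [], tprod (map X (arity \<Omega> \<tau>))]"
  using domain_obj(2)[OF assms] by (simp add: par[OF assms(2)])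

text \<open>
  As \<open>Ss\<close> need not be small, the terms of all sorts together need not form a small set; the levels of
  bounded depth are small sort by sort.
\<close>

primrec term_level :: "('s \<Rightarrow> 'u set) \<Rightarrow> nat \<Rightarrow> 's \<Rightarrow> 'u set" where
  "term_level Y 0 s = (\<lambda>y. tup [y]) ` Y s"
| "term_level Y (Suc n) s = term_level Y n s \<union> (\<Union>\<tau>\<in>Ops \<Omega>.
    if out \<Omega> \<tau> = s then (\<lambda>z. tup [\<tau>, z]) ` tprod (map (term_level Y n) (arity \<Omega> \<tau>)) else {})"

lemma small_term_level:
  assumes "\<And>s. s \<in> Ss \<Longrightarrow> small (Y s)" "s \<in> Ss"
  shows "small (term_level Y n s)"
  using assms(2)
proof (induction n arbitrary: s)
  case 0
  then show ?case by (simp add: assms(1) small_image)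
next
  case (Suc n)
  have "small (tprod (map (term_level Y n) (arity \<Omega> \<tau>)))" if "\<tau> \<in> Ops \<Omega>" for \<tau>
    using Suc.IH sigD(1)[OF that] by (intro small_tprod) auto
  then show ?case
    using Suc small_Ops
    by (auto intro!: small_Un small_UN small_image small_empty intro: small_subset[OF small_Ops])
qed

text \<open>Arities are finite and the levels increase, so the arguments of a term occur together on
  one level.\<close>

lemma is_term_level: "is_term \<Omega> Y s t \<Longrightarrow> \<exists>n. t \<in> term_level Y n s"
proof (induction rule: is_term.induct)
  case (1 y s)
  then have "tup [y] \<in> term_level Y 0 s" by simp
  then show ?case by blast
next
  case (2 \<tau> ts)
  then obtain n where n: "\<And>i. i < length ts \<Longrightarrow> ts ! i \<in> term_level Y (n i) (arity \<Omega> \<tau> ! i)"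
    by metis
  \<comment> \<open>A common level for all arguments; inserting 0 keeps the maximum meaningful for
    symbols without arguments.\<close>
  define N where "N = Max (insert 0 (n ` {..<length ts}))"
  have le: "n i \<le> N" if "i < length ts" for i
    using that unfolding N_def by (intro Max_ge) auto
  have "term_level Y m s \<subseteq> term_level Y m' s" if "m \<le> m'" for m m' s
    using that by (rule lift_Suc_mono_le[of "\<lambda>k. term_level Y k s", rotated]) simp
  then have "ts ! i \<in> term_level Y N (arity \<Omega> \<tau> ! i)" if "i < length ts" for i
    using n le that by blast
  then have "list_all2 (\<in>) ts (map (term_level Y N) (arity \<Omega> \<tau>))"
    using 2(2) by (auto simp: list_all2_mem_iff)
  then have "tup [\<tau>, tup ts] \<in> term_level Y (Suc N) (out \<Omega> \<tau>)"
    using 2(1) by (auto intro!: bexI[of _ \<tau>])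
  then show ?case by blast
qed

lemma Term_iff: "s \<in> Ss \<Longrightarrow> t \<in> Term Ss \<Omega> Y s \<longleftrightarrow> is_term \<Omega> Y s t"
  by (simp add: Term_def)

lemma small_Term:
  assumes "\<And>s. s \<in> Ss \<Longrightarrow> small (Y s)" "s \<in> Ss"
  shows "small (Term Ss \<Omega> Y s)"
proof -
  have "Term Ss \<Omega> Y s \<subseteq> (\<Union>n. term_level Y n s)"
    using is_term_level by (auto simp: Term_iff[OF assms(2)])
  then show ?thesis
    by (rule small_subset[OF small_UN_nat[OF small_term_level[OF assms]], rotated])
qed

section \<open>The algebra of terms\<close>

lemma args_Term_iff:
  assumes "\<tau> \<in> Ops \<Omega>"
  shows "ts \<in> listset (map (Term Ss \<Omega> Y) (arity \<Omega> \<tau>)) \<longleftrightarrow>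
    length ts = length (arity \<Omega> \<tau>) \<and> (\<forall>i < length ts. is_term \<Omega> Y (arity \<Omega> \<tau> ! i) (ts ! i))"
  using sigD(1)[OF assms] by (auto simp: listset_iff list_all2_mem_iff Term_iff)

lemma is_term_op:
  assumes "\<tau> \<in> Ops \<Omega>" "ts \<in> args (Term Ss \<Omega> Y) \<tau>"
  shows "is_term \<Omega> Y (out \<Omega> \<tau>) (tup [\<tau>, tup ts])"
  using assms by (intro is_term.intros(2)) (simp_all add: args_Term_iff)

lemma Term_in: "Y \<in> Obj (power_cat Ss set_cat) \<Longrightarrow> Term Ss \<Omega> Y \<in> Obj (power_cat Ss set_cat)"
  using small_Term[of Y] by (auto simp: power_obj_iff) (simp add: Term_def)

lemma carrier_term_algebra: "carrier (term_algebra Ss \<Omega> Y) = Term Ss \<Omega> Y"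
  by (simp add: term_algebra_def)

lemma act_term_algebra:
  assumes "\<tau> \<in> Ops \<Omega>" "ts \<in> args (Term Ss \<Omega> Y) \<tau>"
  shows "act (term_algebra Ss \<Omega> Y) \<tau> (tup []) ts = tup [\<tau>, tup ts]"
proof -
  have "tup ts \<in> tprod (map (Term Ss \<Omega> Y) (arity \<Omega> \<tau>))" using assms(2) by (simp add: listset_iff)
  then show ?thesis
    using assms(1) by (simp add: term_algebra_def app_arrow2 tprod_def del: tup_in_tprod)
qed

lemma term_algebra_in:
  assumes Y: "Y \<in> Obj (power_cat Ss set_cat)"
  shows "term_algebra Ss \<Omega> Y \<in> Obj Alg"
proof -
  let ?T = "Term Ss \<Omega> Y"
  have T: "?T s \<in> Obj set_cat" if "s \<in> Ss" for s
    using Term_in[OF Y] that by (auto simp: power_obj_iff)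
  have "arrow2 (tprod []) (tprod (map ?T (arity \<Omega> \<tau>))) (\<lambda>u z. tup [\<tau>, z]) (?T (out \<Omega> \<tau>))
      \<in> hom set_cat (tprod [tprod [], tprod (map ?T (arity \<Omega> \<tau>))]) (?T (out \<Omega> \<tau>))"
    if \<tau>: "\<tau> \<in> Ops \<Omega>" for \<tau>
  proof (rule arrow2_in)
    show "small (tprod ([] :: 'u set list))" by (simp add: tprod_def small_singleton)
    show "small (tprod (map ?T (arity \<Omega> \<tau>)))" using T sigD(1)[OF \<tau>] by (intro small_tprod) auto
    show "small (?T (out \<Omega> \<tau>))" using T sigD(2)[OF \<tau>] by simp
    fix u z :: 'u assume "z \<in> tprod (map ?T (arity \<Omega> \<tau>))"
    then obtain ts where "z = tup ts" "ts \<in> args ?T \<tau>" by (auto simp: tprod_iff listset_iff)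
    then show "tup [\<tau>, z] \<in> ?T (out \<Omega> \<tau>)"
      using is_term_op[OF \<tau>] by (simp add: Term_iff[OF sigD(2)[OF \<tau>]])
  qed
  then show ?thesis
    using Term_in[OF Y]
    by (auto simp: Alg_simps algebras_def term_algebra_def power_cat_def oper_hom_iff[OF Term_in[OF Y]])
qed

lemma term_unit_in:
  assumes Y: "Y \<in> Obj (power_cat Ss set_cat)"
  shows "term_unit Ss \<Omega> Y \<in> hom (power_cat Ss set_cat) Y (Term Ss \<Omega> Y)"
  using Y Term_in[OF Y]
  by (auto simp: power_hom_iff power_obj_iff set_hom_iff term_unit_def Term_iff intro: is_term.intros(1))

section \<open>Evaluation and freeness of the term algebra\<close>

inductive eval_term :: "('s \<Rightarrow> 'u set) \<Rightarrow> ('u, 's) classical_algebra \<Rightarrow> ('s \<Rightarrow> 'u set_arrow) \<Rightarrow> 's \<Rightarrow> 'u \<Rightarrow> 'u \<Rightarrow> bool"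
  for Y B f where
    eval_const: "y \<in> Y s \<Longrightarrow> eval_term Y B f s (tup [y]) (app (f s) y)"
  | eval_op: "\<tau> \<in> Ops \<Omega> \<Longrightarrow> length ts = length (arity \<Omega> \<tau>) \<Longrightarrow> length bs = length ts \<Longrightarrow>
      (\<forall>i < length ts. eval_term Y B f (arity \<Omega> \<tau> ! i) (ts ! i) (bs ! i)) \<Longrightarrow>
      eval_term Y B f (out \<Omega> \<tau>) (tup [\<tau>, tup ts]) (app (oper B \<tau>) (tup [tup [], tup bs]))"

text \<open>Terms are codes in the universe and not a datatype, so evaluation is introduced as a
  relation and shown to be functional by induction. Injectivity of \<open>tup\<close> tells
  constants (length one) from applications (length two) and recovers symbol and arguments. The sort
  is an index because one code may be a constant of several sorts.\<close>

lemma eval_term_ex1: "is_term \<Omega> Y s t \<Longrightarrow> \<exists>!b. eval_term Y B f s t b"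
proof (induction rule: is_term.induct)
  case (1 y s)
  show ?case
  proof (rule ex1I[where a = "app (f s) y"])
    show "eval_term Y B f s (tup [y]) (app (f s) y)" by (rule eval_const[of y Y s B f, OF 1])
    fix b assume "eval_term Y B f s (tup [y]) b"
    then show "b = app (f s) y" by cases simp_all
  qed
next
  case (2 \<tau> ts)
  then obtain b where b: "\<And>i. i < length ts \<Longrightarrow> eval_term Y B f (arity \<Omega> \<tau> ! i) (ts ! i) (b i)"
    and u: "\<And>i c. i < length ts \<Longrightarrow> eval_term Y B f (arity \<Omega> \<tau> ! i) (ts ! i) c \<Longrightarrow> c = b i"
    by metis
  let ?bs = "map b [0..<length ts]"
  show ?case
  proof (rule ex1I[where a = "app (oper B \<tau>) (tup [tup [], tup ?bs])"])
    show "eval_term Y B f (out \<Omega> \<tau>) (tup [\<tau>, tup ts]) (app (oper B \<tau>) (tup [tup [], tup ?bs]))"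
      using b by (intro eval_op[OF 2(1,2)]) simp_all
    fix c assume "eval_term Y B f (out \<Omega> \<tau>) (tup [\<tau>, tup ts]) c"
    then show "c = app (oper B \<tau>) (tup [tup [], tup ?bs])"
    proof cases
      case (eval_op \<tau>' ts' cs)
      \<comment> \<open>Decoding identifies \<open>ts'\<close> with \<open>ts\<close>, so
        \<open>cs\<close> lists values of the same arguments, which are unique by induction.\<close>
      then have "cs = ?bs" using u by (intro nth_equalityI) auto
      then show ?thesis using eval_op by simp
    qed simp
  qed
qed

definition evaluate :: "('s \<Rightarrow> 'u set) \<Rightarrow> ('u, 's) classical_algebra \<Rightarrow> ('s \<Rightarrow> 'u set_arrow) \<Rightarrow> 's \<Rightarrow> 'u \<Rightarrow> 'u"
  where "evaluate Y B f s t = (THE b. eval_term Y B f s t b)"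

lemma evaluate: "is_term \<Omega> Y s t \<Longrightarrow> eval_term Y B f s t (evaluate Y B f s t)"
  unfolding evaluate_def by (rule theI'[OF eval_term_ex1])

lemma evaluate_eqI: "is_term \<Omega> Y s t \<Longrightarrow> eval_term Y B f s t b \<Longrightarrow> evaluate Y B f s t = b"
  using eval_term_ex1 evaluate by metis

lemma evaluate_const: "y \<in> Y s \<Longrightarrow> evaluate Y B f s (tup [y]) = app (f s) y"
  by (intro evaluate_eqI is_term.intros(1) eval_const)

lemma evaluate_op:
  assumes \<tau>: "\<tau> \<in> Ops \<Omega>" and ts: "ts \<in> args (Term Ss \<Omega> Y) \<tau>"
  shows "evaluate Y B f (out \<Omega> \<tau>) (tup [\<tau>, tup ts])
    = act B \<tau> (tup []) (map2 (evaluate Y B f) (arity \<Omega> \<tau>) ts)"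
  unfolding id_ftor_simps
  using ts evaluate
  by (intro evaluate_eqI[OF is_term_op[OF \<tau> ts]] eval_op[OF \<tau>]) (simp_all add: args_Term_iff[OF \<tau>])

lemma evaluate_in:
  assumes B: "B \<in> Obj Alg" and f: "f \<in> hom (power_cat Ss set_cat) Y (carrier B)"
  shows "is_term \<Omega> Y s t \<Longrightarrow> s \<in> Ss \<Longrightarrow> evaluate Y B f s t \<in> carrier B s"
proof (induction rule: is_term.induct)
  case (1 y s)
  then have "f s \<in> hom set_cat (Y s) (carrier B s)" using f by (simp add: power_hom_iff)
  then show ?case using 1 app_in by (simp add: evaluate_const)
next
  case (2 \<tau> ts)
  have ts: "ts \<in> args (Term Ss \<Omega> Y) \<tau>" using 2 by (simp add: args_Term_iff)
  have "map2 (evaluate Y B f) (arity \<Omega> \<tau>) ts \<in> args (carrier B) \<tau>"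
    using 2(2,3) sigD(1)[OF 2(1)] by (auto simp: listset_iff list_all2_mem_iff)
  then show ?case
    using act_in[OF B 2(1), of "tup []"] mem_par[OF 2(1)] by (simp add: evaluate_op[OF 2(1) ts])
qed

text \<open>The witness is evaluation: \<open>evaluate_op\<close> is its homomorphism law and
  \<open>evaluate_const\<close> its compatibility with the unit.\<close>

lemma sharp_exists:
  assumes Y: "Y \<in> Obj (power_cat Ss set_cat)" and B: "B \<in> Obj Alg"
    and f: "f \<in> hom (power_cat Ss set_cat) Y (carrier B)"
  shows "\<exists>h. h \<in> hom Alg (term_algebra Ss \<Omega> Y) B \<and>
    Cmp (power_cat Ss set_cat) (map_of_arrow h) (term_unit Ss \<Omega> Y) = f"
proof -
  interpret P: category "power_cat Ss set_cat" by (rule category_power[OF category_set_cat])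
  define e where "e = (\<lambda>s\<in>Ss. Arrow (Term Ss \<Omega> Y s) (\<lambda>t\<in>Term Ss \<Omega> Y s. evaluate Y B f s t) (carrier B s))"
  have app_e: "app (e s) t = evaluate Y B f s t" if "s \<in> Ss" "is_term \<Omega> Y s t" for s t
    using that by (simp add: e_def Term_iff)
  have e: "e \<in> hom (power_cat Ss set_cat) (Term Ss \<Omega> Y) (carrier B)"
    using Term_in[OF Y] alg_carrier[OF B] evaluate_in[OF B f]
    by (auto simp: power_hom_iff power_obj_iff set_hom_iff e_def Term_iff)
  have "Arrow (term_algebra Ss \<Omega> Y) e B \<in> hom Alg (term_algebra Ss \<Omega> Y) B"
  proof (rule Alg_homI[OF term_algebra_in[OF Y] B])
    show "e \<in> hom (power_cat Ss set_cat) (carrier (term_algebra Ss \<Omega> Y)) (carrier B)"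
      unfolding carrier_term_algebra by (rule e)
    fix \<tau> p ts
    assume \<tau>: "\<tau> \<in> Ops \<Omega>" and p: "p \<in> FO id_ftor (par \<Omega> \<tau>)"
      and "ts \<in> args (carrier (term_algebra Ss \<Omega> Y)) \<tau>"
    then have ts: "ts \<in> args (Term Ss \<Omega> Y) \<tau>" by (simp add: carrier_term_algebra)
    have p: "p = tup []" using p mem_par[OF \<tau>] by simp
    have "argmap e \<tau> ts = map2 (evaluate Y B f) (arity \<Omega> \<tau>) ts"
      using ts sigD(1)[OF \<tau>]
      by (intro nth_equalityI) (auto simp: args_Term_iff[OF \<tau>] app_e)
    then show "app (FA id_ftor (e (out \<Omega> \<tau>))) (act (term_algebra Ss \<Omega> Y) \<tau> p ts)
        = act B \<tau> p (argmap e \<tau> ts)"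
      using evaluate_op[OF \<tau> ts] app_e[OF sigD(2)[OF \<tau>] is_term_op[OF \<tau> ts]]
      unfolding p act_term_algebra[OF \<tau> ts] by (simp del: map_eq_conv)
  qed
  moreover have "Cmp (power_cat Ss set_cat) e (term_unit Ss \<Omega> Y) = f"
  proof (rule extensionalityI[of _ Ss])
    show "Cmp (power_cat Ss set_cat) e (term_unit Ss \<Omega> Y) \<in> extensional Ss" "f \<in> extensional Ss"
      using f by (simp_all add: power_cmp power_hom_iff)
    fix s assume s: "s \<in> Ss"
    have u: "term_unit Ss \<Omega> Y s \<in> hom set_cat (Y s) (Term Ss \<Omega> Y s)"
      and es: "e s \<in> hom set_cat (Term Ss \<Omega> Y s) (carrier B s)"
      and fs: "f s \<in> hom set_cat (Y s) (carrier B s)"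
      using term_unit_in[OF Y] e f s unfolding power_hom_iff by blast+
    have "Cmp set_cat (e s) (term_unit Ss \<Omega> Y s) = f s"
    proof (rule set_arrow_eqI[OF set_cmp_in[OF u es] fs])
      fix y assume y: "y \<in> Y s"
      then have "app (term_unit Ss \<Omega> Y s) y = tup [y]" using s by (simp add: term_unit_def)
      then show "app (Cmp set_cat (e s) (term_unit Ss \<Omega> Y s)) y = app (f s) y"
        unfolding app_cmp[OF u es y]
        using app_e[OF s is_term.intros(1)[of y Y s, OF y]] y by (simp add: evaluate_const)
    qed
    then show "Cmp (power_cat Ss set_cat) e (term_unit Ss \<Omega> Y) s = f s"
      using s by (simp add: power_cmp)
  qed
  ultimately show ?thesis
    by (intro exI[of _ "Arrow (term_algebra Ss \<Omega> Y) e B"]) simp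
qed

text \<open>Induction on terms: the hypothesis on the unit settles constants, and the two
  homomorphism laws settle applications.\<close>

lemma sharp_unique:
  assumes Y: "Y \<in> Obj (power_cat Ss set_cat)"
    and h: "h \<in> hom Alg (term_algebra Ss \<Omega> Y) B" and k: "k \<in> hom Alg (term_algebra Ss \<Omega> Y) B"
    and eq: "Cmp (power_cat Ss set_cat) (map_of_arrow h) (term_unit Ss \<Omega> Y)
      = Cmp (power_cat Ss set_cat) (map_of_arrow k) (term_unit Ss \<Omega> Y)"
  shows "h = k"
proof -
  let ?h = "map_of_arrow h" and ?k = "map_of_arrow k"
  have hk: "?h \<in> hom (power_cat Ss set_cat) (Term Ss \<Omega> Y) (carrier B)"
    "?k \<in> hom (power_cat Ss set_cat) (Term Ss \<Omega> Y) (carrier B)"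
    using Alg_homD(4)[OF h] Alg_homD(4)[OF k] by (simp_all add: carrier_term_algebra)
  have hks: "?h s \<in> hom set_cat (Term Ss \<Omega> Y s) (carrier B s)"
    "?k s \<in> hom set_cat (Term Ss \<Omega> Y s) (carrier B s)" if "s \<in> Ss" for s
    using hk that unfolding power_hom_iff by blast+
  have agree: "is_term \<Omega> Y s t \<Longrightarrow> s \<in> Ss \<Longrightarrow> app (?h s) t = app (?k s) t" for s t
  proof (induction rule: is_term.induct)
    case (1 y s)
    have u: "term_unit Ss \<Omega> Y s \<in> hom set_cat (Y s) (Term Ss \<Omega> Y s)"
      using term_unit_in[OF Y] 1(2) unfolding power_hom_iff by blast
    have "Cmp set_cat (?h s) (term_unit Ss \<Omega> Y s) = Cmp set_cat (?k s) (term_unit Ss \<Omega> Y s)"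
      using fun_cong[OF eq, of s] 1(2) by (simp add: power_cmp)
    then have "app (?h s) (app (term_unit Ss \<Omega> Y s) y) = app (?k s) (app (term_unit Ss \<Omega> Y s) y)"
      using app_cmp[OF u hks(1)[OF 1(2)] 1(1)] app_cmp[OF u hks(2)[OF 1(2)] 1(1)] by metis
    then show ?case using 1 by (simp add: term_unit_def)
  next
    case (2 \<tau> ts)
    have ts: "ts \<in> args (Term Ss \<Omega> Y) \<tau>" using 2 by (simp add: args_Term_iff)
    have am: "argmap ?h \<tau> ts = argmap ?k \<tau> ts"
      using 2(2,3) sigD(1)[OF 2(1)] by (intro nth_equalityI) auto
    have p: "tup [] \<in> FO id_ftor (par \<Omega> \<tau>)" using mem_par[OF 2(1)] by simp
    note ts' = ts[folded carrier_term_algebra]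
    show ?case
      using Alg_homD(5)[OF h 2(1) p ts'] Alg_homD(5)[OF k 2(1) p ts'] am
        act_term_algebra[OF 2(1) ts]
      by (simp del: map_eq_conv)
  qed
  have "?h = ?k"
  proof (rule extensionalityI[of _ Ss])
    show "?h \<in> extensional Ss" "?k \<in> extensional Ss" using hk by (simp_all add: power_hom_iff)
    fix s assume s: "s \<in> Ss"
    show "?h s = ?k s"
      by (rule set_arrow_eqI[OF hks[OF s]]) (use agree s in \<open>simp add: Term_iff\<close>)
  qed
  then show ?thesis using Alg_homD(3)[OF h] Alg_homD(3)[OF k] by metis
qed

lemma term_universal_arrows:
  "universal_arrows Alg (power_cat Ss set_cat) alg_forget (term_algebra Ss \<Omega>) (term_unit Ss \<Omega>)"
proof -
  interpret G: cat_functor Alg "power_cat Ss set_cat" alg_forget by (rule forget_functor)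
  show ?thesis
  proof
    fix Y assume Y: "Y \<in> Obj (power_cat Ss (set_cat :: ('u set, 'u set_arrow) cat))"
    show "term_algebra Ss \<Omega> Y \<in> Obj Alg" by (rule term_algebra_in[OF Y])
    show "term_unit Ss \<Omega> Y
        \<in> hom (power_cat Ss set_cat) Y (FO alg_forget (term_algebra Ss \<Omega> Y))"
      using term_unit_in[OF Y] by (simp add: alg_forget_def carrier_term_algebra)
    fix B f assume B: "B \<in> Obj Alg" and f: "f \<in> hom (power_cat Ss set_cat) Y (FO alg_forget B)"
    have f': "f \<in> hom (power_cat Ss set_cat) Y (carrier B)" using f by (simp add: alg_forget_def)
    show "\<exists>!h. h \<in> hom Alg (term_algebra Ss \<Omega> Y) B \<and>
        Cmp (power_cat Ss set_cat) (FA alg_forget h) (term_unit Ss \<Omega> Y) = f"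
      using sharp_exists[OF Y B f'] sharp_unique[OF Y, of _ B] by (auto simp: alg_forget_def)
  qed
qed

end

section \<open>The classical constants and the sources as instances of the general
  construction\<close>

lemma sharp_univ_map:
  "sharp Ss \<Omega> = univ_map (classical_alg_cat Ss \<Omega>) (power_cat Ss set_cat) alg_forget
    (term_algebra Ss \<Omega>) (term_unit Ss \<Omega>)"
  by (intro ext) (simp add: sharp_def univ_map_def)

lemma term_ftor_free:
  "term_ftor Ss \<Omega> = free_ftor (classical_alg_cat Ss \<Omega>) (power_cat Ss set_cat) alg_forget
    (term_algebra Ss \<Omega>) (term_unit Ss \<Omega>)"
  by (simp add: term_ftor_def free_ftor_def sharp_univ_map)

lemma term_counit_free:
  "term_counit Ss \<Omega> = free_counit (classical_alg_cat Ss \<Omega>) (power_cat Ss set_cat) alg_forget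
    (term_algebra Ss \<Omega>) (term_unit Ss \<Omega>)"
  by (intro ext) (simp add: term_counit_def free_counit_def sharp_univ_map alg_forget_def)

context under_signature
begin

abbreviation "\<Omega> \<equiv> under_sig U \<Sigma>"

text \<open>Algebras lie over \<open>V\<close> above and over sets below. The parameters of
  \<open>under_sig\<close> are one-point sets by definition, so term algebras supply the universal
  arrows of the lower adjunction.\<close>

sublocale taut_lift Alg "power_cat Ss V" K.Alg "power_cat Ss set_cat" alg_forget T
  "power_ftor Ss U" alg_forget "term_algebra Ss \<Omega>" "term_unit Ss \<Omega>"
proof -
  interpret C: classical_signature Ss \<Omega> by unfold_locales simp
  show "taut_lift Alg (power_cat Ss V) K.Alg (power_cat Ss set_cat) alg_forget T
      (power_ftor Ss U) alg_forget (term_algebra Ss \<Omega>) (term_unit Ss \<Omega>)"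
    by (intro taut_lift.intro taut_lift_axioms.intro forget_functor T_functor
        power_functor[OF U.cat_functor_axioms] C.term_universal_arrows T_faithful T_amnestic
        power_faithful[OF faithful] power_amnestic[OF amnestic] square T_lift_exists)
qed

lemma sharp_source_src: "sharp_source V U M Ss \<Sigma> X = src X"
  by (simp add: sharp_source_def src_def comma_def under_sharp_def sharp_univ_map)

lemma carrier_source_src:
  "carrier_source V U M Ss \<Sigma> X = (\<lambda>(W, h). (FO alg_forget W, FA alg_forget h)) ` src X"
  by (force simp: carrier_source_def src_def comma_def under_sharp_def sharp_univ_map)

end

theorem theorem3p2p1:
  fixes V :: "('v, 'm) cat"
    and U :: "('v, 'm, 'u::set_universe set, 'u set_arrow) ftor"
    and M :: "('v, 'm) monoidal"
    and Ss :: "'s set"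
    and \<Sigma> :: "('u, 's, 'v) signature"
  assumes "topological V set_cat U"
    and "symmetric_monoidal V M"
    and "strict_symmetric_monoidal_ftor V M set_cat set_cartesian U"
    and "is_signature V Ss \<Sigma>"
  shows "\<exists>F \<eta> \<epsilon>.
    adjunction (alg_cat V U M Ss \<Sigma>) (power_cat Ss V) F alg_forget \<eta> \<epsilon> \<and>
    adjunction_lifting
      (alg_cat V U M Ss \<Sigma>) (power_cat Ss V) F alg_forget \<eta> \<epsilon>
      (classical_alg_cat Ss (under_sig U \<Sigma>)) (power_cat Ss set_cat)
      (term_ftor Ss (under_sig U \<Sigma>)) alg_forget
      (term_unit Ss (under_sig U \<Sigma>)) (term_counit Ss (under_sig U \<Sigma>))
      (under_ftor U Ss \<Sigma>) (power_ftor Ss U) \<and>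
    ftor_eq (power_cat Ss V) (comp_ftor (under_ftor U Ss \<Sigma>) F)
      (comp_ftor (term_ftor Ss (under_sig U \<Sigma>)) (power_ftor Ss U)) \<and>
    (\<forall>X \<in> Obj (power_cat Ss V).
      (\<forall>A. initial_lift (alg_cat V U M Ss \<Sigma>) (classical_alg_cat Ss (under_sig U \<Sigma>))
          (under_ftor U Ss \<Sigma>)
          (FO (term_ftor Ss (under_sig U \<Sigma>)) (FO (power_ftor Ss U) X))
          (sharp_source V U M Ss \<Sigma> X) A
        \<longleftrightarrow> A = FO F X) \<and>
      (\<forall>B. initial_lift (power_cat Ss V) (power_cat Ss set_cat) (power_ftor Ss U)
          (Term Ss (under_sig U \<Sigma>) (FO (power_ftor Ss U) X))
          (carrier_source V U M Ss \<Sigma> X) B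
        \<longleftrightarrow> B = FO alg_forget (FO F X)))"
proof -
  interpret E: enriched_signature V U M Ss \<Sigma>
    using assms by unfold_locales
  interpret under_signature V U M Ss \<Sigma>
    using E.enriched_signature_axioms E.enriched_signature_under by (rule under_signature.intro)
  \<comment> \<open>Once the term functor and its counit are rewritten into the general form, this
    is the abstract \<open>lifting\<close>.\<close>
  interpret lifting: adjunction_lifting "alg_cat V U M Ss \<Sigma>" "power_cat Ss V" L.F alg_forget eta L.eps
    "classical_alg_cat Ss (under_sig U \<Sigma>)" "power_cat Ss set_cat"
    "term_ftor Ss (under_sig U \<Sigma>)" alg_forget
    "term_unit Ss (under_sig U \<Sigma>)" "term_counit Ss (under_sig U \<Sigma>)"
    "under_ftor U Ss \<Sigma>" "power_ftor Ss U"
    unfolding term_ftor_free term_counit_free by (rule lifting)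
  have FO: "FO L.F X = F0 X" for X by (simp add: free_ftor_def)
  have eq: "ftor_eq (power_cat Ss V) (comp_ftor (under_ftor U Ss \<Sigma>) L.F)
      (comp_ftor (term_ftor Ss (under_sig U \<Sigma>)) (power_ftor Ss U))"
    using lifting.lift_left by (simp add: ftor_eq_def)
  have "FO (term_ftor Ss (under_sig U \<Sigma>)) Y = term_algebra Ss (under_sig U \<Sigma>) Y"
    "FO alg_forget (term_algebra Ss (under_sig U \<Sigma>) Y) = Term Ss (under_sig U \<Sigma>) Y" for Y
    by (simp_all add: term_ftor_def alg_forget_def term_algebra_def)
  \<comment> \<open>\<open>F0_lift\<close> and \<open>GF0_lift\<close> are equivalences, so each
    domain is identified and shown to be the only one. The two equations just proved turn the
    generic domain of the carrier source into \<open>Term\<close>.\<close>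
  then have "(initial_lift (alg_cat V U M Ss \<Sigma>) (classical_alg_cat Ss (under_sig U \<Sigma>))
        (under_ftor U Ss \<Sigma>) (FO (term_ftor Ss (under_sig U \<Sigma>)) (FO (power_ftor Ss U) X))
        (sharp_source V U M Ss \<Sigma> X) A \<longleftrightarrow> A = FO L.F X) \<and>
      (initial_lift (power_cat Ss V) (power_cat Ss set_cat) (power_ftor Ss U)
        (Term Ss (under_sig U \<Sigma>) (FO (power_ftor Ss U) X)) (carrier_source V U M Ss \<Sigma> X) B
        \<longleftrightarrow> B = FO alg_forget (FO L.F X))" if "X \<in> Obj (power_cat Ss V)" for X A B
    using F0_lift[OF that] GF0_lift[OF that] by (simp add: FO sharp_source_src carrier_source_src)
  then show ?thesis
    using lifting.first.adjunction_axioms lifting.adjunction_lifting_axioms eq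
    by (intro exI[of _ L.F] exI[of _ eta] exI[of _ L.eps]) blast
qed

end
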